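(* Let $x_L<x_R$, let $p,b,f\in C^\infty[x_L,x_R]$ and $u_L,u_R\in\mathbb{R}$ be fixed (independent of $\varepsilon$). Assume that $p$ has at most finitely many zeros on $[x_L,x_R]$, all of them simple ($p(z)=0\Rightarrow p'(z)\neq 0$); that there is $\gamma_0>0$ with $b(x)-p'(x)\ge\gamma_0$ on $[x_L,x_R]$; and that there is a constant $b_0$ with $b(x)\ge b_0$ on $[x_L,x_R]$, where $b_0>0$ if $p$ has a zero in $[x_L,x_R]$ and $b_0\ge 0$ otherwise. (Thus exponential boundary layers, cusp-like interior layers at interior turning points, and layers at boundary turning points may occur.) For $0<\varepsilon\le 1$ let $u$ be the solution of $$-\varepsilon u''+p(x)u'+b(x)u=f(x),\quad x_L<x<x_R,\qquad u(x_L)=u_L,\ u(x_R)=u_R .$$ For a partition of $[x_L,x_R]$ of mesh size $h$ containing all singular points and all interior zeros of $p$, let $u_h$ be the strong solution of the approximate problem underlying the Petrov-Galerkin method with exact test functions, i.e. $u_h\in C^1[x_L,x_R]$, $u_h$ is $C^2$ on each mesh interval, and $$-\varepsilon u_h''+\bar p(x)u_h'+\bar b(x)u_h=\bar f(x)\ \text{ in the interior of each mesh interval},\qquad u_h(x_L)=u_L,\ u_h(x_R)=u_R,$$ where $\bar p,\bar b,\bar f$ are the piecewise approximations of $p,b,f$ described in the context. Let $e=u-u_h$. Then there is a constant $C$, independent of $h$ and $\varepsilon$, such that $$\|e\|_{L^2}\le\|e\|_\varepsilon\le Ch,\qquad\text{where } \|e\|_\varepsilon=\sqrt{\|e\|_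{L^2(x_L,x_R)}^2+\varepsilon\|e'\|_{L^2(x_L,x_R)}^2}.$$
   Context: Mesh: $x_L=x_0<x_1<\cdots<x_N=x_R$, $I_k=[x_{k-1},x_k]$, $h=\max_k(x_k-x_{k-1})$, $x_{k-1/2}=(x_{k-1}+x_k)/2$. Singular points: $s_1<\cdots<s_{m'}$ are (i) the interior zeros $z$ of $p$ with $\lambda=-b(z)/p'(z)\in(0,1]$, and (ii) the endpoints at which a boundary layer occurs, namely $x_R$ if $p(x_R)>0$, $x_L$ if $p(x_L)<0$ (exponential layers), and any endpoint at which $p$ vanishes (boundary turning point). Fix $\delta$ (independent of $h,\varepsilon$) with $0<\delta<\min_i|s_i-s_{i-1}|/3$ (any fixed $\delta>0$ if there are fewer than two singular points), and set $J_i=[s_i-\delta,s_i+\delta]$, $J_r=[x_L,x_R]\setminus\bigcup_i J_i$. Approximate coefficients: on each $I_k$, $$\bar p(x)=\begin{cases}p(x_{k-1/2}), & x_{k-1/2}\in J_r,\\ p'(x_k^* )(x-x_k^* )+p(x_k^* ), & x_{k-1/2}\in J_i \text{ for some } i,\end{cases}$$ where $x_k^*=s_i$ if $I_k$ is adjacent to (has as an endpoint) some singular point $s_i$, and $x_k^*=x_{k-1/2}$ otherwise; $\bar b(x)=b(x_{k-1/2})$ and $\bar f(x)=f(x_{k-1/2})$ on $I_k$. Relation to the Petrov-Galerkin finite element method (PGFEM): the trial space consists of continuous piecewise linear functions on the mesh, and the test space is spanned by the functions $\psi_i$, $1\le i\le N-1$, where $\psi_i$ is continuous, supported in $I_i\cup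 I_{i+1}$, satisfies exactly $-\varepsilon\psi_i''-\bar p\,\psi_i'+(\bar b-\bar p')\psi_i=0$ in the interiors of $I_i$ and $I_{i+1}$, with $\psi_i(x_i)=1$ and $\psi_i(x_j)=0$ for $j\ne i$. The discrete equations are $\varepsilon(u_h',v_h')+(\bar p u_h',v_h)+(\bar b u_h,v_h)=(\bar f,v_h)$ for all $v_h$ in the test space, with $u_h(x_L)=u_L$, $u_h(x_R)=u_R$, where $(\cdot,\cdot)$ is the $L^2(x_L,x_R)$ inner product. In the statement, $u_h$ denotes the strong solution of the underlying approximate problem.
   Formalization: When b_0=0 (p without zeros) the bound is claimed only for h≤h_0, with h_0>0 independent of ε and the mesh; for coarse meshes the claim fails, since the linearized p̄ may change sign while b̄=0, making u_h exponentially large in 1/ε. For b_0>0 all h are covered. *)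

theory Defs
  imports "HOL-Analysis.Analysis"
begin

text \<open>
  Class \<open>C\<^sup>k\<close> on a nondegenerate interval. Derivatives are taken within \<open>S\<close>, hence they are
  one-sided at those endpoints of the interval that belong to it; continuity of
  \<open>D 0, \<dots>, D (k - 1)\<close> follows from their differentiability.
\<close>

definition C_k_on :: "nat \<Rightarrow> real set \<Rightarrow> (real \<Rightarrow> real) \<Rightarrow> bool" where
  "C_k_on k S g \<longleftrightarrow>
     (\<exists>D :: nat \<Rightarrow> real \<Rightarrow> real.
        (\<forall>x\<in>S. D 0 x = g x) \<and>
        (\<forall>n<k. \<forall>x\<in>S. (D n has_real_derivative D (Suc n) x) (at x within S)) \<and>
        continuous_on S (D k))"

definition C_infinity_on :: "real set \<Rightarrow> (real \<Rightarrow> real) \<Rightarrow> bool" where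
  "C_infinity_on S g \<longleftrightarrow> (\<forall>k. C_k_on k S g)"

text \<open>The derivative on \<open>[a, b]\<close>, one-sided at \<open>a\<close> and \<open>b\<close>.\<close>

definition deriv_Icc :: "real \<Rightarrow> real \<Rightarrow> (real \<Rightarrow> real) \<Rightarrow> real \<Rightarrow> real" where
  "deriv_Icc a b g x = vector_derivative g (at x within {a..b})"

definition L2_norm :: "real \<Rightarrow> real \<Rightarrow> (real \<Rightarrow> real) \<Rightarrow> real" where
  "L2_norm a b g = sqrt (LINT x:{a<..<b}|lborel. (g x)\<^sup>2)"

definition energy_norm :: "real \<Rightarrow> real \<Rightarrow> real \<Rightarrow> (real \<Rightarrow> real) \<Rightarrow> real" where
  "energy_norm eps a b g = sqrt ((L2_norm a b g)\<^sup>2 + eps * (L2_norm a b (deriv g))\<^sup>2)"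

text \<open>
  Interior turning points with \<open>\<lambda> \<in> (0, 1]\<close>, endpoints carrying an exponential layer, and
  boundary turning points.
\<close>

definition singular_points ::
    "real \<Rightarrow> real \<Rightarrow> (real \<Rightarrow> real) \<Rightarrow> (real \<Rightarrow> real) \<Rightarrow> real set" where
  "singular_points xL xR p b =
     {z \<in> {xL<..<xR}. p z = 0 \<and> - b z / deriv_Icc xL xR p z \<in> {0<..1}}
     \<union> {z. z = xR \<and> p xR > 0} \<union> {z. z = xL \<and> p xL < 0}
     \<union> {z \<in> {xL, xR}. p z = 0}"

definition is_mesh :: "real \<Rightarrow> real \<Rightarrow> nat \<Rightarrow> (nat \<Rightarrow> real) \<Rightarrow> bool" where
  "is_mesh xL xR N X \<longleftrightarrow> X 0 = xL \<and> X N = xR \<and> (\<forall>k\<in>{1..N}. X (k - 1) < X k)"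

definition mesh_size :: "nat \<Rightarrow> (nat \<Rightarrow> real) \<Rightarrow> real" where
  "mesh_size N X = Max ((\<lambda>k. X k - X (k - 1)) ` {1..N})"

definition mesh_mid :: "(nat \<Rightarrow> real) \<Rightarrow> nat \<Rightarrow> real" where
  "mesh_mid X k = (X (k - 1) + X k) / 2"

definition regular_region :: "real \<Rightarrow> real \<Rightarrow> real set \<Rightarrow> real \<Rightarrow> real set" where
  "regular_region xL xR S \<delta> = {xL..xR} - (\<Union>s\<in>S. {s - \<delta>..s + \<delta>})"

text \<open>
  With \<open>\<delta>\<close> below a third of the minimal distance in \<open>S\<close>, and \<open>S\<close> contained in the mesh, the
  order of the two tests is irrelevant: if both endpoints of the mesh interval are in \<open>S\<close>,
  they are more than \<open>3 \<delta>\<close> apart and \<open>S\<close> contains no other point within \<open>\<delta>\<close> of the midpoint, so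
  the midpoint lies in \<open>regular_region\<close> and the value is not used.
\<close>

definition expansion_point :: "real set \<Rightarrow> (nat \<Rightarrow> real) \<Rightarrow> nat \<Rightarrow> real" where
  "expansion_point S X k =
     (if X (k - 1) \<in> S then X (k - 1) else if X k \<in> S then X k else mesh_mid X k)"

text \<open>The expression for the approximation of \<open>p\<close> on the \<open>k\<close>-th mesh interval.\<close>

definition p_bar ::
    "real \<Rightarrow> real \<Rightarrow> (real \<Rightarrow> real) \<Rightarrow> (real \<Rightarrow> real) \<Rightarrow> real \<Rightarrow> (nat \<Rightarrow> real) \<Rightarrow> nat \<Rightarrow> real \<Rightarrow> real" where
  "p_bar xL xR p b \<delta> X k x =
     (let S = singular_points xL xR p b; y = expansion_point S X k in
      if mesh_mid X k \<in> regular_region xL xR S \<delta> then p (mesh_mid X k)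
      else deriv_Icc xL xR p y * (x - y) + p y)"

text \<open>Classical solutions, of class \<open>C[xL, xR] \<inter> C\<^sup>2(xL, xR)\<close>.\<close>

definition exact_solution ::
    "real \<Rightarrow> real \<Rightarrow> (real \<Rightarrow> real) \<Rightarrow> (real \<Rightarrow> real) \<Rightarrow> (real \<Rightarrow> real) \<Rightarrow> real \<Rightarrow> real \<Rightarrow>
     real \<Rightarrow> (real \<Rightarrow> real) \<Rightarrow> bool" where
  "exact_solution xL xR p b f uL uR eps u \<longleftrightarrow>
     continuous_on {xL..xR} u \<and> C_k_on 2 {xL<..<xR} u \<and>
     (\<forall>x\<in>{xL<..<xR}. - eps * deriv (deriv u) x + p x * deriv u x + b x * u x = f x) \<and>
     u xL = uL \<and> u xR = uR"

definition approx_solution ::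
    "real \<Rightarrow> real \<Rightarrow> (real \<Rightarrow> real) \<Rightarrow> (real \<Rightarrow> real) \<Rightarrow> (real \<Rightarrow> real) \<Rightarrow> real \<Rightarrow> real \<Rightarrow>
     real \<Rightarrow> real \<Rightarrow> nat \<Rightarrow> (nat \<Rightarrow> real) \<Rightarrow> (real \<Rightarrow> real) \<Rightarrow> bool" where
  "approx_solution xL xR p b f uL uR \<delta> eps N X uh \<longleftrightarrow>
     C_k_on 1 {xL..xR} uh \<and>
     (\<forall>k\<in>{1..N}.
        C_k_on 2 {X (k - 1)..X k} uh \<and>
        (\<forall>x\<in>{X (k - 1)<..<X k}.
           - eps * deriv (deriv uh) x + p_bar xL xR p b \<delta> X k x * deriv uh x
             + b (mesh_mid X k) * uh x = f (mesh_mid X k))) \<and>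
     uh xL = uL \<and> uh xR = uR"

end

theory Submission
  imports Defs
begin

text \<open>
  Write \<open>v = u\<^sub>h'\<close>, \<open>V = u'\<close> and \<open>e = u - u\<^sub>h\<close>. The error solves the exact equation with right-hand
  side \<open>O(h) - (p - p\<^sub>h) v\<close>, where \<open>p\<^sub>h\<close> is the approximation of \<open>p\<close>, and testing with \<open>e\<close> leaves the
  consistency term \<open>\<integral> (p - p\<^sub>h) v e\<close> to be bounded by \<open>O(h) \<integral> \<bar>e\<bar> + O(h\<^sup>2)\<close>. Both \<open>u\<close> and \<open>u\<^sub>h\<close> are bounded
  in the supremum norm and have bounded variation, uniformly in \<open>eps\<close> and the mesh. Near singular
  points \<open>p - p\<^sub>h = O(h\<^sup>2)\<close>, so bounded variation suffices. Elsewhere only \<open>p - p\<^sub>h = O(h)\<close>. Away from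
  the zeros of \<open>p\<close> the derivative \<open>v\<close> is bounded, because layers decay exponentially. Near a zero
  with \<open>p' > 0\<close> it is bounded up to a part with integral \<open>O(h)\<close>, by a flux balance on the components
  of \<open>{v > A}\<close>. Near a zero with \<open>p' < 0\<close> and \<open>\<lambda> > 1\<close> the function \<open>v\<close> may have layers at the mesh
  scale, but there \<open>V\<close> is bounded and may replace \<open>v\<close>, since \<open>\<integral> (p - p\<^sub>h) e' e \<le> - \<integral> p' e\<^sup>2 / 2\<close> on every
  mesh interval.
\<close>

subsection \<open>Calculus on compact intervals\<close>

text \<open>The condition \<open>\<lambda> > 1\<close> enters because \<open>u'\<close> solves
  \<open>- eps (u')'' + p (u')' + (b + p') u' = f' - b' u\<close>: at a zero of \<open>p\<close>
  with \<open>p' < 0\<close> the reaction \<open>b + p'\<close> is positive exactly when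
  \<open>\<lambda> > 1\<close>, and then \<open>u'\<close> obeys a maximum principle. Where the
  approximation of \<open>p\<close> is piecewise constant, this mechanism is lost for the discrete
  solution, since the contribution of \<open>p'\<close> is concentrated in jumps of
  \<open>v'\<close> at the breakpoints. Hence only first-order information on \<open>v\<close> is
  used there: one-sided slopes at the ends of superlevel components. The threshold \<open>h0\<close>
  has two roles. If \<open>b0 = 0\<close>, then \<open>p\<close> has no zero and all uniform bounds
  rest on the sign of the convection; on a coarse mesh the tangent lines replacing \<open>p\<close>
  may change sign, so \<open>h \<le> h0\<close> is imposed. If \<open>b0 > 0\<close>, the reaction
  bounds both solutions on every mesh, and for \<open>h > h0\<close> a uniform bound of the energy
  norm suffices, at the price of a factor \<open>1 / h0\<close>.\<close>

lemma nonneg_deriv_within_imp_le: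
  fixes f :: "real \<Rightarrow> real"
  assumes "a \<le> b"
    and der: "\<And>x. x \<in> {a..b} \<Longrightarrow> (f has_real_derivative f' x) (at x within {a..b})"
    and nonneg: "\<And>x. x \<in> {a<..<b} \<Longrightarrow> f' x \<ge> 0"
  shows "f a \<le> f b"
proof (rule DERIV_nonneg_imp_increasing_open[OF \<open>a \<le> b\<close>])
  show "continuous_on {a..b} f"
    using der by (rule DERIV_continuous_on)
  fix x assume "a < x" "x < b"
  then show "\<exists>y. DERIV f x :> y \<and> y \<ge> 0"
    using der[of x] nonneg[of x] by (auto simp: at_within_Icc_at)
qed

lemma deriv_within_diff_le:
  fixes f :: "real \<Rightarrow> real"
  assumes "a \<le> b"
    and der: "\<And>x. x \<in> {a..b} \<Longrightarrow> (f has_real_derivative f' x) (at x within {a..b})"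
    and bound: "\<And>x. x \<in> {a<..<b} \<Longrightarrow> f' x \<le> C"
  shows "f b - f a \<le> C * (b - a)"
proof -
  have "C * a - f a \<le> C * b - f b"
    by (rule nonneg_deriv_within_imp_le[of a b "\<lambda>x. C * x - f x" "\<lambda>x. C - f' x"])
       (use assms in \<open>auto intro!: derivative_eq_intros\<close>)
  then show ?thesis by (simp add: algebra_simps)
qed

lemma deriv_within_diff_ge:
  fixes f :: "real \<Rightarrow> real"
  assumes "a \<le> b"
    and der: "\<And>x. x \<in> {a..b} \<Longrightarrow> (f has_real_derivative f' x) (at x within {a..b})"
    and bound: "\<And>x. x \<in> {a<..<b} \<Longrightarrow> C \<le> f' x"
  shows "C * (b - a) \<le> f b - f a"
proof -
  have "f a - C * a \<le> f b - C * b"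
    by (rule nonneg_deriv_within_imp_le[of a b "\<lambda>x. f x - C * x" "\<lambda>x. f' x - C"])
       (use assms in \<open>auto intro!: derivative_eq_intros\<close>)
  then show ?thesis by (simp add: algebra_simps)
qed

lemma deriv_within_lipschitz:
  fixes f :: "real \<Rightarrow> real"
  assumes der: "\<And>x. x \<in> {a..b} \<Longrightarrow> (f has_real_derivative f' x) (at x within {a..b})"
    and bound: "\<And>x. x \<in> {a..b} \<Longrightarrow> \<bar>f' x\<bar> \<le> C"
    and "x \<in> {a..b}" "y \<in> {a..b}"
  shows "\<bar>f x - f y\<bar> \<le> C * \<bar>x - y\<bar>"
proof -
  have *: "\<bar>f y - f x\<bar> \<le> C * (y - x)" if "x \<le> y" "x \<in> {a..b}" "y \<in> {a..b}" for x y
  proof -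
    have d: "(f has_real_derivative f' t) (at t within {x..y})" if "t \<in> {x..y}" for t
      using that \<open>x \<in> _\<close> \<open>y \<in> _\<close> by (intro DERIV_subset[OF der]) auto
    have "f y - f x \<le> C * (y - x)"
      using that by (intro deriv_within_diff_le[OF _ d]) (auto intro!: abs_le_D1[OF bound])
    moreover have "(- C) * (y - x) \<le> f y - f x"
    proof (intro deriv_within_diff_ge[OF _ d])
      show "- C \<le> f' t" if "t \<in> {x<..<y}" for t
        using bound[of t] that \<open>x \<in> _\<close> \<open>y \<in> _\<close> by auto
    qed (use that in auto)
    ultimately show ?thesis by auto
  qed
  show ?thesis
    using *[of x y] *[of y x] assms(3,4) by (cases "x \<le> y") (auto simp: abs_minus_commute)
qed

lemma integral_deriv_within:
  fixes f :: "real \<Rightarrow> real"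
  assumes "a \<le> b"
    and "\<And>x. x \<in> {a..b} \<Longrightarrow> (f has_real_derivative f' x) (at x within {a..b})"
  shows "integral {a..b} f' = f b - f a" and "f' integrable_on {a..b}"
proof -
  have "(f' has_integral (f b - f a)) {a..b}"
    using assms by (intro fundamental_theorem_of_calculus)
      (auto simp: has_real_derivative_iff_has_vector_derivative)
  then show "integral {a..b} f' = f b - f a" and "f' integrable_on {a..b}"
    by (auto simp: integral_unique)
qed

lemma mvt_within:
  fixes f :: "real \<Rightarrow> real"
  assumes "a < b"
    and der: "\<And>x. x \<in> {a..b} \<Longrightarrow> (f has_real_derivative f' x) (at x within {a..b})"
  obtains \<xi> where "a < \<xi>" "\<xi> < b" "f b - f a = (b - a) * f' \<xi>"
proof -
  have D: "DERIV f x :> f' x" if "a < x" "x < b" for x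
    using der[of x] that by (auto simp: at_within_Icc_at)
  have "\<exists>l z. a < z \<and> z < b \<and> DERIV f z :> l \<and> f b - f a = (b - a) * l"
    using D by (intro MVT[OF \<open>a < b\<close> DERIV_continuous_on[OF der]])
      (auto simp: real_differentiable_def)
  then obtain l z where "a < z" "z < b" "DERIV f z :> l" "f b - f a = (b - a) * l"
    by blast
  then show ?thesis using DERIV_unique[OF D[of z], of l] that[of z] by auto
qed

lemma taylor2_within:
  fixes f :: "real \<Rightarrow> real"
  assumes der: "\<And>x. x \<in> {a..b} \<Longrightarrow> (f has_real_derivative f1 x) (at x within {a..b})"
    and der1: "\<And>x. x \<in> {a..b} \<Longrightarrow> (f1 has_real_derivative f2 x) (at x within {a..b})"
    and bound: "\<And>x. x \<in> {a..b} \<Longrightarrow> \<bar>f2 x\<bar> \<le> C"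
    and x: "x \<in> {a..b}" and y: "y \<in> {a..b}"
  shows "\<bar>f x - (f1 y * (x - y) + f y)\<bar> \<le> C * (x - y)\<^sup>2"
proof -
  define l r where "l = min x y" and "r = max x y"
  have lr: "{l..r} \<subseteq> {a..b}" using x y by (auto simp: l_def r_def)
  have C0: "C \<ge> 0" using bound[OF x] by linarith
  have "\<bar>(f x - f1 y * x) - (f y - f1 y * y)\<bar> \<le> (C * (r - l)) * \<bar>x - y\<bar>"
  proof (rule deriv_within_lipschitz[of l r "\<lambda>t. f t - f1 y * t" "\<lambda>t. f1 t - f1 y"])
    fix t assume t: "t \<in> {l..r}"
    have "(f has_real_derivative f1 t) (at t within {l..r})"
      using t lr by (intro DERIV_subset[OF der]) auto
    then show "((\<lambda>t. f t - f1 y * t) has_real_derivative f1 t - f1 y) (at t within {l..r})"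
      by (auto intro!: derivative_eq_intros)
    have "\<bar>f1 t - f1 y\<bar> \<le> C * \<bar>t - y\<bar>"
      using t lr y by (intro deriv_within_lipschitz[OF der1 bound]) auto
    also have "\<dots> \<le> C * (r - l)"
      using t C0 by (intro mult_left_mono) (auto simp: l_def r_def)
    finally show "\<bar>f1 t - f1 y\<bar> \<le> C * (r - l)" .
  qed (auto simp: l_def r_def)
  moreover have "r - l = \<bar>x - y\<bar>" by (auto simp: l_def r_def)
  ultimately show ?thesis by (simp add: algebra_simps power2_eq_square abs_mult_self_eq)
qed

text \<open>\<open>\<alpha>\<close> is the last point before \<open>x\<close> and
  \<open>\<beta>\<close> the first point after \<open>x\<close> with \<open>v \<le> A\<close>; the
  intermediate value theorem turns this into equality. At such ends the one-sided slopes of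
  \<open>v\<close> have known signs, which the zone estimates exploit.\<close>

lemma superlevel_component:
  fixes v :: "real \<Rightarrow> real"
  assumes cont: "continuous_on {a..b} v" and va: "v a \<le> A" and vb: "v b \<le> A"
    and x: "x \<in> {a..b}" "v x > A"
  obtains \<alpha> \<beta> where "a \<le> \<alpha>" "\<alpha> < x" "x < \<beta>" "\<beta> \<le> b" "v \<alpha> = A" "v \<beta> = A"
    "\<And>t. t \<in> {\<alpha><..<\<beta>} \<Longrightarrow> v t > A"
proof -
  have c1: "continuous_on {a..x} v" and c2: "continuous_on {x..b} v"
    using cont x by (auto elim!: continuous_on_subset)
  have "compact {t \<in> {a..x}. v t \<le> A}" "compact {t \<in> {x..b}. v t \<le> A}"
    using continuous_on_closed_Collect_le[OF c1 continuous_on_const, of A]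
      continuous_on_closed_Collect_le[OF c2 continuous_on_const, of A]
    by (auto simp: compact_eq_bounded_closed
        intro: bounded_subset[OF bounded_closed_interval[of a x]]
          bounded_subset[OF bounded_closed_interval[of x b]])
  moreover have "a \<in> {t \<in> {a..x}. v t \<le> A}" "b \<in> {t \<in> {x..b}. v t \<le> A}"
    using assms by auto
  ultimately obtain \<alpha> \<beta>
    where "\<alpha> \<in> {t \<in> {a..x}. v t \<le> A}" "\<forall>t \<in> {t \<in> {a..x}. v t \<le> A}. t \<le> \<alpha>"
      and "\<beta> \<in> {t \<in> {x..b}. v t \<le> A}" "\<forall>t \<in> {t \<in> {x..b}. v t \<le> A}. \<beta> \<le> t"
    using compact_attains_sup[of "{t \<in> {a..x}. v t \<le> A}"]
      compact_attains_inf[of "{t \<in> {x..b}. v t \<le> A}"] by blast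
  then have al: "\<alpha> \<in> {a..x}" "v \<alpha> \<le> A" "\<And>t. t \<in> {a..x} \<Longrightarrow> v t \<le> A \<Longrightarrow> t \<le> \<alpha>"
    and be: "\<beta> \<in> {x..b}" "v \<beta> \<le> A" "\<And>t. t \<in> {x..b} \<Longrightarrow> v t \<le> A \<Longrightarrow> \<beta> \<le> t"
    by blast+
  have ne: "\<alpha> \<noteq> x" "\<beta> \<noteq> x" using al be x by auto
  have "continuous_on {\<alpha>..x} v" "continuous_on {x..\<beta>} v"
    using al(1) be(1) by (auto intro: continuous_on_subset[OF c1] continuous_on_subset[OF c2])
  then obtain s t where s: "s \<ge> \<alpha>" "s \<le> x" "v s = A" and t: "t \<ge> x" "t \<le> \<beta>" "v t = A"
    using IVT'[of v \<alpha> A x] IVT2'[of v \<beta> A x] al be x by auto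
  have va: "v \<alpha> = A" using al(1) al(3)[of s] s by auto
  have vb: "v \<beta> = A" using be(1) be(3)[of t] t by auto
  have "v t > A" if "t \<in> {\<alpha><..<\<beta>}" for t
  proof (rule ccontr)
    assume "\<not> v t > A"
    then show False
      using that al(1) be(1) al(3)[of t] be(3)[of t] by (cases "t \<le> x") auto
  qed
  then show ?thesis
    using al(1) be(1) ne va vb by (intro that[of \<alpha> \<beta>]) auto
qed

subsection \<open>Meshes\<close>

lemma mesh_mono:
  assumes "is_mesh xL xR N X" "i \<le> j" "j \<le> N"
  shows "X i \<le> X j"
  using assms(2,3)
proof (induction j)
  case (Suc j)
  have "X j < X (Suc j)" using assms(1) Suc.prems by (force simp: is_mesh_def)
  then show ?case using Suc by (cases "i = Suc j") auto
qed auto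

lemma mesh_in_Icc:
  assumes "is_mesh xL xR N X" "k \<le> N"
  shows "X k \<in> {xL..xR}"
  using mesh_mono[OF assms(1), of 0 k] mesh_mono[OF assms(1), of k N] assms
  by (auto simp: is_mesh_def)

lemma mesh_Icc_subset:
  assumes "is_mesh xL xR N X" "k \<in> {1..N}"
  shows "{X (k - 1)..X k} \<subseteq> {xL..xR}" and "X (k - 1) < X k"
  using mesh_in_Icc[OF assms(1), of k] mesh_in_Icc[OF assms(1), of "k - 1"] assms
  by (auto simp: is_mesh_def)

text \<open>The interval leaves room to the right of \<open>x\<close>, so at a breakpoint the
  equation is read in the piece on the right; \<open>mesh_locate_left\<close> is the counterpart.
  The derivative of \<open>v\<close> may differ between the two sides.\<close>

lemma mesh_locate_right:
  assumes "is_mesh xL xR N X" "xL \<le> x" "x < xR"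
  obtains k where "k \<in> {1..N}" "X (k - 1) \<le> x" "x < X k"
proof -
  define k where "k = (LEAST k. x < X k)"
  have ex: "x < X N" using assms by (auto simp: is_mesh_def)
  have k: "x < X k" unfolding k_def by (rule LeastI[of "\<lambda>k. x < X k", OF ex])
  have "k \<le> N" unfolding k_def by (rule Least_le[of "\<lambda>k. x < X k", OF ex])
  moreover have "k \<noteq> 0" using k assms by (auto simp: is_mesh_def intro!: Nat.gr0I)
  moreover have "\<not> x < X (k - 1)"
    using not_less_Least[of "k - 1" "\<lambda>k. x < X k"] \<open>k \<noteq> 0\<close> by (auto simp: k_def)
  ultimately show ?thesis using k by (intro that[of k]) auto
qed

lemma mesh_locate_left:
  assumes "is_mesh xL xR N X" "xL < x" "x \<le> xR"
  obtains k where "k \<in> {1..N}" "X (k - 1) < x" "x \<le> X k"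
proof -
  define k where "k = (LEAST k. x \<le> X k)"
  have ex: "x \<le> X N" using assms by (auto simp: is_mesh_def)
  have k: "x \<le> X k" unfolding k_def by (rule LeastI[of "\<lambda>k. x \<le> X k", OF ex])
  have "k \<le> N" unfolding k_def by (rule Least_le[of "\<lambda>k. x \<le> X k", OF ex])
  moreover have "k \<noteq> 0" using k assms by (auto simp: is_mesh_def intro!: Nat.gr0I)
  moreover have "\<not> x \<le> X (k - 1)"
    using not_less_Least[of "k - 1" "\<lambda>k. x \<le> X k"] \<open>k \<noteq> 0\<close> by (auto simp: k_def)
  ultimately show ?thesis using k by (intro that[of k]) auto
qed

text \<open>Transports an estimate across breakpoints, where the equation for \<open>v\<close>
  changes: the induction cuts off the part of \<open>{a..b}\<close> in the last mesh interval and
  composes by \<open>trans\<close>.\<close>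

lemma mesh_chain:
  assumes mesh: "is_mesh xL xR N X"
    and step: "\<And>k a b. \<lbrakk>k \<in> {1..N}; X (k - 1) \<le> a; a \<le> b; b \<le> X k\<rbrakk> \<Longrightarrow> R a b"
    and trans: "\<And>a b c. \<lbrakk>xL \<le> a; a \<le> b; b \<le> c; c \<le> xR; R a b; R b c\<rbrakk> \<Longrightarrow> R a c"
    and ab: "xL \<le> a" "a < b" "b \<le> xR"
  shows "R a b"
proof -
  have "R a b" if "k \<le> N" "b \<le> X k" "xL \<le> a" "a < b" for k b
    using that
  proof (induction k arbitrary: b)
    case 0
    then show ?case using mesh by (auto simp: is_mesh_def)
  next
    case (Suc k)
    have k: "Suc k \<in> {1..N}" using Suc.prems by auto
    have bR: "b \<le> xR" using mesh_in_Icc[OF mesh, of "Suc k"] Suc.prems by auto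
    consider "b \<le> X k" | "X k < b" "a < X k" | "X k \<le> a" by linarith
    then show ?case
    proof cases
      case 1
      then show ?thesis using Suc by auto
    next
      case 2
      have "R a (X k)" using 2 Suc by auto
      moreover have "R (X k) b" using step[OF k] 2 Suc.prems by auto
      ultimately show ?thesis using 2 Suc.prems bR by (intro trans[of a "X k" b]) auto
    next
      case 3
      then show ?thesis using step[OF k, of a b] Suc.prems by auto
    qed
  qed
  from this[of N b] show ?thesis using ab mesh by (auto simp: is_mesh_def)
qed

lemma mesh_sum_integral:
  fixes g :: "real \<Rightarrow> real"
  assumes mesh: "is_mesh xL xR N X" and g: "g integrable_on {xL..xR}"
  shows "(\<Sum>k=1..N. integral {X (k - 1)..X k} g) = integral {xL..xR} g"
proof -
  have "(\<Sum>k=1..n. integral {X (k - 1)..X k} g) = integral {xL..X n} g" if "n \<le> N" for n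
    using that
  proof (induction n)
    case 0
    then show ?case using mesh by (simp add: is_mesh_def)
  next
    case (Suc n)
    have "integral {xL..X n} g + integral {X n..X (Suc n)} g = integral {xL..X (Suc n)} g"
      using mesh_in_Icc[OF mesh, of n] mesh_in_Icc[OF mesh, of "Suc n"] mesh_mono[OF mesh, of n "Suc n"]
        Suc.prems
      by (intro Henstock_Kurzweil_Integration.integral_combine) (auto intro: integrable_on_subinterval[OF g])
    then show ?case using Suc by simp
  qed
  from this[of N] show ?thesis using mesh by (auto simp: is_mesh_def)
qed

lemma mesh_sum_diff:
  fixes g :: "real \<Rightarrow> real"
  assumes mesh: "is_mesh xL xR N X"
  shows "(\<Sum>k=1..N. g (X k) - g (X (k - 1))) = g xR - g xL"
  using sum_telescope''[of 0 N "\<lambda>k. g (X k)"] mesh by (auto simp: is_mesh_def)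

lemma mesh_width_le:
  assumes "k \<in> {1..N}"
  shows "X k - X (k - 1) \<le> mesh_size N X"
  unfolding mesh_size_def using assms by (intro Max_ge) auto

lemma mesh_mid_in:
  assumes "is_mesh xL xR N X" "k \<in> {1..N}"
  shows "X (k - 1) < mesh_mid X k" "mesh_mid X k < X k"
  using mesh_Icc_subset(2)[OF assms] by (auto simp: mesh_mid_def)

lemma mesh_mid_mono:
  assumes "is_mesh xL xR N X" "j \<le> k" "1 \<le> j" "k \<le> N"
  shows "mesh_mid X j \<le> mesh_mid X k"
proof -
  have "X (j - 1) \<le> X (k - 1)" "X j \<le> X k"
    using assms by (auto intro!: mesh_mono[OF assms(1)])
  then show ?thesis by (simp add: mesh_mid_def)
qed

subsection \<open>Piecewise solutions of first-order systems\<close>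

text \<open>The integrating factor \<open>exp (- \<integral> P / eps)\<close> compares \<open>v\<close> with the constant \<open>G / c\<close>.\<close>

lemma linear_decay_right:
  fixes v P g :: "real \<Rightarrow> real"
  assumes "a \<le> b" and eps_pos: "eps > 0" and cont: "continuous_on {a..b} P"
    and dv: "\<And>t. t \<in> {a..b} \<Longrightarrow> (v has_real_derivative (P t * v t - g t) / eps) (at t within {a..b})"
    and c: "c > 0" and P: "\<And>t. t \<in> {a..b} \<Longrightarrow> P t \<ge> c"
    and G: "\<And>t. t \<in> {a..b} \<Longrightarrow> \<bar>g t\<bar> \<le> G"
  shows "v a - G / c \<le> max 0 (v b - G / c) * exp (- c * (b - a) / eps)"
proof -
  have contab: "continuous_on {a..b} (\<lambda>t. P t / eps)"
    using eps_pos by (intro continuous_intros cont) auto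
  define E where "E t = exp (- integral {a..t} (\<lambda>t. P t / eps))" for t
  have E_pos: "E t > 0" for t by (simp add: E_def)
  have dE: "(E has_real_derivative - (P t / eps) * E t) (at t within {a..b})" if "t \<in> {a..b}" for t
    unfolding E_def
    by (rule derivative_eq_intros integral_has_real_derivative[OF contab that] refl)+ simp
  have "(v a - G / c) * E a \<le> (v b - G / c) * E b"
  proof (rule nonneg_deriv_within_imp_le[OF \<open>a \<le> b\<close>])
    fix t assume t: "t \<in> {a..b}"
    show "((\<lambda>t. (v t - G / c) * E t) has_real_derivative
        (G * (P t / c) - g t) / eps * E t) (at t within {a..b})"
      by (rule derivative_eq_intros dv dE t refl)+ (use eps_pos c in \<open>simp add: field_simps\<close>)
  next
    fix t assume t: "t \<in> {a<..<b}"
    have "G \<ge> 0" using G[of t] t by auto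
    have "1 \<le> P t / c" using P[of t] t c by simp
    then have "G * 1 \<le> G * (P t / c)" using \<open>G \<ge> 0\<close> by (intro mult_left_mono)
    then have "0 \<le> G * (P t / c) - g t" using G[of t] t by auto
    then show "0 \<le> (G * (P t / c) - g t) / eps * E t"
      using E_pos[of t] eps_pos by simp
  qed
  moreover have "E a = 1" by (simp add: E_def)
  ultimately have 1: "v a - G / c \<le> (v b - G / c) * E b" by simp
  \<comment> \<open>A second monotonicity argument compares \<open>E\<close> with the pure
    exponential, so the integral in \<open>E\<close> need not be estimated.\<close>
  have "E b * exp (c / eps * (b - a)) \<le> E a * exp (c / eps * (a - a))"
  proof -
    have "- (E a * exp (c / eps * (a - a))) \<le> - (E b * exp (c / eps * (b - a)))"
    proof (rule nonneg_deriv_within_imp_le[OF \<open>a \<le> b\<close>])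
      fix t assume t: "t \<in> {a..b}"
      show "((\<lambda>t. - (E t * exp (c / eps * (t - a)))) has_real_derivative
          (P t - c) / eps * (E t * exp (c / eps * (t - a)))) (at t within {a..b})"
        by (rule derivative_eq_intros dE t refl)+ (use eps_pos in \<open>simp add: field_simps\<close>)
    next
      fix t assume "t \<in> {a<..<b}"
      then show "0 \<le> (P t - c) / eps * (E t * exp (c / eps * (t - a)))"
        using P[of t] eps_pos E_pos[of t] by simp
    qed
    then show ?thesis by simp
  qed
  then have "E b * exp (c / eps * (b - a)) \<le> 1" using \<open>E a = 1\<close> by simp
  then have "E b \<le> exp (- (c / eps * (b - a)))"
    by (simp add: exp_minus inverse_eq_divide pos_le_divide_eq)
  then have "E b \<le> exp (- c * (b - a) / eps)" by simp
  \<comment> \<open>Replacing \<open>E b\<close> by an upper bound requires a nonnegative factor,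
    hence the positive part.\<close>
  then have "max 0 (v b - G / c) * E b \<le> max 0 (v b - G / c) * exp (- c * (b - a) / eps)"
    by (intro mult_left_mono) auto
  moreover have "(v b - G / c) * E b \<le> max 0 (v b - G / c) * E b"
    using E_pos[of b] by (intro mult_right_mono) auto
  ultimately show ?thesis using 1 by linarith
qed

text \<open>Under the reflection \<open>t \<mapsto> - t\<close> the equation
  \<open>v' = (P v - g) / eps\<close> keeps its form, with \<open>P\<close> and \<open>g\<close>
  both negated.\<close>

lemma linear_decay_left:
  fixes v P g :: "real \<Rightarrow> real"
  assumes "a \<le> b" and eps_pos: "eps > 0" and cont: "continuous_on {a..b} P"
    and dv: "\<And>t. t \<in> {a..b} \<Longrightarrow> (v has_real_derivative (P t * v t - g t) / eps) (at t within {a..b})"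
    and c: "c > 0" and P: "\<And>t. t \<in> {a..b} \<Longrightarrow> P t \<le> - c"
    and G: "\<And>t. t \<in> {a..b} \<Longrightarrow> \<bar>g t\<bar> \<le> G"
  shows "v b - G / c \<le> max 0 (v a - G / c) * exp (- c * (b - a) / eps)"
proof -
  have "v (- (- b)) - G / c \<le> max 0 (v (- (- a)) - G / c) * exp (- c * (- a - - b) / eps)"
  proof (rule linear_decay_right[where v = "\<lambda>t. v (- t)" and P = "\<lambda>t. - P (- t)" and g = "\<lambda>t. - g (- t)"])
    show "continuous_on {- b..- a} (\<lambda>t. - P (- t))"
      by (intro continuous_intros continuous_on_compose2[OF cont]) auto
    fix t assume t: "t \<in> {- b..- a}"
    then have "(v has_real_derivative (P (- t) * v (- t) - g (- t)) / eps) (at (- t) within uminus ` {- b..- a})"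
      using dv[of "- t"] by simp
    from DERIV_image_chain[OF this DERIV_minus[OF DERIV_ident]]
    show "((\<lambda>t. v (- t)) has_real_derivative (- P (- t) * v (- t) - - g (- t)) / eps) (at t within {- b..- a})"
      by (simp add: o_def diff_divide_distrib)
    show "c \<le> - P (- t)" "\<bar>- g (- t)\<bar> \<le> G" using P[of "- t"] G[of "- t"] t by auto
  qed (use assms in auto)
  then show ?thesis by simp
qed

text \<open>The system for \<open>w\<close> and \<open>v = w'\<close>; both the exact solution (with a single mesh interval)
  and the approximate one are instances.\<close>

locale pw_solution =
  fixes xL xR :: real and N :: nat and X :: "nat \<Rightarrow> real" and eps :: real
    and P B F :: "nat \<Rightarrow> real \<Rightarrow> real" and w v :: "real \<Rightarrow> real"
  assumes mesh: "is_mesh xL xR N X"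
    and less: "xL < xR"
    and eps_pos: "eps > 0"
    and w_deriv: "\<And>x. x \<in> {xL..xR} \<Longrightarrow> (w has_real_derivative v x) (at x within {xL..xR})"
    and v_cont: "continuous_on {xL..xR} v"
    and v_deriv: "\<And>k x. k \<in> {1..N} \<Longrightarrow> x \<in> {X (k - 1)..X k} \<Longrightarrow>
      (v has_real_derivative (P k x * v x + B k x * w x - F k x) / eps) (at x within {X (k - 1)..X k})"
begin

text \<open>By this symmetry one-sided bounds for \<open>w\<close> and \<open>v\<close> yield
  two-sided ones.\<close>

lemma uminus: "pw_solution xL xR N X eps P B (\<lambda>k x. - F k x) (\<lambda>x. - w x) (\<lambda>x. - v x)"
proof
  show "((\<lambda>x. - v x) has_real_derivative (P k x * - v x + B k x * - w x - - F k x) / eps)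
      (at x within {X (k - 1)..X k})" if "k \<in> {1..N}" "x \<in> {X (k - 1)..X k}" for k x
    using DERIV_minus[OF v_deriv[OF that]] by (simp add: algebra_simps minus_divide_left)
qed (use mesh less eps_pos in \<open>auto intro!: DERIV_minus w_deriv continuous_on_minus v_cont\<close>)

lemma w_deriv_sub: "{a..b} \<subseteq> {xL..xR} \<Longrightarrow> x \<in> {a..b} \<Longrightarrow> (w has_real_derivative v x) (at x within {a..b})"
  by (rule DERIV_subset[OF w_deriv]) auto

lemma v_deriv_sub:
  "\<lbrakk>k \<in> {1..N}; X (k - 1) \<le> a; b \<le> X k; x \<in> {a..b}\<rbrakk> \<Longrightarrow>
    (v has_real_derivative (P k x * v x + B k x * w x - F k x) / eps) (at x within {a..b})"
  by (rule DERIV_subset[OF v_deriv[of k]]) auto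

lemma w_cont: "continuous_on {xL..xR} w"
  using w_deriv by (rule DERIV_continuous_on)

lemma abs_v_integrable: "{a..b} \<subseteq> {xL..xR} \<Longrightarrow> (\<lambda>x. \<bar>v x\<bar>) integrable_on {a..b}"
  by (intro integrable_continuous_real continuous_intros continuous_on_subset[OF v_cont])

lemma v_integral: "{a..b} \<subseteq> {xL..xR} \<Longrightarrow> a \<le> b \<Longrightarrow> integral {a..b} v = w b - w a"
  by (intro integral_deriv_within w_deriv_sub) auto

text \<open>A maximum principle with linear barriers. At an interior maximum of
  \<open>w x - (a + s * x)\<close> one has \<open>v = s\<close>, and \<open>sup\<close> makes the
  right derivative of \<open>v\<close> positive, so \<open>w\<close> outgrows the barrier to the
  right. A one-sided derivative is enough, which matters since \<open>v'\<close> may jump at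
  breakpoints.\<close>

lemma upper_barrier:
  assumes bdry: "w xL \<le> a + s * xL" "w xR \<le> a + s * xR"
    and sup: "\<And>k x. \<lbrakk>k \<in> {1..N}; x \<in> {X (k - 1)..X k}; w x > a + s * x\<rbrakk>
      \<Longrightarrow> P k x * s + B k x * w x - F k x > 0"
    and x: "x \<in> {xL..xR}"
  shows "w x \<le> a + s * x"
proof (rule ccontr)
  assume neg: "\<not> ?thesis"
  define \<psi> where "\<psi> x = w x - (a + s * x)" for x
  have d\<psi>: "(\<psi> has_real_derivative v x - s) (at x within {xL..xR})" if "x \<in> {xL..xR}" for x
    unfolding \<psi>_def using that by (auto intro!: derivative_eq_intros w_deriv)
  have "continuous_on {xL..xR} \<psi>" using d\<psi> by (rule DERIV_continuous_on)
  then obtain x0 where x0: "x0 \<in> {xL..xR}" and mx: "\<And>y. y \<in> {xL..xR} \<Longrightarrow> \<psi> y \<le> \<psi> x0"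
    using continuous_attains_sup[of "{xL..xR}" \<psi>] less by auto
  have pos: "\<psi> x0 > 0" using mx[OF x] neg by (auto simp: \<psi>_def)
  then have "x0 \<noteq> xL" "x0 \<noteq> xR" using bdry by (auto simp: \<psi>_def)
  then have in0: "xL < x0" "x0 < xR" using x0 by auto
  have "v x0 - s = 0"
  proof (rule DERIV_local_max)
    show "DERIV \<psi> x0 :> v x0 - s" using d\<psi>[OF x0] in0 by (simp add: at_within_Icc_at)
    show "0 < min (x0 - xL) (xR - x0)" using in0 by auto
  qed (auto intro!: mx)
  then have vs: "v x0 = s" by simp
  obtain k where k: "k \<in> {1..N}" "X (k - 1) \<le> x0" "x0 < X k"
    using mesh_locate_right[OF mesh, of x0] in0 by auto
  have "P k x0 * s + B k x0 * w x0 - F k x0 > 0"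
    using k pos by (intro sup) (auto simp: \<psi>_def)
  then have "(P k x0 * v x0 + B k x0 * w x0 - F k x0) / eps > 0"
    using vs eps_pos by simp
  from has_real_derivative_pos_inc_right[OF v_deriv[OF k(1)] this] k(2,3)
  obtain d where d: "d > 0" "\<And>h. h > 0 \<Longrightarrow> x0 + h \<in> {X (k - 1)..X k} \<Longrightarrow> h < d \<Longrightarrow> v x0 < v (x0 + h)"
    by auto
  define t where "t = min (d / 2) (X k - x0)"
  have t: "t > 0" "t < d" "x0 + t \<le> X k" using d(1) k(3) by (auto simp: t_def)
  have sub: "{x0..x0 + t} \<subseteq> {xL..xR}"
    using mesh_Icc_subset(1)[OF mesh k(1)] t k by auto
  obtain \<xi> where xi: "x0 < \<xi>" "\<xi> < x0 + t" "\<psi> (x0 + t) - \<psi> x0 = (x0 + t - x0) * (v \<xi> - s)"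
    using mvt_within[of x0 "x0 + t" \<psi> "\<lambda>x. v x - s"] t(1) sub
      DERIV_subset[OF d\<psi> sub] by auto
  have "v x0 < v (x0 + (\<xi> - x0))" using xi t k by (intro d(2)) auto
  then have "(x0 + t - x0) * (v \<xi> - s) > 0" using vs t by simp
  with xi(3) mx[of "x0 + t"] sub t show False by auto
qed

text \<open>As \<open>v\<close> exceeds \<open>A\<close> immediately to the right of
  \<open>\<alpha>\<close>, its right derivative there is nonnegative; \<open>eps\<close> times this
  derivative is the expression in the conclusion, read in the mesh interval to the right.\<close>

lemma flux_at_left_end:
  assumes "xL \<le> \<alpha>" "\<alpha> < \<beta>" "\<beta> \<le> xR" and level: "v \<alpha> = A" "\<And>t. t \<in> {\<alpha><..<\<beta>} \<Longrightarrow> v t > A"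
  obtains k where "k \<in> {1..N}" "X (k - 1) \<le> \<alpha>" "\<alpha> < X k" "P k \<alpha> * A + B k \<alpha> * w \<alpha> - F k \<alpha> \<ge> 0"
proof -
  obtain k where k: "k \<in> {1..N}" "X (k - 1) \<le> \<alpha>" "\<alpha> < X k"
    using mesh_locate_right[OF mesh, of \<alpha>] assms by auto
  have "P k \<alpha> * A + B k \<alpha> * w \<alpha> - F k \<alpha> \<ge> 0"
  proof (rule ccontr)
    assume "\<not> ?thesis"
    then have "(P k \<alpha> * v \<alpha> + B k \<alpha> * w \<alpha> - F k \<alpha>) / eps < 0"
      using level(1) eps_pos by (simp add: divide_neg_pos)
    from has_real_derivative_neg_dec_right[OF v_deriv[OF k(1)] this] k(2,3)
    obtain d where d: "d > 0" "\<And>h. h > 0 \<Longrightarrow> \<alpha> + h \<in> {X (k - 1)..X k} \<Longrightarrow> h < d \<Longrightarrow> v (\<alpha> + h) < v \<alpha>"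
      by auto
    define h where "h = min (d / 2) (min (X k - \<alpha>) ((\<beta> - \<alpha>) / 2))"
    have h: "h > 0" "h < d" "\<alpha> + h \<le> X k" "\<alpha> + h < \<beta>"
      using d(1) k(3) assms(2) by (auto simp: h_def min_def field_simps)
    then show False using d(2)[of h] level(1) level(2)[of "\<alpha> + h"] k by auto
  qed
  then show ?thesis using k that by blast
qed

text \<open>Here \<open>v\<close> approaches \<open>A\<close> from above, so the left derivative,
  taken in the mesh interval to the left of \<open>\<beta>\<close>, is nonpositive.\<close>

lemma flux_at_right_end:
  assumes "xL \<le> \<alpha>" "\<alpha> < \<beta>" "\<beta> \<le> xR" and level: "v \<beta> = A" "\<And>t. t \<in> {\<alpha><..<\<beta>} \<Longrightarrow> v t > A"
  obtains k where "k \<in> {1..N}" "X (k - 1) < \<beta>" "\<beta> \<le> X k" "P k \<beta> * A + B k \<beta> * w \<beta> - F k \<beta> \<le> 0"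
proof -
  obtain k where k: "k \<in> {1..N}" "X (k - 1) < \<beta>" "\<beta> \<le> X k"
    using mesh_locate_left[OF mesh, of \<beta>] assms by auto
  have "P k \<beta> * A + B k \<beta> * w \<beta> - F k \<beta> \<le> 0"
  proof (rule ccontr)
    assume "\<not> ?thesis"
    then have "(P k \<beta> * v \<beta> + B k \<beta> * w \<beta> - F k \<beta>) / eps > 0"
      using level(1) eps_pos by simp
    from has_real_derivative_pos_inc_left[OF v_deriv[OF k(1)] this] k(2,3)
    obtain d where d: "d > 0" "\<And>h. h > 0 \<Longrightarrow> \<beta> - h \<in> {X (k - 1)..X k} \<Longrightarrow> h < d \<Longrightarrow> v (\<beta> - h) < v \<beta>"
      by auto
    define h where "h = min (d / 2) (min (\<beta> - X (k - 1)) ((\<beta> - \<alpha>) / 2))"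
    have h: "h > 0" "h < d" "X (k - 1) \<le> \<beta> - h" "\<alpha> < \<beta> - h"
      using d(1) k(2) assms(2) by (auto simp: h_def min_def field_simps)
    then show False using d(2)[of h] level(1) level(2)[of "\<beta> - h"] k by auto
  qed
  then show ?thesis using k that by blast
qed

text \<open>With positive parts the one-interval estimate composes: the exponentials multiply to the
  factor for the total length, without loss at the breakpoints.\<close>

lemma decay_right:
  assumes ab: "xL \<le> a" "a < b" "b \<le> xR"
    and cont: "\<And>k. k \<in> {1..N} \<Longrightarrow> continuous_on {X (k - 1)..X k} (P k)"
    and c: "c > 0"
    and P: "\<And>k t. \<lbrakk>k \<in> {1..N}; t \<in> {X (k - 1)..X k}; t \<in> {a..b}\<rbrakk> \<Longrightarrow> P k t \<ge> c"
    and G: "\<And>k t. \<lbrakk>k \<in> {1..N}; t \<in> {X (k - 1)..X k}; t \<in> {a..b}\<rbrakk> \<Longrightarrow> \<bar>F k t - B k t * w t\<bar> \<le> G"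
  shows "max 0 (v a - G / c) \<le> max 0 (v b - G / c) * exp (- c * (b - a) / eps)"
proof -
  let ?R = "\<lambda>a' b'. {a'..b'} \<subseteq> {a..b} \<longrightarrow>
    max 0 (v a' - G / c) \<le> max 0 (v b' - G / c) * exp (- c * (b' - a') / eps)"
  have "?R a b"
  proof (rule mesh_chain[where R="?R", OF mesh _ _ ab])
    fix k a' b' assume k: "k \<in> {1..N}" "X (k - 1) \<le> a'" "a' \<le> b'" "b' \<le> X k"
    show "?R a' b'"
    proof
      assume sub: "{a'..b'} \<subseteq> {a..b}"
      have "v a' - G / c \<le> max 0 (v b' - G / c) * exp (- c * (b' - a') / eps)"
        using k sub
        by (intro linear_decay_right[where P = "P k" and g = "\<lambda>t. F k t - B k t * w t", OF k(3) eps_pos _ _ c] P G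
            continuous_on_subset[OF cont] DERIV_cong[OF v_deriv_sub[OF k(1,2,4)]]) auto
      then show "max 0 (v a' - G / c) \<le> max 0 (v b' - G / c) * exp (- c * (b' - a') / eps)"
        by simp
    qed
  next
    fix a' b' c' assume le: "xL \<le> a'" "a' \<le> b'" "b' \<le> c'" "c' \<le> xR" and R: "?R a' b'" "?R b' c'"
    show "?R a' c'"
    proof
      assume sub: "{a'..c'} \<subseteq> {a..b}"
      have "{a'..b'} \<subseteq> {a..b}" "{b'..c'} \<subseteq> {a..b}" using sub le by auto
      then have "max 0 (v a' - G / c) \<le> max 0 (v b' - G / c) * exp (- c * (b' - a') / eps)"
        and "max 0 (v b' - G / c) \<le> max 0 (v c' - G / c) * exp (- c * (c' - b') / eps)"
        using R by auto
      then have "max 0 (v a' - G / c) \<le>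
          max 0 (v c' - G / c) * exp (- c * (c' - b') / eps) * exp (- c * (b' - a') / eps)"
        by (meson exp_ge_zero mult_right_mono order_trans)
      also have "\<dots> = max 0 (v c' - G / c) * exp (- c * (c' - a') / eps)"
        by (simp add: mult_exp_exp add_divide_distrib[symmetric] algebra_simps)
      finally show "max 0 (v a' - G / c) \<le> max 0 (v c' - G / c) * exp (- c * (c' - a') / eps)" .
    qed
  qed
  then show ?thesis by simp
qed

lemma decay_left:
  assumes ab: "xL \<le> a" "a < b" "b \<le> xR"
    and cont: "\<And>k. k \<in> {1..N} \<Longrightarrow> continuous_on {X (k - 1)..X k} (P k)"
    and c: "c > 0"
    and P: "\<And>k t. \<lbrakk>k \<in> {1..N}; t \<in> {X (k - 1)..X k}; t \<in> {a..b}\<rbrakk> \<Longrightarrow> P k t \<le> - c"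
    and G: "\<And>k t. \<lbrakk>k \<in> {1..N}; t \<in> {X (k - 1)..X k}; t \<in> {a..b}\<rbrakk> \<Longrightarrow> \<bar>F k t - B k t * w t\<bar> \<le> G"
  shows "max 0 (v b - G / c) \<le> max 0 (v a - G / c) * exp (- c * (b - a) / eps)"
proof -
  let ?R = "\<lambda>a' b'. {a'..b'} \<subseteq> {a..b} \<longrightarrow>
    max 0 (v b' - G / c) \<le> max 0 (v a' - G / c) * exp (- c * (b' - a') / eps)"
  have "?R a b"
  proof (rule mesh_chain[where R="?R", OF mesh _ _ ab])
    fix k a' b' assume k: "k \<in> {1..N}" "X (k - 1) \<le> a'" "a' \<le> b'" "b' \<le> X k"
    show "?R a' b'"
    proof
      assume sub: "{a'..b'} \<subseteq> {a..b}"
      have "v b' - G / c \<le> max 0 (v a' - G / c) * exp (- c * (b' - a') / eps)"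
        using k sub
        by (intro linear_decay_left[where P = "P k" and g = "\<lambda>t. F k t - B k t * w t", OF k(3) eps_pos _ _ c] P G
            continuous_on_subset[OF cont] DERIV_cong[OF v_deriv_sub[OF k(1,2,4)]]) auto
      then show "max 0 (v b' - G / c) \<le> max 0 (v a' - G / c) * exp (- c * (b' - a') / eps)"
        by simp
    qed
  next
    fix a' b' c' assume le: "xL \<le> a'" "a' \<le> b'" "b' \<le> c'" "c' \<le> xR" and R: "?R a' b'" "?R b' c'"
    show "?R a' c'"
    proof
      assume sub: "{a'..c'} \<subseteq> {a..b}"
      have "{a'..b'} \<subseteq> {a..b}" "{b'..c'} \<subseteq> {a..b}" using sub le by auto
      then have "max 0 (v b' - G / c) \<le> max 0 (v a' - G / c) * exp (- c * (b' - a') / eps)"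
        and "max 0 (v c' - G / c) \<le> max 0 (v b' - G / c) * exp (- c * (c' - b') / eps)"
        using R by auto
      then have "max 0 (v c' - G / c) \<le>
          max 0 (v a' - G / c) * exp (- c * (b' - a') / eps) * exp (- c * (c' - b') / eps)"
        by (meson exp_ge_zero mult_right_mono order_trans)
      also have "\<dots> = max 0 (v a' - G / c) * exp (- c * (c' - a') / eps)"
        by (simp add: mult_exp_exp add_divide_distrib[symmetric] algebra_simps)
      finally show "max 0 (v c' - G / c) \<le> max 0 (v a' - G / c) * exp (- c * (c' - a') / eps)" .
    qed
  qed
  then show ?thesis by simp
qed

end

subsection \<open>Uniform bounds for piecewise solutions\<close>

text \<open>A smooth increasing substitute for the sign, so that the product of the flux with the
  sign of \<open>v\<close> can be differentiated; \<open>\<tau>\<close> tends to \<open>0\<close> at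
  the end of the variation estimate.\<close>

definition smooth_sgn :: "real \<Rightarrow> real \<Rightarrow> real" where
  "smooth_sgn \<tau> t = t / sqrt (t\<^sup>2 + \<tau>\<^sup>2)"

text \<open>The primitive of \<open>t \<mapsto> t * smooth_sgn' t\<close> vanishing at \<open>0\<close>.\<close>

definition smooth_sgn_rest :: "real \<Rightarrow> real \<Rightarrow> real" where
  "smooth_sgn_rest \<tau> t = \<tau> - \<tau>\<^sup>2 / sqrt (t\<^sup>2 + \<tau>\<^sup>2)"

definition smooth_sgn_deriv :: "real \<Rightarrow> real \<Rightarrow> real" where
  "smooth_sgn_deriv \<tau> t = \<tau>\<^sup>2 / sqrt (t\<^sup>2 + \<tau>\<^sup>2) ^ 3"

text \<open>That \<open>smooth_sgn_rest\<close> lies between \<open>0\<close> and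
  \<open>\<tau>\<close> is what removes the convection from the variation estimate in the limit; the
  loss against the true sign, \<open>\<bar>t\<bar> - smooth_sgn \<tau> t * t\<close>, is at most
  \<open>\<tau>\<close> as well.\<close>

lemma smooth_sgn_bounds:
  assumes "\<tau> > 0"
  shows "\<bar>smooth_sgn \<tau> t\<bar> \<le> 1" "\<bar>t\<bar> - \<tau> \<le> smooth_sgn \<tau> t * t" "0 \<le> smooth_sgn \<tau> t * t"
    "0 \<le> smooth_sgn_rest \<tau> t" "smooth_sgn_rest \<tau> t \<le> \<tau>" "smooth_sgn_deriv \<tau> t \<ge> 0"
proof -
  define r where "r = sqrt (t\<^sup>2 + \<tau>\<^sup>2)"
  have r2: "r\<^sup>2 = t\<^sup>2 + \<tau>\<^sup>2" by (simp add: r_def)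
  have rt: "r \<ge> \<tau>" "r \<ge> \<bar>t\<bar>"
    using assms by (auto simp: r_def intro!: real_le_rsqrt)
  have r0: "r > 0" using rt(1) assms by linarith
  have rle: "r \<le> \<bar>t\<bar> + \<tau>"
    unfolding r_def using sqrt_sum_squares_le_sum_abs[of t \<tau>] assms by simp
  show "\<bar>smooth_sgn \<tau> t\<bar> \<le> 1"
    using rt(2) r0 by (simp add: smooth_sgn_def r_def[symmetric])
  have "(\<bar>t\<bar> - \<tau>) * r \<le> t * t"
  proof (cases "\<bar>t\<bar> \<le> \<tau>")
    case True
    then show ?thesis using r0 by (intro order_trans[OF mult_nonpos_nonneg]) auto
  next
    case False
    have "(\<bar>t\<bar> - \<tau>) * r \<le> (\<bar>t\<bar> - \<tau>) * (\<bar>t\<bar> + \<tau>)" using False rle by (intro mult_left_mono) auto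
    also have "\<dots> \<le> t * t" by (simp add: algebra_simps)
    finally show ?thesis .
  qed
  then show "\<bar>t\<bar> - \<tau> \<le> smooth_sgn \<tau> t * t"
    using r0 by (simp add: smooth_sgn_def r_def[symmetric] pos_le_divide_eq)
  show "0 \<le> smooth_sgn \<tau> t * t"
    using r0 by (simp add: smooth_sgn_def r_def[symmetric])
  have "\<tau>\<^sup>2 \<le> \<tau> * r" using rt(1) assms by (simp add: power2_eq_square)
  then show "0 \<le> smooth_sgn_rest \<tau> t"
    using r0 by (simp add: smooth_sgn_rest_def r_def[symmetric] pos_divide_le_eq)
  show "smooth_sgn_rest \<tau> t \<le> \<tau>" "smooth_sgn_deriv \<tau> t \<ge> 0"
    using r0 by (auto simp: smooth_sgn_rest_def smooth_sgn_deriv_def r_def[symmetric])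
qed

lemma smooth_sgn_has_deriv:
  assumes "\<tau> > 0"
  shows "(smooth_sgn \<tau> has_real_derivative smooth_sgn_deriv \<tau> t) (at t)"
    and "(smooth_sgn_rest \<tau> has_real_derivative t * smooth_sgn_deriv \<tau> t) (at t)"
proof -
  define r where "r = sqrt (t\<^sup>2 + \<tau>\<^sup>2)"
  have pos: "t\<^sup>2 + \<tau>\<^sup>2 > 0" using assms by (intro add_nonneg_pos) auto
  have r0: "r > 0" unfolding r_def using pos by (rule real_sqrt_gt_zero)
  have r2: "r\<^sup>2 = t\<^sup>2 + \<tau>\<^sup>2" by (simp add: r_def)
  have dr: "((\<lambda>t. sqrt (t\<^sup>2 + \<tau>\<^sup>2)) has_real_derivative t / r) (at t)"
    using pos assms by (auto intro!: derivative_eq_intros simp: r_def field_simps)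
  have ne: "sqrt (t\<^sup>2 + \<tau>\<^sup>2) \<noteq> 0" using r0 unfolding r_def by linarith
  have *: "(r - t * (t / r)) / r\<^sup>2 = \<tau>\<^sup>2 / r ^ 3"
    using r0 r2 by (simp add: field_simps power2_eq_square power3_eq_cube)
  have "(smooth_sgn \<tau> has_real_derivative (1 * sqrt (t\<^sup>2 + \<tau>\<^sup>2) - t / r * t) /
      sqrt (t\<^sup>2 + \<tau>\<^sup>2) ^ Suc (Suc 0)) (at t)"
    unfolding smooth_sgn_def[abs_def] by (rule DERIV_quotient[OF DERIV_ident dr ne])
  moreover have "(1 * r - t / r * t) / r ^ Suc (Suc 0) = \<tau>\<^sup>2 / r ^ 3"
    using * by (simp add: power2_eq_square)
  ultimately show "(smooth_sgn \<tau> has_real_derivative smooth_sgn_deriv \<tau> t) (at t)"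
    unfolding smooth_sgn_deriv_def r_def[symmetric] by (simp only:)
  have d: "((\<lambda>t. \<tau> - \<tau>\<^sup>2 * inverse (sqrt (t\<^sup>2 + \<tau>\<^sup>2))) has_real_derivative
      0 - \<tau>\<^sup>2 * (- (t / r * inverse (sqrt (t\<^sup>2 + \<tau>\<^sup>2) ^ Suc (Suc 0))))) (at t)"
    by (rule DERIV_diff[OF DERIV_const DERIV_cmult[OF DERIV_inverse_fun[OF dr ne]]])
  have "0 - \<tau>\<^sup>2 * (- (t / r * inverse (r ^ Suc (Suc 0)))) = t * (\<tau>\<^sup>2 / r ^ 3)"
    by (simp add: divide_inverse power3_eq_cube)
  with d show "(smooth_sgn_rest \<tau> has_real_derivative t * smooth_sgn_deriv \<tau> t) (at t)"
    unfolding smooth_sgn_rest_def[abs_def] smooth_sgn_deriv_def r_def[symmetric] divide_inverse[of "\<tau>\<^sup>2" "sqrt _"]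
    by (simp only:)
qed

text \<open>A continuous derivative without interior zeros has constant sign by the intermediate
  value theorem, so the variation of \<open>w\<close> is its increment.\<close>

lemma integral_abs_deriv_le:
  fixes v w :: "real \<Rightarrow> real"
  assumes "a \<le> b" and cont: "continuous_on {a..b} v"
    and der: "\<And>x. x \<in> {a..b} \<Longrightarrow> (w has_real_derivative v x) (at x within {a..b})"
    and nz: "\<And>x. x \<in> {a<..<b} \<Longrightarrow> v x \<noteq> 0"
  shows "integral {a..b} (\<lambda>x. \<bar>v x\<bar>) \<le> \<bar>w b - w a\<bar>"
proof (cases "a < b")
  case True
  define m where "m = (a + b) / 2"
  have m: "m \<in> {a<..<b}" using True by (simp add: m_def)
  have same: "v x * v m > 0" if x: "x \<in> {a<..<b}" for x
  proof (rule ccontr)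
    assume neg: "\<not> ?thesis"
    have mm: "min x m \<le> max x m" by simp
    have c: "continuous_on {min x m..max x m} v"
      by (rule continuous_on_subset[OF cont]) (use x m in auto)
    have "v x * v m < 0" using nz[OF x] nz[OF m] neg mult_eq_0_iff[of "v x" "v m"] by linarith
    then have "(v (min x m) \<le> 0 \<and> 0 \<le> v (max x m)) \<or> (v (max x m) \<le> 0 \<and> 0 \<le> v (min x m))"
      by (cases "x \<le> m") (auto simp: mult_less_0_iff min_def max_def)
    then obtain t where "min x m \<le> t" "t \<le> max x m" "v t = 0"
      using IVT'[of v "min x m" 0 "max x m"] IVT2'[of v "max x m" 0 "min x m"] c mm by blast
    then show False using nz[of t] x m by (auto simp: min_def max_def split: if_splits)
  qed
  have *: "integral {a..b} (\<lambda>x. \<bar>v x\<bar>) = integral {a..b} (\<lambda>x. sgn (v m) * v x)"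
    unfolding integral_open_interval_real
  proof (rule integral_cong)
    show "\<bar>v x\<bar> = sgn (v m) * v x" if "x \<in> {a<..<b}" for x
      using same[OF that] by (auto simp: zero_less_mult_iff)
  qed
  also have "\<dots> = sgn (v m) * (w b - w a)"
    using integral_deriv_within(1)[OF \<open>a \<le> b\<close> der] by simp
  also have "\<dots> \<le> \<bar>w b - w a\<bar>"
    by (auto simp: sgn_if)
  finally show ?thesis .
qed (use assms in auto)

lemma integral_abs_le_const:
  fixes v :: "real \<Rightarrow> real"
  assumes "a \<le> b" "continuous_on {a..b} v" "\<And>x. x \<in> {a..b} \<Longrightarrow> \<bar>v x\<bar> \<le> K"
  shows "integral {a..b} (\<lambda>x. \<bar>v x\<bar>) \<le> K * (b - a)"
proof -
  have "integral {a..b} (\<lambda>x. \<bar>v x\<bar>) \<le> integral {a..b} (\<lambda>x. K)"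
    using assms by (intro integral_le integrable_continuous_real continuous_intros) auto
  then show ?thesis using assms(1) by (simp add: mult.commute)
qed

text \<open>Once \<open>\<bar>v\<bar>\<close> exceeds the threshold it stays above, so \<open>w\<close> is monotone from there on.\<close>

lemma integral_abs_le_persist_right:
  fixes v w :: "real \<Rightarrow> real"
  assumes "a \<le> b" and cont: "continuous_on {a..b} v"
    and der: "\<And>x. x \<in> {a..b} \<Longrightarrow> (w has_real_derivative v x) (at x within {a..b})"
    and w: "\<And>x. x \<in> {a..b} \<Longrightarrow> \<bar>w x\<bar> \<le> M" and K: "K \<ge> 0"
    and pers: "\<And>x y. \<lbrakk>a \<le> x; x \<le> y; y \<le> b; \<bar>v x\<bar> > K\<rbrakk> \<Longrightarrow> \<bar>v y\<bar> > K"
  shows "integral {a..b} (\<lambda>x. \<bar>v x\<bar>) \<le> 2 * M + K * (b - a)"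
proof -
  define T where "T = {x \<in> {a..b}. \<bar>v x\<bar> \<le> K}"
  have int: "(\<lambda>x. \<bar>v x\<bar>) integrable_on {a..b}"
    by (intro integrable_continuous_real continuous_intros cont)
  \<comment> \<open>\<open>\<xi>\<close> is the last point with
    \<open>\<bar>v\<bar> \<le> K\<close>, or \<open>a\<close> if there is none. Persistence gives
    \<open>\<bar>v\<bar> \<le> K\<close> before it, and after it \<open>v\<close> has no
    zero.\<close>
  obtain \<xi> where xi: "\<xi> \<in> {a..b}" "integral {a..\<xi>} (\<lambda>x. \<bar>v x\<bar>) \<le> K * (\<xi> - a)"
    "\<And>x. x \<in> {\<xi><..<b} \<Longrightarrow> \<bar>v x\<bar> > K"
  proof (cases "T = {}")
    case True
    then have "\<bar>v x\<bar> > K" if "x \<in> {a..b}" for x using that by (force simp: T_def)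
    then show ?thesis using \<open>a \<le> b\<close> by (intro that[of a]) auto
  next
    case False
    have "compact T" unfolding T_def
      using continuous_on_closed_Collect_le[of "{a..b}" "\<lambda>x. \<bar>v x\<bar>" "\<lambda>_. K"] cont
      by (auto simp: compact_eq_bounded_closed intro!: continuous_intros
          bounded_subset[OF bounded_closed_interval[of a b]])
    then obtain \<xi> where xi: "\<xi> \<in> T" "\<forall>t\<in>T. t \<le> \<xi>"
      using compact_attains_sup False by metis
    have "\<bar>v x\<bar> \<le> K" if "x \<in> {a..\<xi>}" for x
      using pers[of x \<xi>] xi(1) that by (auto simp: T_def not_less[symmetric])
    then have "integral {a..\<xi>} (\<lambda>x. \<bar>v x\<bar>) \<le> K * (\<xi> - a)"
      using xi(1) by (intro integral_abs_le_const continuous_on_subset[OF cont]) (auto simp: T_def)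
    moreover have "\<bar>v x\<bar> > K" if "x \<in> {\<xi><..<b}" for x
    proof (rule ccontr)
      assume "\<not> \<bar>v x\<bar> > K"
      then have "x \<in> T" using that xi(1) by (auto simp: T_def)
      then show False using xi(2) that by auto
    qed
    ultimately show ?thesis using xi(1) by (intro that[of \<xi>]) (auto simp: T_def)
  qed
  have "integral {\<xi>..b} (\<lambda>x. \<bar>v x\<bar>) \<le> \<bar>w b - w \<xi>\<bar>"
  proof (rule integral_abs_deriv_le)
    show "v x \<noteq> 0" if "x \<in> {\<xi><..<b}" for x using xi(3)[OF that] K by auto
    show "(w has_real_derivative v x) (at x within {\<xi>..b})" if "x \<in> {\<xi>..b}" for x
      using that xi(1) by (intro DERIV_subset[OF der]) auto
  qed (use xi(1) in \<open>auto intro: continuous_on_subset[OF cont]\<close>)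
  also have "\<dots> \<le> 2 * M" using w[of b] w[of \<xi>] xi(1) by auto
  finally have "integral {a..b} (\<lambda>x. \<bar>v x\<bar>) \<le> 2 * M + K * (\<xi> - a)"
    using xi(1,2) Henstock_Kurzweil_Integration.integral_combine[OF _ _ int, of \<xi>] by auto
  also have "\<dots> \<le> 2 * M + K * (b - a)"
    using xi(1) K by (auto intro!: mult_left_mono)
  finally show ?thesis .
qed

lemma integral_abs_le_persist_left:
  fixes v w :: "real \<Rightarrow> real"
  assumes "a \<le> b" and cont: "continuous_on {a..b} v"
    and der: "\<And>x. x \<in> {a..b} \<Longrightarrow> (w has_real_derivative v x) (at x within {a..b})"
    and w: "\<And>x. x \<in> {a..b} \<Longrightarrow> \<bar>w x\<bar> \<le> M" and K: "K \<ge> 0"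
    and pers: "\<And>x y. \<lbrakk>a \<le> x; x \<le> y; y \<le> b; \<bar>v y\<bar> > K\<rbrakk> \<Longrightarrow> \<bar>v x\<bar> > K"
  shows "integral {a..b} (\<lambda>x. \<bar>v x\<bar>) \<le> 2 * M + K * (b - a)"
proof -
  have "integral {- b..- a} (\<lambda>x. \<bar>v (- x)\<bar>) \<le> 2 * M + K * (- a - - b)"
  proof (rule integral_abs_le_persist_right[of "- b" "- a" "\<lambda>x. v (- x)" "\<lambda>x. - w (- x)"])
    show "continuous_on {- b..- a} (\<lambda>x. v (- x))"
      by (rule continuous_on_compose2[OF cont]) (auto intro!: continuous_intros)
    show "((\<lambda>x. - w (- x)) has_real_derivative v (- x)) (at x within {- b..- a})"
      if "x \<in> {- b..- a}" for x
    proof -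
      have "(w has_real_derivative v (- x)) (at (- x) within uminus ` {- b..- a})"
        using der[of "- x"] that by simp
      from DERIV_minus[OF DERIV_image_chain[OF this DERIV_minus[OF DERIV_ident]]]
      show ?thesis by (simp add: o_def)
    qed
    show "\<bar>v (- y)\<bar> > K" if "- b \<le> x" "x \<le> y" "y \<le> - a" "\<bar>v (- x)\<bar> > K" for x y
      using that by (intro pers[of "- y" "- x"]) auto
  qed (use assms in auto)
  then show ?thesis using Henstock_Kurzweil_Integration.integral_reflect_real[of b a "\<lambda>x. \<bar>v x\<bar>"] by simp
qed

section \<open>Supremum norm, variation and scaled derivative of a piecewise solution\<close>

context pw_solution
begin

text \<open>A constant barrier: above \<open>U + Fm / b0\<close> the reaction \<open>B w\<close>
  dominates \<open>F\<close>, whatever the convection does.\<close>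

lemma upper_bound_reaction:
  assumes B: "\<And>k x. k \<in> {1..N} \<Longrightarrow> x \<in> {X (k - 1)..X k} \<Longrightarrow> B k x \<ge> b0" and b0: "b0 > 0"
    and F: "\<And>k x. k \<in> {1..N} \<Longrightarrow> x \<in> {X (k - 1)..X k} \<Longrightarrow> \<bar>F k x\<bar> \<le> Fm"
    and U: "\<bar>w xL\<bar> \<le> U" "\<bar>w xR\<bar> \<le> U" and Fm: "Fm \<ge> 0" and x: "x \<in> {xL..xR}"
  shows "w x \<le> U + Fm / b0"
proof -
  have "w x \<le> (U + Fm / b0) + 0 * x"
  proof (rule upper_barrier[OF _ _ _ x])
    fix k x assume kx: "k \<in> {1..N}" "x \<in> {X (k - 1)..X k}" and gt: "w x > U + Fm / b0 + 0 * x"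
    have "Fm / b0 < w x" using gt U by auto
    then have 1: "Fm < b0 * w x" using b0 by (simp add: pos_divide_less_eq mult.commute)
    have "w x > 0" using \<open>Fm / b0 < w x\<close> Fm b0 by (smt (verit) divide_nonneg_pos)
    then have "b0 * w x \<le> B k x * w x" using B[OF kx] by simp
    with 1 show "P k x * 0 + B k x * w x - F k x > 0" using F[OF kx] by auto
  qed (use U divide_nonneg_pos[OF Fm b0] in linarith)+
  then show ?thesis by simp
qed

lemma bound_reaction:
  assumes B: "\<And>k x. k \<in> {1..N} \<Longrightarrow> x \<in> {X (k - 1)..X k} \<Longrightarrow> B k x \<ge> b0" and b0: "b0 > 0"
    and F: "\<And>k x. k \<in> {1..N} \<Longrightarrow> x \<in> {X (k - 1)..X k} \<Longrightarrow> \<bar>F k x\<bar> \<le> Fm"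
    and U: "\<bar>w xL\<bar> \<le> U" "\<bar>w xR\<bar> \<le> U" and Fm: "Fm \<ge> 0" and x: "x \<in> {xL..xR}"
  shows "\<bar>w x\<bar> \<le> U + Fm / b0"
proof -
  interpret neg: pw_solution xL xR N X eps P B "\<lambda>k x. - F k x" "\<lambda>x. - w x" "\<lambda>x. - v x"
    by (rule uminus)
  have "w x \<le> U + Fm / b0" using assms by (rule upper_bound_reaction)
  moreover have "- w x \<le> U + Fm / b0"
    by (rule neg.upper_bound_reaction[OF B b0 _ _ _ Fm x]) (use F U in auto)
  ultimately show ?thesis by auto
qed

text \<open>A barrier of slope \<open>\<sigma> * (Fm + 1) / c\<close>, steep enough for the
  convection alone to give \<open>P s \<ge> Fm + 1 > F\<close>; the summand \<open>1\<close>
  provides the strict inequality.\<close>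

lemma upper_bound_convection:
  assumes sgn: "\<sigma> = 1 \<or> \<sigma> = -1"
    and P: "\<And>k x. k \<in> {1..N} \<Longrightarrow> x \<in> {X (k - 1)..X k} \<Longrightarrow> \<sigma> * P k x \<ge> c" and c: "c > 0"
    and B: "\<And>k x. k \<in> {1..N} \<Longrightarrow> x \<in> {X (k - 1)..X k} \<Longrightarrow> B k x \<ge> 0"
    and F: "\<And>k x. k \<in> {1..N} \<Longrightarrow> x \<in> {X (k - 1)..X k} \<Longrightarrow> \<bar>F k x\<bar> \<le> Fm"
    and U: "\<bar>w xL\<bar> \<le> U" "\<bar>w xR\<bar> \<le> U" and Fm: "Fm \<ge> 0" and x: "x \<in> {xL..xR}"
  shows "w x \<le> U + (Fm + 1) / c * (xR - xL)"
proof -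
  define s0 where "s0 = (Fm + 1) / c"
  have s0: "s0 > 0" using Fm c by (simp add: s0_def)
  define s where "s = \<sigma> * s0"
  \<comment> \<open>The barrier equals \<open>U\<close> at the end from which it rises:
    \<open>xL\<close> for \<open>\<sigma> = 1\<close>, \<open>xR\<close> for
    \<open>\<sigma> = -1\<close>.\<close>
  define a where "a = U - s * (if \<sigma> = 1 then xL else xR)"
  have ge: "a + s * y \<ge> U" "a + s * y \<le> U + s0 * (xR - xL)" if "y \<in> {xL..xR}" for y
  proof -
    have "s0 * xL \<le> s0 * y" "s0 * y \<le> s0 * xR" using that s0 by auto
    then show "a + s * y \<ge> U" "a + s * y \<le> U + s0 * (xR - xL)"
      using sgn by (auto simp: a_def s_def algebra_simps)
  qed
  have "w x \<le> a + s * x"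
  proof (rule upper_barrier[OF _ _ _ x])
    fix k x assume kx: "k \<in> {1..N}" "x \<in> {X (k - 1)..X k}" and gt: "w x > a + s * x"
    have "x \<in> {xL..xR}" using mesh_Icc_subset(1)[OF mesh kx(1)] kx(2) by auto
    then have "w x \<ge> 0" using ge(1)[of x] gt U by auto
    then have "B k x * w x \<ge> 0" using B[OF kx] by simp
    moreover have "P k x * s = (\<sigma> * P k x) * s0" by (simp add: s_def)
    moreover have "c * s0 \<le> (\<sigma> * P k x) * s0" using P[OF kx] s0 by (intro mult_right_mono) auto
    moreover have "c * s0 = Fm + 1" using c by (simp add: s0_def)
    ultimately show "P k x * s + B k x * w x - F k x > 0" using F[OF kx] by linarith
  qed (use ge(1)[of xL] ge(1)[of xR] U less in auto)
  then show ?thesis using ge(2)[OF x] by (simp add: s0_def)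
qed

lemma bound_convection:
  assumes sgn: "\<sigma> = 1 \<or> \<sigma> = -1"
    and P: "\<And>k x. k \<in> {1..N} \<Longrightarrow> x \<in> {X (k - 1)..X k} \<Longrightarrow> \<sigma> * P k x \<ge> c" and c: "c > 0"
    and B: "\<And>k x. k \<in> {1..N} \<Longrightarrow> x \<in> {X (k - 1)..X k} \<Longrightarrow> B k x \<ge> 0"
    and F: "\<And>k x. k \<in> {1..N} \<Longrightarrow> x \<in> {X (k - 1)..X k} \<Longrightarrow> \<bar>F k x\<bar> \<le> Fm"
    and U: "\<bar>w xL\<bar> \<le> U" "\<bar>w xR\<bar> \<le> U" and Fm: "Fm \<ge> 0" and x: "x \<in> {xL..xR}"
  shows "\<bar>w x\<bar> \<le> U + (Fm + 1) / c * (xR - xL)"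
proof -
  interpret neg: pw_solution xL xR N X eps P B "\<lambda>k x. - F k x" "\<lambda>x. - w x" "\<lambda>x. - v x"
    by (rule uminus)
  have "w x \<le> U + (Fm + 1) / c * (xR - xL)" using assms by (rule upper_bound_convection)
  moreover have "- w x \<le> U + (Fm + 1) / c * (xR - xL)"
    by (rule neg.upper_bound_convection[OF sgn P c B _ _ _ Fm x]) (use F U in auto)
  ultimately show ?thesis by auto
qed

text \<open>The flux \<open>F - B w = P v - eps v'\<close> tested with the sign of \<open>v\<close>: the diffusive part is
  dissipative, and the convective part is negligible whatever the sign and the jumps of \<open>P\<close>.\<close>

lemma variation_reaction:
  assumes P_deriv: "\<And>k x. k \<in> {1..N} \<Longrightarrow> x \<in> {X (k - 1)..X k} \<Longrightarrow>
      (P k has_real_derivative P' k x) (at x within {X (k - 1)..X k})"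
    and B_deriv: "\<And>k x. k \<in> {1..N} \<Longrightarrow> x \<in> {X (k - 1)..X k} \<Longrightarrow>
      (B k has_real_derivative B' k x) (at x within {X (k - 1)..X k})"
    and F_deriv: "\<And>k x. k \<in> {1..N} \<Longrightarrow> x \<in> {X (k - 1)..X k} \<Longrightarrow>
      (F k has_real_derivative F' k x) (at x within {X (k - 1)..X k})"
    and P'_le: "\<And>k x. k \<in> {1..N} \<Longrightarrow> x \<in> {X (k - 1)..X k} \<Longrightarrow> \<bar>P' k x\<bar> \<le> Q"
    and P_le: "\<And>k x. k \<in> {1..N} \<Longrightarrow> x \<in> {X (k - 1)..X k} \<Longrightarrow> \<bar>P k x\<bar> \<le> Pm"
    and D: "\<And>k x. k \<in> {1..N} \<Longrightarrow> x \<in> {X (k - 1)..X k} \<Longrightarrow> \<bar>F' k x - B' k x * w x\<bar> \<le> D"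
    and G: "\<And>k x. k \<in> {1..N} \<Longrightarrow> x \<in> {X (k - 1)..X k} \<Longrightarrow> \<bar>F k x - B k x * w x\<bar> \<le> G"
    and B: "\<And>k x. k \<in> {1..N} \<Longrightarrow> x \<in> {X (k - 1)..X k} \<Longrightarrow> B k x \<ge> b0" and b0: "b0 > 0"
    and jump: "\<And>k. k \<in> {1..<N} \<Longrightarrow>
      \<bar>(F (Suc k) (X k) - B (Suc k) (X k) * w (X k)) - (F k (X k) - B k (X k) * w (X k))\<bar>
        \<le> \<rho> (Suc k) - \<rho> k"
  shows "b0 * integral {xL..xR} (\<lambda>x. \<bar>v x\<bar>) \<le> 2 * G + D * (xR - xL) + (\<rho> N - \<rho> 1)"
proof -
  have N: "N \<ge> 1" using mesh less by (cases N) (auto simp: is_mesh_def)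
  define V where "V x = integral {xL..x} (\<lambda>x. \<bar>v x\<bar>)" for x
  have dV: "(V has_real_derivative \<bar>v x\<bar>) (at x within {xL..xR})" if "x \<in> {xL..xR}" for x
    unfolding V_def using that by (intro integral_has_real_derivative continuous_intros v_cont)
  have main: "b0 * V xR \<le> (2 * G + D * (xR - xL) + (\<rho> N - \<rho> 1)) +
      \<tau> * (2 * Pm + (Q + b0) * (xR - xL) + 2 * Pm * real N)" if \<tau>: "\<tau> > 0" for \<tau>
  proof -
    note sb = smooth_sgn_bounds[OF \<tau>]
    define g where "g k x = F k x - B k x * w x" for k x
    \<comment> \<open>The second term is chosen so that in \<open>H'\<close> the factor
      \<open>smooth_sgn_deriv \<tau> (v x) * v'\<close> multiplies
      \<open>g - P v = - eps v'\<close>; what is left of this pair is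
      \<open>- eps * smooth_sgn_deriv \<tau> (v x) * (v')\<^sup>2 \<le> 0\<close>.\<close>
    define H where "H k x = smooth_sgn \<tau> (v x) * g k x - P k x * smooth_sgn_rest \<tau> (v x)" for k x
    have Pm: "Pm \<ge> 0" using P_le[of 1 "X 0"] N mesh_Icc_subset(2)[OF mesh, of 1] by force
    have Hle: "\<bar>H k x\<bar> \<le> G + \<tau> * Pm" if "k \<in> {1..N}" "x \<in> {X (k - 1)..X k}" for k x
    proof -
      have "\<bar>smooth_sgn \<tau> (v x) * g k x\<bar> \<le> 1 * G"
        unfolding abs_mult using sb(1) G[OF that] by (intro mult_mono) (auto simp: g_def)
      moreover have "\<bar>P k x * smooth_sgn_rest \<tau> (v x)\<bar> \<le> Pm * \<tau>"
        unfolding abs_mult using sb(4,5) P_le[OF that] by (intro mult_mono) auto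
      ultimately show ?thesis unfolding H_def by (simp add: mult.commute)
    qed
    have mesh_step: "H k (X k) + b0 * V (X k) \<le> H k (X (k - 1)) + b0 * V (X (k - 1)) +
        (D + (Q + b0) * \<tau>) * (X k - X (k - 1))" if k: "k \<in> {1..N}" for k
    proof -
      define dv where "dv x = (P k x * v x + B k x * w x - F k x) / eps" for x
      have "(H k (X k) + b0 * V (X k)) - (H k (X (k - 1)) + b0 * V (X (k - 1)))
        \<le> (D + (Q + b0) * \<tau>) * (X k - X (k - 1))"
      proof (rule deriv_within_diff_le[where f' = "\<lambda>x.
          (smooth_sgn_deriv \<tau> (v x) * dv x * g k x + smooth_sgn \<tau> (v x) * (F' k x - (B' k x * w x + B k x * v x)))
          - (P' k x * smooth_sgn_rest \<tau> (v x) + P k x * (v x * smooth_sgn_deriv \<tau> (v x) * dv x)) + b0 * \<bar>v x\<bar>"])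
        show "X (k - 1) \<le> X k" using mesh_Icc_subset(2)[OF mesh k] by simp
      next
        fix x assume x: "x \<in> {X (k - 1)..X k}"
        have dvx: "(v has_real_derivative dv x) (at x within {X (k - 1)..X k})"
          unfolding dv_def using k x by (rule v_deriv)
        have dw: "(w has_real_derivative v x) (at x within {X (k - 1)..X k})"
          using mesh_Icc_subset(1)[OF mesh k] x by (rule w_deriv_sub)
        have dVx: "(V has_real_derivative \<bar>v x\<bar>) (at x within {X (k - 1)..X k})"
          using mesh_Icc_subset(1)[OF mesh k] x by (intro DERIV_subset[OF dV]) auto
        show "((\<lambda>x. H k x + b0 * V x) has_real_derivative
          (smooth_sgn_deriv \<tau> (v x) * dv x * g k x + smooth_sgn \<tau> (v x) * (F' k x - (B' k x * w x + B k x * v x)))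
          - (P' k x * smooth_sgn_rest \<tau> (v x) + P k x * (v x * smooth_sgn_deriv \<tau> (v x) * dv x)) + b0 * \<bar>v x\<bar>)
          (at x within {X (k - 1)..X k})"
          unfolding H_def g_def
          by (rule derivative_eq_intros dvx dw dVx P_deriv[OF k x] B_deriv[OF k x] F_deriv[OF k x]
              DERIV_chain2[OF smooth_sgn_has_deriv(1)[OF \<tau>] dvx]
              DERIV_chain2[OF smooth_sgn_has_deriv(2)[OF \<tau>] dvx] refl)+
             (simp add: algebra_simps)
      next
        fix x assume "x \<in> {X (k - 1)<..<X k}"
        then have x: "x \<in> {X (k - 1)..X k}" by auto
        have g: "g k x = P k x * v x - eps * dv x" using eps_pos by (simp add: dv_def g_def)
        have "smooth_sgn_deriv \<tau> (v x) * dv x * g k x - P k x * (v x * smooth_sgn_deriv \<tau> (v x) * dv x)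
          = - eps * (smooth_sgn_deriv \<tau> (v x) * (dv x)\<^sup>2)"
          unfolding g by (simp add: algebra_simps power2_eq_square)
        also have "\<dots> \<le> 0" using eps_pos sb(6) by (intro mult_nonpos_nonneg) auto
        finally have 1: "smooth_sgn_deriv \<tau> (v x) * dv x * g k x -
          P k x * (v x * smooth_sgn_deriv \<tau> (v x) * dv x) \<le> 0" .
        have "\<bar>smooth_sgn \<tau> (v x) * (F' k x - B' k x * w x)\<bar> \<le> 1 * D"
          unfolding abs_mult using sb(1) D[OF k x] by (intro mult_mono) auto
        then have 2: "smooth_sgn \<tau> (v x) * (F' k x - B' k x * w x) \<le> D" by simp
        have "b0 * (\<bar>v x\<bar> - \<tau>) \<le> b0 * (smooth_sgn \<tau> (v x) * v x)"
          using b0 sb(2) by simp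
        also have "\<dots> \<le> B k x * (smooth_sgn \<tau> (v x) * v x)"
          using B[OF k x] sb(3) by (intro mult_right_mono)
        finally have 3: "b0 * (\<bar>v x\<bar> - \<tau>) \<le> smooth_sgn \<tau> (v x) * (B k x * v x)" by (simp add: ac_simps)
        have "\<bar>P' k x * smooth_sgn_rest \<tau> (v x)\<bar> \<le> Q * \<tau>"
          unfolding abs_mult using sb(4,5) P'_le[OF k x] by (intro mult_mono) auto
        then have 4: "- (P' k x * smooth_sgn_rest \<tau> (v x)) \<le> Q * \<tau>" by simp
        show "(smooth_sgn_deriv \<tau> (v x) * dv x * g k x + smooth_sgn \<tau> (v x) * (F' k x - (B' k x * w x + B k x * v x)))
          - (P' k x * smooth_sgn_rest \<tau> (v x) + P k x * (v x * smooth_sgn_deriv \<tau> (v x) * dv x)) + b0 * \<bar>v x\<bar>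
          \<le> D + (Q + b0) * \<tau>"
          using 1 2 3 4 by (simp add: algebra_simps)
      qed
      then show ?thesis by simp
    qed
    \<comment> \<open>The last term grows with the number of breakpoints, but it carries
      \<open>\<tau>\<close>, which tends to \<open>0\<close> on a fixed mesh.\<close>
    have tele: "H k (X k) + b0 * V (X k) \<le> H 1 xL + (D + (Q + b0) * \<tau>) * (X k - xL) + (\<rho> k - \<rho> 1) +
        2 * Pm * \<tau> * real k" if "1 \<le> k" "k \<le> N" for k
      using that
    proof (induction k rule: dec_induct)
      case base
      have "V xL = 0" by (simp add: V_def)
      moreover have "0 \<le> 2 * Pm * \<tau>" using Pm \<tau> by simp
      moreover have "X 0 = xL" using mesh by (simp add: is_mesh_def)
      ultimately show ?case using mesh_step[of 1] N by simp
    next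
      case (step k)
      have k: "k \<in> {1..N}" "Suc k \<in> {1..N}" and k': "k \<in> {1..<N}" using step by auto
      have X: "X k \<in> {X (k - 1)..X k}" "X k \<in> {X (Suc k - 1)..X (Suc k)}"
        using mesh_Icc_subset(2)[OF mesh k(1)] mesh_Icc_subset(2)[OF mesh k(2)] by auto
      \<comment> \<open>The jump of the flux is paid by the increment of \<open>\<rho>\<close>. The
        jump of \<open>P\<close> need not be small, but it is multiplied by
        \<open>smooth_sgn_rest\<close>.\<close>
      have "H (Suc k) (X k) - H k (X k) = smooth_sgn \<tau> (v (X k)) * (g (Suc k) (X k) - g k (X k)) +
          (P k (X k) - P (Suc k) (X k)) * smooth_sgn_rest \<tau> (v (X k))"
        by (simp add: H_def algebra_simps)
      also have "\<dots> \<le> 1 * (\<rho> (Suc k) - \<rho> k) + (2 * Pm) * \<tau>"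
      proof (rule add_mono; rule abs_le_D1)
        show "\<bar>smooth_sgn \<tau> (v (X k)) * (g (Suc k) (X k) - g k (X k))\<bar> \<le> 1 * (\<rho> (Suc k) - \<rho> k)"
          unfolding abs_mult using sb(1) jump[OF k'] by (intro mult_mono) (auto simp: g_def)
        show "\<bar>(P k (X k) - P (Suc k) (X k)) * smooth_sgn_rest \<tau> (v (X k))\<bar> \<le> (2 * Pm) * \<tau>"
          unfolding abs_mult using sb(4,5) P_le[OF k(1) X(1)] P_le[OF k(2) X(2)]
          by (intro mult_mono) auto
      qed
      finally have "H (Suc k) (X k) - H k (X k) \<le> \<rho> (Suc k) - \<rho> k + 2 * Pm * \<tau>" by simp
      moreover have "(D + (Q + b0) * \<tau>) * (X (Suc k) - xL) =
          (D + (Q + b0) * \<tau>) * (X (Suc k) - X k) + (D + (Q + b0) * \<tau>) * (X k - xL)"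
        by (simp add: algebra_simps)
      moreover have "2 * Pm * \<tau> * real (Suc k) = 2 * Pm * \<tau> * real k + 2 * Pm * \<tau>"
        by (simp add: algebra_simps)
      moreover have "H k (X k) + b0 * V (X k) \<le> H 1 xL + (D + (Q + b0) * \<tau>) * (X k - xL) +
          (\<rho> k - \<rho> 1) + 2 * Pm * \<tau> * real k"
        using step by simp
      moreover have "H (Suc k) (X (Suc k)) + b0 * V (X (Suc k)) \<le> H (Suc k) (X k) + b0 * V (X k) +
          (D + (Q + b0) * \<tau>) * (X (Suc k) - X k)"
        using mesh_step[OF k(2)] by simp
      ultimately show ?case by linarith
    qed
    have XN: "X N = xR" using mesh by (simp add: is_mesh_def)
    have "N \<in> {1..N}" "xR \<in> {X (N - 1)..X N}" "1 \<in> {1..N}" "xL \<in> {X (1 - 1)..X 1}"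
      using N XN mesh mesh_Icc_subset(2)[OF mesh, of N] mesh_Icc_subset(2)[OF mesh, of 1]
      by (auto simp: is_mesh_def)
    then have "\<bar>H N xR\<bar> \<le> G + \<tau> * Pm" "\<bar>H 1 xL\<bar> \<le> G + \<tau> * Pm" using Hle by blast+
    with tele[of N] N XN show ?thesis by (simp add: algebra_simps)
  qed
  have "b0 * V xR \<le> 2 * G + D * (xR - xL) + (\<rho> N - \<rho> 1)"
  proof (rule ccontr)
    assume neg: "\<not> ?thesis"
    define d where "d = b0 * V xR - (2 * G + D * (xR - xL) + (\<rho> N - \<rho> 1))"
    define K where "K = 2 * Pm + (Q + b0) * (xR - xL) + 2 * Pm * real N"
    have d: "d > 0" using neg by (simp add: d_def)
    \<comment> \<open>Passage to the limit: \<open>\<tau> = 1\<close> shows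
      \<open>K \<ge> d > 0\<close>, and then \<open>\<tau> = d / (2 * K)\<close> yields
      \<open>d \<le> d / 2\<close>.\<close>
    have "d \<le> \<tau> * K" if "\<tau> > 0" for \<tau> using main[OF that] by (simp add: d_def K_def)
    from this[of 1] this[of "d / (2 * K)"] d show False by (cases "K = 0") auto
  qed
  then show ?thesis by (simp add: V_def)
qed

text \<open>The decay estimate is read backwards: once \<open>\<bar>v\<bar>\<close> exceeds
  \<open>G / c\<close> at a point, it does so at all points to its right if
  \<open>\<sigma> = 1\<close>, to its left if \<open>\<sigma> = -1\<close>. This is the persistence
  that bounds the variation.\<close>

lemma variation_convection:
  assumes sgn: "\<sigma> = 1 \<or> \<sigma> = -1"
    and cont: "\<And>k. k \<in> {1..N} \<Longrightarrow> continuous_on {X (k - 1)..X k} (P k)"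
    and P: "\<And>k x. k \<in> {1..N} \<Longrightarrow> x \<in> {X (k - 1)..X k} \<Longrightarrow> \<sigma> * P k x \<ge> c" and c: "c > 0"
    and G: "\<And>k x. k \<in> {1..N} \<Longrightarrow> x \<in> {X (k - 1)..X k} \<Longrightarrow> \<bar>F k x - B k x * w x\<bar> \<le> G"
    and w: "\<And>x. x \<in> {xL..xR} \<Longrightarrow> \<bar>w x\<bar> \<le> M"
  shows "integral {xL..xR} (\<lambda>x. \<bar>v x\<bar>) \<le> 2 * M + G / c * (xR - xL)"
proof -
  interpret neg: pw_solution xL xR N X eps P B "\<lambda>k x. - F k x" "\<lambda>x. - w x" "\<lambda>x. - v x"
    by (rule uminus)
  have N: "N \<ge> 1" using mesh less by (cases N) (auto simp: is_mesh_def)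
  have "G \<ge> 0" using G[of 1 "X 0"] N mesh_Icc_subset(2)[OF mesh, of 1] by force
  then have K: "G / c \<ge> 0" using c by simp
  have G': "\<bar>- F k x - B k x * - w x\<bar> \<le> G" if "k \<in> {1..N}" "x \<in> {X (k - 1)..X k}" for k x
    using G[OF that] by simp
  have pos: "max 0 s \<le> max 0 t * exp z \<Longrightarrow> s > 0 \<Longrightarrow> t > 0" for s t z :: real
    by (cases "t > 0") (auto simp: max_def split: if_splits)
  from sgn show ?thesis
  proof
    assume s: "\<sigma> = 1"
    show ?thesis
    proof (rule integral_abs_le_persist_right[OF _ v_cont w_deriv w K])
      fix x y assume xy: "xL \<le> x" "x \<le> y" "y \<le> xR" "\<bar>v x\<bar> > G / c"
      show "\<bar>v y\<bar> > G / c"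
      proof (cases "x = y")
        case False
        then have lt: "x < y" using xy by simp
        have "max 0 (v x - G / c) \<le> max 0 (v y - G / c) * exp (- c * (y - x) / eps)"
          by (rule decay_right[OF xy(1) lt xy(3) cont c]) (use P s G in auto)
        moreover have "max 0 (- v x - G / c) \<le> max 0 (- v y - G / c) * exp (- c * (y - x) / eps)"
          by (rule neg.decay_right[OF xy(1) lt xy(3) cont c]) (use P s G' in auto)
        moreover have "v x - G / c > 0 \<or> - v x - G / c > 0" using xy(4) by linarith
        ultimately have "v y - G / c > 0 \<or> - v y - G / c > 0" using pos by blast
        then show ?thesis by linarith
      qed (use xy in auto)
    qed (use less in auto)
  next
    assume s: "\<sigma> = -1"
    have P': "P k x \<le> - c" if "k \<in> {1..N}" "x \<in> {X (k - 1)..X k}" for k x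
      using P[OF that] s by simp
    show ?thesis
    proof (rule integral_abs_le_persist_left[OF _ v_cont w_deriv w K])
      fix x y assume xy: "xL \<le> x" "x \<le> y" "y \<le> xR" "\<bar>v y\<bar> > G / c"
      show "\<bar>v x\<bar> > G / c"
      proof (cases "x = y")
        case False
        then have lt: "x < y" using xy by simp
        have "max 0 (v y - G / c) \<le> max 0 (v x - G / c) * exp (- c * (y - x) / eps)"
          by (rule decay_left[OF xy(1) lt xy(3) cont c]) (use P' G in auto)
        moreover have "max 0 (- v y - G / c) \<le> max 0 (- v x - G / c) * exp (- c * (y - x) / eps)"
          by (rule neg.decay_left[OF xy(1) lt xy(3) cont c]) (use P' G' in auto)
        moreover have "v y - G / c > 0 \<or> - v y - G / c > 0" using xy(4) by linarith
        ultimately have "v x - G / c > 0 \<or> - v x - G / c > 0" using pos by blast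
        then show ?thesis by linarith
      qed (use xy in auto)
    qed (use less in auto)
  qed
qed

text \<open>The mean value theorem provides a point with
  \<open>\<bar>v\<bar> \<le> 2 * M / (xR - xL)\<close>; from there \<open>eps * v\<close> changes by
  at most the integral of \<open>\<bar>P v + B w - F\<bar>\<close>, which the variation of
  \<open>w\<close> controls. Jumps of \<open>P\<close> do no harm because \<open>v\<close> is
  continuous.\<close>

lemma eps_v_bound:
  assumes P: "\<And>k x. k \<in> {1..N} \<Longrightarrow> x \<in> {X (k - 1)..X k} \<Longrightarrow> \<bar>P k x\<bar> \<le> Pm"
    and G: "\<And>k x. k \<in> {1..N} \<Longrightarrow> x \<in> {X (k - 1)..X k} \<Longrightarrow> \<bar>F k x - B k x * w x\<bar> \<le> G"
    and w: "\<And>x. x \<in> {xL..xR} \<Longrightarrow> \<bar>w x\<bar> \<le> M"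
    and V: "integral {xL..xR} (\<lambda>x. \<bar>v x\<bar>) \<le> V"
    and x: "x \<in> {xL..xR}" and eps: "eps \<le> 1"
  shows "eps * \<bar>v x\<bar> \<le> 2 * M / (xR - xL) + Pm * V + G * (xR - xL)"
proof -
  have N: "N \<ge> 1" using mesh less by (cases N) (auto simp: is_mesh_def)
  have G0: "G \<ge> 0" and Pm0: "Pm \<ge> 0"
    using G[of 1 "X 0"] P[of 1 "X 0"] N mesh_Icc_subset(2)[OF mesh, of 1] by force+
  have le: "\<bar>eps * v b - eps * v a\<bar> \<le> Pm * integral {a..b} (\<lambda>x. \<bar>v x\<bar>) + G * (b - a)"
    if ab: "xL \<le> a" "a < b" "b \<le> xR" for a b
  proof (rule mesh_chain[where R = "\<lambda>a b. \<bar>eps * v b - eps * v a\<bar> \<le>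
      Pm * integral {a..b} (\<lambda>x. \<bar>v x\<bar>) + G * (b - a)", OF mesh _ _ ab])
    fix k a b assume k: "k \<in> {1..N}" "X (k - 1) \<le> a" "a \<le> b" "b \<le> X k"
    have sub: "{a..b} \<subseteq> {xL..xR}" using mesh_Icc_subset(1)[OF mesh k(1)] k by auto
    have cabs: "continuous_on {a..b} (\<lambda>x. \<bar>v x\<bar>)"
      by (intro continuous_intros continuous_on_subset[OF v_cont sub])
    define R where "R t = Pm * integral {a..t} (\<lambda>x. \<bar>v x\<bar>) + G * t" for t
    have dR: "(R has_real_derivative Pm * \<bar>v t\<bar> + G) (at t within {a..b})" if "t \<in> {a..b}" for t
      unfolding R_def
      by (rule derivative_eq_intros integral_has_real_derivative[OF cabs that] refl)+ simp
    have bd: "\<bar>P k t * v t + B k t * w t - F k t\<bar> \<le> Pm * \<bar>v t\<bar> + G" if "t \<in> {a..b}" for t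
    proof -
      have t: "t \<in> {X (k - 1)..X k}" using that k by auto
      have "\<bar>P k t * v t\<bar> \<le> Pm * \<bar>v t\<bar>"
        unfolding abs_mult using P[OF k(1) t] by (intro mult_right_mono) auto
      then show ?thesis using G[OF k(1) t] by linarith
    qed
    have bd': "0 \<le> Pm * \<bar>v t\<bar> + G - (P k t * v t + B k t * w t - F k t)"
      "0 \<le> Pm * \<bar>v t\<bar> + G + (P k t * v t + B k t * w t - F k t)" if "t \<in> {a<..<b}" for t
      using bd[of t] that by auto
    have dv: "((\<lambda>t. eps * v t) has_real_derivative P k t * v t + B k t * w t - F k t) (at t within {a..b})"
      if "t \<in> {a..b}" for t
      using DERIV_cmult[OF v_deriv_sub[OF k(1,2,4) that], of eps] eps_pos by simp
    have "R a - eps * v a \<le> R b - eps * v b"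
      by (rule nonneg_deriv_within_imp_le[OF k(3) DERIV_diff[OF dR dv]])
        (assumption | rule bd')+
    moreover have "R a + eps * v a \<le> R b + eps * v b"
      by (rule nonneg_deriv_within_imp_le[OF k(3) DERIV_add[OF dR dv]])
        (assumption | rule bd')+
    moreover have "R a = G * a" by (simp add: R_def)
    ultimately show "\<bar>eps * v b - eps * v a\<bar> \<le> Pm * integral {a..b} (\<lambda>x. \<bar>v x\<bar>) + G * (b - a)"
      unfolding R_def by (simp add: algebra_simps abs_le_iff)
  next
    fix a b c assume le: "xL \<le> a" "a \<le> b" "b \<le> c" "c \<le> xR"
      and 1: "\<bar>eps * v b - eps * v a\<bar> \<le> Pm * integral {a..b} (\<lambda>x. \<bar>v x\<bar>) + G * (b - a)"
      and 2: "\<bar>eps * v c - eps * v b\<bar> \<le> Pm * integral {b..c} (\<lambda>x. \<bar>v x\<bar>) + G * (c - b)"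
    have "(\<lambda>x. \<bar>v x\<bar>) integrable_on {a..c}" using le by (intro abs_v_integrable) auto
    then have "integral {a..c} (\<lambda>x. \<bar>v x\<bar>) = integral {a..b} (\<lambda>x. \<bar>v x\<bar>) + integral {b..c} (\<lambda>x. \<bar>v x\<bar>)"
      using Henstock_Kurzweil_Integration.integral_combine[OF le(2,3)] by metis
    with 1 2 show "\<bar>eps * v c - eps * v a\<bar> \<le> Pm * integral {a..c} (\<lambda>x. \<bar>v x\<bar>) + G * (c - a)"
      by (simp add: algebra_simps)
  qed
  have sub: "\<bar>eps * v b - eps * v a\<bar> \<le> Pm * V + G * (xR - xL)"
    if ab: "xL \<le> a" "a < b" "b \<le> xR" for a b
  proof -
    have "integral {a..b} (\<lambda>x. \<bar>v x\<bar>) \<le> integral {xL..xR} (\<lambda>x. \<bar>v x\<bar>)"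
      using ab by (intro integral_subset_le abs_v_integrable) auto
    then have "Pm * integral {a..b} (\<lambda>x. \<bar>v x\<bar>) \<le> Pm * V" using V Pm0 by (intro mult_left_mono) auto
    moreover have "G * (b - a) \<le> G * (xR - xL)" using ab G0 by (intro mult_left_mono) auto
    ultimately show ?thesis using le[OF ab] by linarith
  qed
  obtain \<xi> where xi: "xL < \<xi>" "\<xi> < xR" "w xR - w xL = (xR - xL) * v \<xi>"
    using mvt_within[OF less w_deriv] by blast
  have "\<bar>v \<xi>\<bar> = \<bar>w xR - w xL\<bar> / (xR - xL)"
    using less by (simp add: xi(3) abs_mult)
  also have "\<dots> \<le> 2 * M / (xR - xL)"
    using w[of xL] w[of xR] less by (intro divide_right_mono) auto
  finally have v\<xi>: "\<bar>v \<xi>\<bar> \<le> 2 * M / (xR - xL)" .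
  have "eps * \<bar>v \<xi>\<bar> \<le> 1 * \<bar>v \<xi>\<bar>" using eps by (intro mult_right_mono) auto
  then have 1: "eps * \<bar>v \<xi>\<bar> \<le> 2 * M / (xR - xL)" using v\<xi> by linarith
  have "Pm * V + G * (xR - xL) \<ge> 0" using sub[of xL xR] less by auto
  then have "\<bar>eps * v x - eps * v \<xi>\<bar> \<le> Pm * V + G * (xR - xL)"
    using sub[of x \<xi>] sub[of \<xi> x] x xi by (cases x \<xi> rule: linorder_cases) auto
  moreover have "eps * \<bar>v x\<bar> = \<bar>eps * v x\<bar>" "eps * \<bar>v \<xi>\<bar> = \<bar>eps * v \<xi>\<bar>" using eps_pos by (auto simp: abs_mult)
  ultimately show ?thesis using 1 by linarith
qed

end

subsection \<open>Exact and approximate solutions as piecewise solutions\<close>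

lemma has_real_derivative_unique_within_Icc:
  fixes g :: "real \<Rightarrow> real"
  assumes "a < b" "x \<in> {a..b}" "(g has_real_derivative d) (at x within {a..b})"
    "(g has_real_derivative e) (at x within {a..b})"
  shows "d = e"
  using vector_derivative_within_cbox[of a b x g] assms
  by (auto simp: has_real_derivative_iff_has_vector_derivative)

lemma deriv_Icc_eq:
  assumes "a < b" "x \<in> {a..b}" "(g has_real_derivative d) (at x within {a..b})"
  shows "deriv_Icc a b g x = d"
  using vector_derivative_within_cbox[of a b x g d] assms
  by (auto simp: deriv_Icc_def has_real_derivative_iff_has_vector_derivative)

lemma C_k_on_2E:
  assumes "C_k_on 2 S g"
  obtains g1 g2 where "\<And>x. x \<in> S \<Longrightarrow> (g has_real_derivative g1 x) (at x within S)"
    "\<And>x. x \<in> S \<Longrightarrow> (g1 has_real_derivative g2 x) (at x within S)" "continuous_on S g2"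
proof -
  obtain D :: "nat \<Rightarrow> real \<Rightarrow> real" where D: "\<And>x. x \<in> S \<Longrightarrow> D 0 x = g x"
    "\<And>n x. n < 2 \<Longrightarrow> x \<in> S \<Longrightarrow> (D n has_real_derivative D (Suc n) x) (at x within S)"
    "continuous_on S (D 2)"
    using assms unfolding C_k_on_def by blast
  show ?thesis
  proof (rule that[of "D 1" "D 2"])
    show "(g has_real_derivative D 1 x) (at x within S)" if "x \<in> S" for x
      using D(2)[of 0 x] that D(1)
      by (auto intro: has_field_derivative_transform_within[where d = 1])
    show "(D 1 has_real_derivative D 2 x) (at x within S)" if "x \<in> S" for x
      using D(2)[of 1 x] that by (simp add: numeral_2_eq_2)
  qed (fact D(3))
qed

lemma C_k_on_1E:
  assumes "C_k_on 1 S g"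
  obtains g1 where "\<And>x. x \<in> S \<Longrightarrow> (g has_real_derivative g1 x) (at x within S)" "continuous_on S g1"
proof -
  obtain D :: "nat \<Rightarrow> real \<Rightarrow> real" where D: "\<And>x. x \<in> S \<Longrightarrow> D 0 x = g x"
    "\<And>n x. n < 1 \<Longrightarrow> x \<in> S \<Longrightarrow> (D n has_real_derivative D (Suc n) x) (at x within S)"
    "continuous_on S (D 1)"
    using assms unfolding C_k_on_def by blast
  show ?thesis
  proof (rule that[of "D 1"])
    show "(g has_real_derivative D 1 x) (at x within S)" if "x \<in> S" for x
      using D(2)[of 0 x] that D(1)
      by (auto intro: has_field_derivative_transform_within[where d = 1])
  qed (fact D(3))
qed

text \<open>The first-order equation for \<open>u'\<close> has coefficients continuous up to the boundary, so \<open>u'\<close>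
  extends to the closed interval by variation of constants.\<close>

lemma exact_solution_pw:
  assumes less: "xL < xR" and eps: "eps > 0"
    and contp: "continuous_on {xL..xR} p" and contb: "continuous_on {xL..xR} b"
    and contf: "continuous_on {xL..xR} f"
    and sol: "exact_solution xL xR p b f uL uR eps u"
  obtains v where "pw_solution xL xR 1 (\<lambda>k. if k = 0 then xL else xR) eps (\<lambda>k. p) (\<lambda>k. b) (\<lambda>k. f) u v"
proof -
  have contu: "continuous_on {xL..xR} u" and C2: "C_k_on 2 {xL<..<xR} u"
    and ode: "\<And>x. x \<in> {xL<..<xR} \<Longrightarrow> - eps * deriv (deriv u) x + p x * deriv u x + b x * u x = f x"
    using sol by (auto simp: exact_solution_def)
  obtain D1 D2 where D1': "\<And>x. x \<in> {xL<..<xR} \<Longrightarrow> (u has_real_derivative D1 x) (at x within {xL<..<xR})"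
    and D2': "\<And>x. x \<in> {xL<..<xR} \<Longrightarrow> (D1 has_real_derivative D2 x) (at x within {xL<..<xR})"
    using C_k_on_2E[OF C2] by metis
  have D1: "DERIV u x :> D1 x" and D2: "DERIV D1 x :> D2 x" if "x \<in> {xL<..<xR}" for x
    using D1'[OF that] D2'[OF that] that by (simp_all add: at_within_open[OF that])
  have du: "deriv u x = D1 x" if "x \<in> {xL<..<xR}" for x using D1[OF that] by (rule DERIV_imp_deriv)
  have ddu: "deriv (deriv u) x = D2 x" if x: "x \<in> {xL<..<xR}" for x
  proof (rule DERIV_imp_deriv)
    show "DERIV (deriv u) x :> D2 x"
      by (rule has_field_derivative_transform_within_open[OF D2[OF x], of "{xL<..<xR}"])
        (use x du in auto)
  qed
  have ode': "D2 x = (p x * D1 x + b x * u x - f x) / eps" if "x \<in> {xL<..<xR}" for x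
    using ode[OF that] du[OF that] ddu[OF that] eps by (simp add: field_simps)
  \<comment> \<open>\<open>exp (- Q)\<close> is the integrating factor of the equation for
    \<open>u'\<close>. Both \<open>Q\<close> and \<open>R\<close> are continuous up to the
    endpoints, whereas \<open>u'\<close> is known only inside.\<close>
  define Q where "Q x = integral {xL..x} (\<lambda>x. p x / eps)" for x
  have dQ: "(Q has_real_derivative p x / eps) (at x within {xL..xR})" if "x \<in> {xL..xR}" for x
    unfolding Q_def using that eps
    by (intro integral_has_real_derivative continuous_intros contp) auto
  have contQ: "continuous_on {xL..xR} Q" using dQ by (rule DERIV_continuous_on)
  define R where "R x = integral {xL..x} (\<lambda>x. (b x * u x - f x) / eps * exp (- Q x))" for x
  have dR: "(R has_real_derivative (b x * u x - f x) / eps * exp (- Q x)) (at x within {xL..xR})"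
    if "x \<in> {xL..xR}" for x
    unfolding R_def using that eps
    by (intro integral_has_real_derivative continuous_intros contb contu contf contQ) auto
  define m where "m = (xL + xR) / 2"
  have m: "m \<in> {xL<..<xR}" using less by (simp add: m_def)
  define c where "c = D1 m * exp (- Q m) - R m"
  have const: "D1 x * exp (- Q x) - R x = c" if x: "x \<in> {xL<..<xR}" for x
    unfolding c_def
  proof (rule DERIV_isconst3[OF less x m])
    fix y assume y: "y \<in> {xL<..<xR}"
    then have "DERIV Q y :> p y / eps" "DERIV R y :> (b y * u y - f y) / eps * exp (- Q y)"
      using dQ[of y] dR[of y] by (auto simp: at_within_Icc_at)
    note d = this D2[OF y]
    have fy: "f y = p y * D1 y + b y * u y - eps * D2 y" using ode'[OF y] eps by simp
    show "DERIV (\<lambda>x. D1 x * exp (- Q x) - R x) y :> 0"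
      by (rule derivative_eq_intros d refl)+ (use eps in \<open>simp add: fy field_simps\<close>)
  qed
  define v where "v x = (c + R x) * exp (Q x)" for x
  have vD1: "v x = D1 x" if "x \<in> {xL<..<xR}" for x
    using const[OF that] by (simp add: v_def exp_minus field_simps)
  have dv: "(v has_real_derivative (p x * v x + b x * u x - f x) / eps) (at x within {xL..xR})"
    if x: "x \<in> {xL..xR}" for x
    unfolding v_def
    by (rule derivative_eq_intros dR[OF x] dQ[OF x] refl)+
      (use eps in \<open>simp add: field_simps exp_minus\<close>)
  have contv: "continuous_on {xL..xR} v" using dv by (rule DERIV_continuous_on)
  \<comment> \<open>Comparing \<open>u\<close> with a primitive of the extension \<open>v\<close>
    yields the one-sided derivatives of \<open>u\<close> at the endpoints.\<close>
  define W where "W x = integral {xL..x} v" for x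
  have dW: "(W has_real_derivative v x) (at x within {xL..xR})" if "x \<in> {xL..xR}" for x
    unfolding W_def using that by (intro integral_has_real_derivative contv)
  have contW: "continuous_on {xL..xR} W" using dW by (rule DERIV_continuous_on)
  have uW: "u x - W x = u xL - W xL" if "x \<in> {xL..xR}" for x
  proof (rule DERIV_isconst2[OF less, of "\<lambda>x. u x - W x"])
    show "continuous_on {xL..xR} (\<lambda>x. u x - W x)" by (intro continuous_intros contu contW)
    fix y assume "xL < y" "y < xR"
    then have y: "y \<in> {xL<..<xR}" by simp
    have "DERIV W y :> v y" using dW[of y] y by (auto simp: at_within_Icc_at)
    from DERIV_diff[OF D1[OF y] this] show "DERIV (\<lambda>x. u x - W x) y :> 0"
      using vD1[OF y] by simp
  qed (use that in auto)
  have du': "(u has_real_derivative v x) (at x within {xL..xR})" if x: "x \<in> {xL..xR}" for x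
  proof (rule has_field_derivative_transform_within[where d = 1])
    show "((\<lambda>x. W x + (u xL - W xL)) has_real_derivative v x) (at x within {xL..xR})"
      using DERIV_add[OF dW[OF x] DERIV_const] by simp
    show "W y + (u xL - W xL) = u y" if "y \<in> {xL..xR}" for y using uW[OF that] by simp
  qed (use x in auto)
  show ?thesis
  proof (rule that, unfold_locales)
    fix k x assume k: "k \<in> {1..1::nat}"
      and x: "x \<in> {(if k - 1 = 0 then xL else xR)..(if k = 0 then xL else xR)}"
    then show "(v has_real_derivative (p x * v x + b x * u x - f x) / eps)
        (at x within {(if k - 1 = 0 then xL else xR)..(if k = 0 then xL else xR)})"
      using dv by simp
  qed (use less eps du' contv in \<open>auto simp: is_mesh_def\<close>)
qed

text \<open>On each closed mesh interval \<open>uh\<close> has a continuous second derivative, so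
  the equation, given in the interior, extends to the endpoints by continuity. Uniqueness of
  derivatives identifies the global \<open>v\<close> with the local first derivative.\<close>

lemma approx_solution_pw:
  assumes less: "xL < xR" and eps: "eps > 0" and mesh: "is_mesh xL xR N X"
    and contP: "\<And>k. k \<in> {1..N} \<Longrightarrow> continuous_on {X (k - 1)..X k} (p_bar xL xR p b \<delta> X k)"
    and sol: "approx_solution xL xR p b f uL uR \<delta> eps N X uh"
  obtains v where "pw_solution xL xR N X eps (p_bar xL xR p b \<delta> X)
    (\<lambda>k x. b (mesh_mid X k)) (\<lambda>k x. f (mesh_mid X k)) uh v"
proof -
  have C1: "C_k_on 1 {xL..xR} uh"
    and C2: "\<And>k. k \<in> {1..N} \<Longrightarrow> C_k_on 2 {X (k - 1)..X k} uh"
    and ode: "\<And>k x. k \<in> {1..N} \<Longrightarrow> x \<in> {X (k - 1)<..<X k} \<Longrightarrow>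
      - eps * deriv (deriv uh) x + p_bar xL xR p b \<delta> X k x * deriv uh x
             + b (mesh_mid X k) * uh x = f (mesh_mid X k)"
    using sol by (auto simp: approx_solution_def)
  obtain v where dw: "\<And>x. x \<in> {xL..xR} \<Longrightarrow> (uh has_real_derivative v x) (at x within {xL..xR})"
    and contv: "continuous_on {xL..xR} v"
    using C_k_on_1E[OF C1] by metis
  show ?thesis
  proof (rule that, unfold_locales)
    fix k x assume k: "k \<in> {1..N}" and x: "x \<in> {X (k - 1)..X k}"
    let ?P = "p_bar xL xR p b \<delta> X k"
    note sub = mesh_Icc_subset[OF mesh k]
    obtain D1 D2 where D1: "\<And>x. x \<in> {X (k - 1)..X k} \<Longrightarrow> (uh has_real_derivative D1 x) (at x within {X (k - 1)..X k})"
      and D2: "\<And>x. x \<in> {X (k - 1)..X k} \<Longrightarrow> (D1 has_real_derivative D2 x) (at x within {X (k - 1)..X k})"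
      and contD2: "continuous_on {X (k - 1)..X k} D2"
      using C_k_on_2E[OF C2[OF k]] by metis
    have vD1: "v y = D1 y" if y: "y \<in> {X (k - 1)..X k}" for y
      using has_real_derivative_unique_within_Icc[OF sub(2) y _ D1[OF y]] DERIV_subset[OF dw sub(1)] y sub(1)
      by blast
    have dv: "(v has_real_derivative D2 y) (at y within {X (k - 1)..X k})" if y: "y \<in> {X (k - 1)..X k}" for y
      by (rule has_field_derivative_transform_within[OF D2[OF y], where d = 1]) (use vD1 y in auto)
    have zero: "- eps * D2 y + ?P y * v y + b (mesh_mid X k) * uh y - f (mesh_mid X k) = 0"
      if y: "y \<in> {X (k - 1)<..<X k}" for y
    proof -
      have d1: "DERIV uh t :> v t" if "t \<in> {X (k - 1)<..<X k}" for t
      proof -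
        have t: "t \<in> {X (k - 1)..X k}" using that by auto
        show ?thesis using D1[OF t] vD1[OF t] that by (simp add: at_within_Icc_at)
      qed
      have "DERIV v y :> D2 y" using dv[of y] y by (simp add: at_within_Icc_at)
      then have "DERIV (deriv uh) y :> D2 y"
        by (rule has_field_derivative_transform_within_open[of _ _ _ "{X (k - 1)<..<X k}"])
          (use y DERIV_imp_deriv[OF d1] in auto)
      then show ?thesis using ode[OF k y] DERIV_imp_deriv[OF d1[OF y]] by (simp add: DERIV_imp_deriv)
    qed
    have cont: "continuous_on {X (k - 1)..X k}
        (\<lambda>y. - eps * D2 y + ?P y * v y + b (mesh_mid X k) * uh y - f (mesh_mid X k))"
      by (intro continuous_intros contD2 contP[OF k] continuous_on_subset[OF contv sub(1)]
          continuous_on_subset[OF DERIV_continuous_on[OF dw] sub(1)])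
    have cl: "closure {X (k - 1)<..<X k} = {X (k - 1)..X k}" using sub(2) by simp
    have "- eps * D2 x + ?P x * v x + b (mesh_mid X k) * uh x - f (mesh_mid X k) = 0"
      by (rule continuous_constant_on_closure[of "{X (k - 1)<..<X k}"
        "\<lambda>y. - eps * D2 y + ?P y * v y + b (mesh_mid X k) * uh y - f (mesh_mid X k)" 0 x])
        (use zero x in \<open>auto simp only: cl intro: cont\<close>)
    then have "D2 x = (?P x * v x + b (mesh_mid X k) * uh x - f (mesh_mid X k)) / eps"
      using eps by (simp add: field_simps)
    then show "(v has_real_derivative (?P x * v x + b (mesh_mid X k) * uh x - f (mesh_mid X k)) / eps)
      (at x within {X (k - 1)..X k})" using dv[OF x] by simp
  qed (use less eps mesh dw contv in auto)
qed

text \<open>Passes from the Lebesgue integral over the open interval in \<open>L2_norm\<close> to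
  the gauge integral of the estimates. \<open>k\<close> and \<open>g\<close> may differ at the
  endpoints, where \<open>deriv\<close> carries no information.\<close>

lemma L2_norm_square:
  assumes "a \<le> b" "continuous_on {a..b} g" "\<And>x. x \<in> {a<..<b} \<Longrightarrow> k x = g x"
  shows "(L2_norm a b k)\<^sup>2 = integral {a..b} (\<lambda>x. (g x)\<^sup>2)"
proof -
  have int: "set_integrable lborel {a..b} (\<lambda>x. (g x)\<^sup>2)"
    by (intro borel_integrable_atLeastAtMost' continuous_intros assms)
  have int': "set_integrable lborel {a<..<b} (\<lambda>x. (g x)\<^sup>2)"
    by (rule set_integrable_subset[OF int]) auto
  have "(LINT x:{a<..<b}|lborel. (k x)\<^sup>2) = (LINT x:{a<..<b}|lborel. (g x)\<^sup>2)"
    using assms(3) by (intro set_lebesgue_integral_cong) auto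
  also have "\<dots> = integral {a<..<b} (\<lambda>x. (g x)\<^sup>2)"
    by (rule set_borel_integral_eq_integral(2)[OF int'])
  also have "\<dots> = integral {a..b} (\<lambda>x. (g x)\<^sup>2)"
    by (rule integral_open_interval_real[symmetric])
  finally have eq: "(LINT x:{a<..<b}|lborel. (k x)\<^sup>2) = integral {a..b} (\<lambda>x. (g x)\<^sup>2)" .
  have "integral {a..b} (\<lambda>x. (g x)\<^sup>2) \<ge> 0"
    by (intro integral_nonneg integrable_continuous_real continuous_intros assms) auto
  then show ?thesis unfolding L2_norm_def eq by simp
qed

lemma L2_norm_nonneg: "L2_norm a b g \<ge> 0"
proof -
  have "(LINT x:{a<..<b}|lborel. (g x)\<^sup>2) \<ge> 0"
    unfolding set_lebesgue_integral_def by (rule integral_nonneg_AE) (auto simp: indicator_def)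
  then show ?thesis by (simp add: L2_norm_def)
qed

subsection \<open>Turning points and layers\<close>

text \<open>Demanding \<open>Q z t\<close> for all \<open>t\<close> below a threshold makes the
  condition stable under shrinking, so the minimum of finitely many thresholds works.\<close>

lemma uniform_small:
  fixes Q :: "'a \<Rightarrow> real \<Rightarrow> bool"
  assumes "finite Z" "\<And>z. z \<in> Z \<Longrightarrow> \<exists>e>0. \<forall>t. 0 < t \<and> t \<le> e \<longrightarrow> Q z t"
  shows "\<exists>e>0. \<forall>z\<in>Z. \<forall>t. 0 < t \<and> t \<le> e \<longrightarrow> Q z t"
  using assms
proof (induction Z)
  case empty
  show ?case by (rule exI[of _ 1]) auto
next
  case (insert z Z)
  obtain e1 where "e1 > 0" "\<forall>z\<in>Z. \<forall>t. 0 < t \<and> t \<le> e1 \<longrightarrow> Q z t" using insert by auto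
  moreover obtain e2 where "e2 > 0" "\<forall>t. 0 < t \<and> t \<le> e2 \<longrightarrow> Q z t"
    using insert.prems[of z] by blast
  ultimately show ?case by (intro exI[of _ "min e1 e2"]) auto
qed

lemma same_sign_if_nonzero:
  fixes g :: "real \<Rightarrow> real"
  assumes "a \<le> b" "continuous_on {a..b} g" "\<And>t. t \<in> {a..b} \<Longrightarrow> g t \<noteq> 0"
  shows "g a > 0 \<longleftrightarrow> g b > 0"
proof
  assume "g a > 0"
  show "g b > 0"
  proof (rule ccontr)
    assume "\<not> g b > 0"
    then obtain t where "t \<ge> a" "t \<le> b" "g t = 0"
      using IVT2'[of g b 0 a] \<open>g a > 0\<close> assms by auto
    then show False using assms(3)[of t] by auto
  qed
next
  assume "g b > 0"
  show "g a > 0"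
  proof (rule ccontr)
    assume "\<not> g a > 0"
    then obtain t where "t \<ge> a" "t \<le> b" "g t = 0"
      using IVT'[of g a 0 b] \<open>g b > 0\<close> assms by auto
    then show False using assms(3)[of t] by auto
  qed
qed

text \<open>Turns exponential decay over a fixed distance into a factor \<open>eps\<close>, enough
  to compensate a derivative of order \<open>1 / eps\<close>.\<close>

lemma exp_decay_le_inverse:
  fixes s :: real
  assumes "s > 0"
  shows "exp (- s) \<le> 1 / s"
proof -
  have "s \<le> exp s" using exp_ge_add_one_self[of s] by linarith
  then show ?thesis using assms by (simp add: exp_minus field_simps)
qed

section \<open>Data with uniform bounds, and the turning points without layers\<close>

locale coefficients =
  fixes xL xR \<gamma>0 b0 \<delta> K :: real and p p1 p2 b b1 f f1 :: "real \<Rightarrow> real"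
  assumes less: "xL < xR"
    and p_deriv: "\<And>x. x \<in> {xL..xR} \<Longrightarrow> (p has_real_derivative p1 x) (at x within {xL..xR})"
    and p1_deriv: "\<And>x. x \<in> {xL..xR} \<Longrightarrow> (p1 has_real_derivative p2 x) (at x within {xL..xR})"
    and b_deriv: "\<And>x. x \<in> {xL..xR} \<Longrightarrow> (b has_real_derivative b1 x) (at x within {xL..xR})"
    and f_deriv: "\<And>x. x \<in> {xL..xR} \<Longrightarrow> (f has_real_derivative f1 x) (at x within {xL..xR})"
    and p_le: "\<And>x. x \<in> {xL..xR} \<Longrightarrow> \<bar>p x\<bar> \<le> K"
    and p1_le: "\<And>x. x \<in> {xL..xR} \<Longrightarrow> \<bar>p1 x\<bar> \<le> K"
    and p2_le: "\<And>x. x \<in> {xL..xR} \<Longrightarrow> \<bar>p2 x\<bar> \<le> K"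
    and b_le: "\<And>x. x \<in> {xL..xR} \<Longrightarrow> \<bar>b x\<bar> \<le> K"
    and b1_le: "\<And>x. x \<in> {xL..xR} \<Longrightarrow> \<bar>b1 x\<bar> \<le> K"
    and f_le: "\<And>x. x \<in> {xL..xR} \<Longrightarrow> \<bar>f x\<bar> \<le> K"
    and f1_le: "\<And>x. x \<in> {xL..xR} \<Longrightarrow> \<bar>f1 x\<bar> \<le> K"
    and K_pos: "K > 0"
    and \<gamma>0_pos: "\<gamma>0 > 0"
    and coercive: "\<And>x. x \<in> {xL..xR} \<Longrightarrow> b x - p1 x \<ge> \<gamma>0"
    and b_ge: "\<And>x. x \<in> {xL..xR} \<Longrightarrow> b x \<ge> b0"
    and b0_nonneg: "b0 \<ge> 0"
    and at_zero: "\<And>x. x \<in> {xL..xR} \<Longrightarrow> p x = 0 \<Longrightarrow> b0 > 0 \<and> p1 x \<noteq> 0"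
    and finite_zeros: "finite {x \<in> {xL..xR}. p x = 0}"
    and \<delta>_pos: "\<delta> > 0"
begin

definition zeros :: "real set" where
  "zeros = {x \<in> {xL..xR}. p x = 0}"

definition layer_points :: "real set" where
  "layer_points = singular_points xL xR p b"

definition layer_region :: "real set" where
  "layer_region = (\<Union>s\<in>layer_points. {s - \<delta>..s + \<delta>})"

text \<open>These points may well lie in \<open>layer_region\<close>, inside the neighbourhood of
  some other point or at its border. For this reason \<open>zone_at\<close> controls that region on
  each side of them.\<close>

definition regular_zeros :: "real set" where
  "regular_zeros = zeros - layer_points"

lemma p_lipschitz: "x \<in> {xL..xR} \<Longrightarrow> y \<in> {xL..xR} \<Longrightarrow> \<bar>p x - p y\<bar> \<le> K * \<bar>x - y\<bar>"
  by (rule deriv_within_lipschitz[OF p_deriv p1_le])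

lemma p1_lipschitz: "x \<in> {xL..xR} \<Longrightarrow> y \<in> {xL..xR} \<Longrightarrow> \<bar>p1 x - p1 y\<bar> \<le> K * \<bar>x - y\<bar>"
  by (rule deriv_within_lipschitz[OF p1_deriv p2_le])

lemma b_lipschitz: "x \<in> {xL..xR} \<Longrightarrow> y \<in> {xL..xR} \<Longrightarrow> \<bar>b x - b y\<bar> \<le> K * \<bar>x - y\<bar>"
  by (rule deriv_within_lipschitz[OF b_deriv b1_le])

lemma f_lipschitz: "x \<in> {xL..xR} \<Longrightarrow> y \<in> {xL..xR} \<Longrightarrow> \<bar>f x - f y\<bar> \<le> K * \<bar>x - y\<bar>"
  by (rule deriv_within_lipschitz[OF f_deriv f1_le])

lemma p_cont: "continuous_on {xL..xR} p"
  using p_deriv by (rule DERIV_continuous_on)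

lemma finite_layer_points: "finite layer_points"
proof (rule finite_subset)
  show "layer_points \<subseteq> {x \<in> {xL..xR}. p x = 0} \<union> {xL, xR}"
    using less by (auto simp: layer_points_def singular_points_def)
qed (use finite_zeros in auto)

lemma layer_points_boundary:
  "p xR > 0 \<Longrightarrow> xR \<in> layer_points" "p xL < 0 \<Longrightarrow> xL \<in> layer_points"
  by (auto simp: layer_points_def singular_points_def)

text \<open>Zeros at the boundary are always singular, hence the strict inequalities. For
  \<open>p1 z < 0\<close> the number \<open>\<lambda> = - b z / p1 z\<close> is positive, so lying
  outside \<open>{0<..1}\<close> means \<open>\<lambda> > 1\<close>, that is
  \<open>b z + p1 z > 0\<close>.\<close>

lemma regular_zeroD:
  assumes "z \<in> regular_zeros"
  shows "z \<in> {xL..xR}" "xL < z" "z < xR" "p z = 0" "p1 z \<noteq> 0" "b0 > 0"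
    "p1 z < 0 \<Longrightarrow> b z + p1 z > 0"
proof -
  show z: "z \<in> {xL..xR}" "p z = 0" using assms by (auto simp: regular_zeros_def zeros_def)
  then show b0: "p1 z \<noteq> 0" "b0 > 0" using at_zero by auto
  show ends: "xL < z" "z < xR"
    using z assms by (auto simp: regular_zeros_def layer_points_def singular_points_def order_le_less)
  have d: "deriv_Icc xL xR p z = p1 z" using less z(1) p_deriv[OF z(1)] by (rule deriv_Icc_eq)
  have notin: "- b z / p1 z \<notin> {0<..1}"
    using assms z ends d by (auto simp: regular_zeros_def layer_points_def singular_points_def)
  show "b z + p1 z > 0" if neg: "p1 z < 0"
  proof -
    have "b z > 0" using b_ge[OF z(1)] b0 by simp
    then have "- b z / p1 z > 0" using neg by (simp add: divide_pos_neg)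
    then have "- b z / p1 z > 1" using notin by auto
    then show ?thesis using neg by (simp add: field_simps)
  qed
qed

lemma finite_regular_zeros: "finite regular_zeros"
  using finite_zeros by (auto simp: regular_zeros_def zeros_def)

text \<open>The zone proper has radius \<open>t\<close>; the conditions reach to
  \<open>2 * t\<close> to cover the mesh intervals that meet it. Using \<open>t\<close> also as the
  margin for the slopes saves constants. By the last two clauses the approximation of
  \<open>p\<close> can change its type only at \<open>z\<close>, once \<open>z\<close> is a
  breakpoint.\<close>

definition zone_at :: "real \<Rightarrow> real \<Rightarrow> bool" where
  "zone_at z t \<longleftrightarrow> xL < z - 2 * t \<and> z + 2 * t < xR \<and>
     (p1 z > 0 \<longrightarrow> (\<forall>x. \<bar>x - z\<bar> \<le> 2 * t \<longrightarrow> p1 x \<ge> t)) \<and>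
     (p1 z < 0 \<longrightarrow> (\<forall>x. \<bar>x - z\<bar> \<le> 2 * t \<longrightarrow> p1 x \<le> - t \<and> b x + p1 x \<ge> t)) \<and>
     (\<forall>x\<in>{z<..<z + 2 * t}. \<forall>y\<in>{z<..<z + 2 * t}. x \<in> layer_region \<longleftrightarrow> y \<in> layer_region) \<and>
     (\<forall>x\<in>{z - 2 * t<..<z}. \<forall>y\<in>{z - 2 * t<..<z}. x \<in> layer_region \<longleftrightarrow> y \<in> layer_region)"

definition zone_radius :: "real \<Rightarrow> bool" where
  "zone_radius t \<longleftrightarrow> t > 0 \<and> (\<forall>z\<in>regular_zeros. zone_at z t)"

lemma zone_radius_exists: "\<exists>t. zone_radius t"
proof -
  have pure: "\<exists>e>0. \<forall>t. 0 < t \<and> t \<le> e \<longrightarrow>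
    (\<forall>x\<in>{z<..<z + 2 * t}. \<forall>y\<in>{z<..<z + 2 * t}. x \<in> layer_region \<longleftrightarrow> y \<in> layer_region) \<and>
    (\<forall>x\<in>{z - 2 * t<..<z}. \<forall>y\<in>{z - 2 * t<..<z}. x \<in> layer_region \<longleftrightarrow> y \<in> layer_region)" for z
  proof -
    have "\<exists>e>0. \<forall>s\<in>layer_points. \<forall>t. 0 < t \<and> t \<le> e \<longrightarrow>
      (\<forall>x\<in>{z<..<z + 2 * t}. \<forall>y\<in>{z<..<z + 2 * t}. x \<in> {s - \<delta>..s + \<delta>} \<longleftrightarrow> y \<in> {s - \<delta>..s + \<delta>}) \<and>
      (\<forall>x\<in>{z - 2 * t<..<z}. \<forall>y\<in>{z - 2 * t<..<z}. x \<in> {s - \<delta>..s + \<delta>} \<longleftrightarrow> y \<in> {s - \<delta>..s + \<delta>})"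
    proof (rule uniform_small[OF finite_layer_points])
      fix s
      \<comment> \<open>A window of length \<open>2 * t \<le> \<bar>z - q\<bar>\<close> starting at
        \<open>z\<close> does not pass the border point \<open>q\<close>; if \<open>q = z\<close>,
        any length will do because the windows exclude \<open>z\<close>.\<close>
      define gap where "gap q = (if z = q then 1 else \<bar>z - q\<bar> / 2)" for q
      have gap: "q \<le> z \<or> z + 2 * t \<le> q" "z \<le> q \<or> q \<le> z - 2 * t" if "t \<le> gap q" for t q
        using that by (auto simp: gap_def split: if_splits)
      show "\<exists>e>0. \<forall>t. 0 < t \<and> t \<le> e \<longrightarrow>
        (\<forall>x\<in>{z<..<z + 2 * t}. \<forall>y\<in>{z<..<z + 2 * t}. x \<in> {s - \<delta>..s + \<delta>} \<longleftrightarrow> y \<in> {s - \<delta>..s + \<delta>}) \<and>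
        (\<forall>x\<in>{z - 2 * t<..<z}. \<forall>y\<in>{z - 2 * t<..<z}. x \<in> {s - \<delta>..s + \<delta>} \<longleftrightarrow> y \<in> {s - \<delta>..s + \<delta>})"
      proof (rule exI[of _ "min (gap (s - \<delta>)) (gap (s + \<delta>))"], intro conjI allI impI ballI)
        show "0 < min (gap (s - \<delta>)) (gap (s + \<delta>))" by (auto simp: gap_def)
        fix t assume "0 < t \<and> t \<le> min (gap (s - \<delta>)) (gap (s + \<delta>))"
        then have t: "t \<le> gap (s - \<delta>)" "t \<le> gap (s + \<delta>)" by auto
        show "x \<in> {s - \<delta>..s + \<delta>} \<longleftrightarrow> y \<in> {s - \<delta>..s + \<delta>}"
          if "x \<in> {z<..<z + 2 * t}" "y \<in> {z<..<z + 2 * t}" for x y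
          using gap(1)[OF t(1)] gap(1)[OF t(2)] that by auto
        show "x \<in> {s - \<delta>..s + \<delta>} \<longleftrightarrow> y \<in> {s - \<delta>..s + \<delta>}"
          if "x \<in> {z - 2 * t<..<z}" "y \<in> {z - 2 * t<..<z}" for x y
          using gap(2)[OF t(1)] gap(2)[OF t(2)] that by auto
      qed
    qed
    then obtain e where "e > 0" and e: "\<And>s t. s \<in> layer_points \<Longrightarrow> 0 < t \<Longrightarrow> t \<le> e \<Longrightarrow>
      (\<forall>x\<in>{z<..<z + 2 * t}. \<forall>y\<in>{z<..<z + 2 * t}. x \<in> {s - \<delta>..s + \<delta>} \<longleftrightarrow> y \<in> {s - \<delta>..s + \<delta>}) \<and>
      (\<forall>x\<in>{z - 2 * t<..<z}. \<forall>y\<in>{z - 2 * t<..<z}. x \<in> {s - \<delta>..s + \<delta>} \<longleftrightarrow> y \<in> {s - \<delta>..s + \<delta>})" by blast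
    show ?thesis
    proof (rule exI[of _ e], intro conjI allI impI ballI)
      fix t assume t: "0 < t \<and> t \<le> e"
      show "x \<in> layer_region \<longleftrightarrow> y \<in> layer_region" if "x \<in> {z<..<z + 2 * t}" "y \<in> {z<..<z + 2 * t}" for x y
        unfolding layer_region_def UN_iff using e[of _ t] t that by (intro bex_cong refl) blast
      show "x \<in> layer_region \<longleftrightarrow> y \<in> layer_region" if "x \<in> {z - 2 * t<..<z}" "y \<in> {z - 2 * t<..<z}" for x y
        unfolding layer_region_def UN_iff using e[of _ t] t that by (intro bex_cong refl) blast
    qed (fact \<open>e > 0\<close>)
  qed
  have "\<exists>e>0. \<forall>z\<in>regular_zeros. \<forall>t. 0 < t \<and> t \<le> e \<longrightarrow>
    zone_at z t"
  proof (rule uniform_small[OF finite_regular_zeros])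
    fix z assume z: "z \<in> regular_zeros"
    note zD = regular_zeroD[OF z]
    obtain e1 where e1: "e1 > 0" "\<And>t. 0 < t \<Longrightarrow> t \<le> e1 \<Longrightarrow>
      (\<forall>x\<in>{z<..<z + 2 * t}. \<forall>y\<in>{z<..<z + 2 * t}. x \<in> layer_region \<longleftrightarrow> y \<in> layer_region) \<and>
      (\<forall>x\<in>{z - 2 * t<..<z}. \<forall>y\<in>{z - 2 * t<..<z}. x \<in> layer_region \<longleftrightarrow> y \<in> layer_region)"
      using pure[of z] by blast
    define e3 where "e3 = min ((z - xL) / 3) ((xR - z) / 3)"
    have e3: "e3 > 0" using zD by (auto simp: e3_def)
    \<comment> \<open>Within distance \<open>2 * t\<close> of \<open>z\<close> both
      \<open>p1\<close> and \<open>b\<close> change by at most \<open>2 * K * t\<close>. Hence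
      \<open>t * (4 * K + 1) \<le> q\<close> leaves the margin \<open>t\<close>, even for the sum
      \<open>b + p1\<close>.\<close>
    define q where "q = (if p1 z > 0 then p1 z else min (- p1 z) (b z + p1 z))"
    have q: "q > 0" using zD by (auto simp: q_def)
    define e4 where "e4 = q / (4 * K + 1)"
    have e4: "e4 > 0" using q K_pos by (simp add: e4_def)
    define e where "e = min e1 (min e3 e4)"
    have e: "e > 0" using e1 e3 e4 by (simp add: e_def)
    have main: "xL < z - 2 * t \<and> z + 2 * t < xR \<and>
     (p1 z > 0 \<longrightarrow> (\<forall>x. \<bar>x - z\<bar> \<le> 2 * t \<longrightarrow> p1 x \<ge> t)) \<and>
     (p1 z < 0 \<longrightarrow> (\<forall>x. \<bar>x - z\<bar> \<le> 2 * t \<longrightarrow> p1 x \<le> - t \<and> b x + p1 x \<ge> t))"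
      if t: "0 < t" "t \<le> e" for t
    proof -
      have t3: "t \<le> (z - xL) / 3" "t \<le> (xR - z) / 3" and "t \<le> e4"
        using t by (auto simp: e_def e3_def)
      then have "t * (4 * K + 1) \<le> q" using K_pos by (simp add: e4_def pos_le_divide_eq)
      then have tq: "4 * (K * t) + t \<le> q" by (simp add: algebra_simps)
      have inside: "xL < z - 2 * t" "z + 2 * t < xR" using t3 t by auto
      have lip: "\<bar>p1 x - p1 z\<bar> \<le> 2 * (K * t)" "\<bar>b x - b z\<bar> \<le> 2 * (K * t)" if x: "\<bar>x - z\<bar> \<le> 2 * t" for x
      proof -
        have "x \<in> {xL..xR}" using x inside by auto
        moreover have "K * \<bar>x - z\<bar> \<le> K * (2 * t)" using x K_pos by (intro mult_left_mono) auto
        ultimately show "\<bar>p1 x - p1 z\<bar> \<le> 2 * (K * t)" "\<bar>b x - b z\<bar> \<le> 2 * (K * t)"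
          using p1_lipschitz[of x z] b_lipschitz[of x z] zD(1) by auto
      qed
      have "p1 x \<ge> t" if "p1 z > 0" "\<bar>x - z\<bar> \<le> 2 * t" for x
      proof -
        have "4 * (K * t) + t \<le> p1 z" "K * t > 0" using tq that(1) t K_pos by (auto simp: q_def)
        then show ?thesis using lip(1)[OF that(2)] by linarith
      qed
      moreover have "p1 x \<le> - t \<and> b x + p1 x \<ge> t" if "p1 z < 0" "\<bar>x - z\<bar> \<le> 2 * t" for x
      proof -
        have "4 * (K * t) + t \<le> - p1 z" "4 * (K * t) + t \<le> b z + p1 z" "K * t > 0"
          using tq that(1) t K_pos by (auto simp: q_def)
        then show ?thesis using lip[OF that(2)] by linarith
      qed
      ultimately show ?thesis using inside by blast
    qed
    show "\<exists>e>0. \<forall>t. 0 < t \<and> t \<le> e \<longrightarrow>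
      zone_at z t"
    proof (rule exI[of _ e], rule conjI[OF e], intro allI impI)
      fix t assume "0 < t \<and> t \<le> e"
      then have t: "0 < t" "t \<le> e" and t': "t \<le> e1" by (auto simp: e_def)
      show "zone_at z t"
        unfolding zone_at_def
        by (intro conjI main[OF t, THEN conjunct1] main[OF t, THEN conjunct2, THEN conjunct1]
            main[OF t, THEN conjunct2, THEN conjunct2, THEN conjunct1]
            main[OF t, THEN conjunct2, THEN conjunct2, THEN conjunct2]
            e1(2)[OF t(1) t', THEN conjunct1] e1(2)[OF t(1) t', THEN conjunct2])
    qed
  qed
  then obtain e where "e > 0" and e: "\<forall>z\<in>regular_zeros. \<forall>t. 0 < t \<and> t \<le> e \<longrightarrow>
    zone_at z t"
    by auto
  then have "zone_radius e" unfolding zone_radius_def by (meson order_refl)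
  then show ?thesis by blast
qed

text \<open>Compactness: \<open>\<bar>p\<bar>\<close> attains a positive minimum on the set in
  question, unless this set is empty.\<close>

lemma away_from_zeros:
  assumes "r > 0"
  shows "\<exists>c>0. \<forall>x\<in>{xL..xR}. (\<forall>z\<in>zeros. r \<le> \<bar>x - z\<bar>) \<longrightarrow> c \<le> \<bar>p x\<bar>"
proof -
  define U where "U = {xL..xR} \<inter> (\<Inter>z\<in>zeros. {x. r \<le> \<bar>x - z\<bar>})"
  have "closed (\<Inter>z\<in>zeros. {x. r \<le> \<bar>x - z\<bar>})"
    by (intro closed_INT ballI closed_Collect_le continuous_intros)
  then have "compact U" unfolding U_def by (intro compact_Int_closed) auto
  show ?thesis
  proof (cases "U = {}")
    case True
    then show ?thesis by (intro exI[of _ 1]) (auto simp: U_def)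
  next
    case False
    have "continuous_on U (\<lambda>x. \<bar>p x\<bar>)"
      by (intro continuous_intros continuous_on_subset[OF p_cont]) (auto simp: U_def)
    then obtain y where y: "y \<in> U" "\<forall>x\<in>U. \<bar>p y\<bar> \<le> \<bar>p x\<bar>"
      using continuous_attains_inf[OF \<open>compact U\<close> False] by blast
    have "p y \<noteq> 0" using y(1) assms by (auto simp: U_def zeros_def)
    then show ?thesis using y(2) by (intro exI[of _ "\<bar>p y\<bar>"]) (auto simp: U_def)
  qed
qed

end

section \<open>Pointwise bounds for the derivative outside the layers\<close>

locale zones = coefficients +
  fixes \<eta> c1 :: real
  assumes zone: "zone_radius \<eta>"
    and c1_pos: "c1 > 0"
    and away: "\<And>x. x \<in> {xL..xR} \<Longrightarrow> (\<And>z. z \<in> zeros \<Longrightarrow> min \<eta> \<delta> / 4 \<le> \<bar>x - z\<bar>) \<Longrightarrow> c1 \<le> \<bar>p x\<bar>"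
begin

text \<open>The quarter is chosen so that points at distance \<open>3 / 4 * \<delta>\<close> from
  the layer points and \<open>\<eta> / 2\<close> from the regular zeros remain at distance
  \<open>rad\<close> from all zeros after a shift by \<open>rad\<close>.\<close>

definition rad :: real where "rad = min \<eta> \<delta> / 4"

lemma \<eta>_pos: "\<eta> > 0" and rad_pos: "rad > 0" and rad_le: "rad \<le> \<eta> / 4" "rad \<le> \<delta> / 4"
  using zone \<delta>_pos by (auto simp: zone_radius_def rad_def)

lemma away_rad: "x \<in> {xL..xR} \<Longrightarrow> (\<And>z. z \<in> zeros \<Longrightarrow> rad \<le> \<bar>x - z\<bar>) \<Longrightarrow> c1 \<le> \<bar>p x\<bar>"
  using away by (simp add: rad_def)

lemma zoneD:
  assumes "z \<in> regular_zeros"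
  shows "xL < z - 2 * \<eta>" "z + 2 * \<eta> < xR"
    "\<And>x. p1 z > 0 \<Longrightarrow> \<bar>x - z\<bar> \<le> 2 * \<eta> \<Longrightarrow> p1 x \<ge> \<eta>"
    "\<And>x. p1 z < 0 \<Longrightarrow> \<bar>x - z\<bar> \<le> 2 * \<eta> \<Longrightarrow> p1 x \<le> - \<eta>"
    "\<And>x. p1 z < 0 \<Longrightarrow> \<bar>x - z\<bar> \<le> 2 * \<eta> \<Longrightarrow> b x + p1 x \<ge> \<eta>"
    "\<And>x y. z < x \<Longrightarrow> x < z + 2 * \<eta> \<Longrightarrow> z < y \<Longrightarrow> y < z + 2 * \<eta> \<Longrightarrow> x \<in> layer_region \<longleftrightarrow> y \<in> layer_region"
    "\<And>x y. z - 2 * \<eta> < x \<Longrightarrow> x < z \<Longrightarrow> z - 2 * \<eta> < y \<Longrightarrow> y < z \<Longrightarrow> x \<in> layer_region \<longleftrightarrow> y \<in> layer_region"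
proof -
  have "zone_at z \<eta>" using zone assms by (simp add: zone_radius_def)
  note z = this[unfolded zone_at_def]
  show "xL < z - 2 * \<eta>" "z + 2 * \<eta> < xR"
    by (rule z[THEN conjunct1] z[THEN conjunct2, THEN conjunct1])+
  show "p1 x \<ge> \<eta>" if "p1 z > 0" "\<bar>x - z\<bar> \<le> 2 * \<eta>" for x
    using z[THEN conjunct2, THEN conjunct2, THEN conjunct1] that by blast
  show "p1 x \<le> - \<eta>" "b x + p1 x \<ge> \<eta>" if "p1 z < 0" "\<bar>x - z\<bar> \<le> 2 * \<eta>" for x
    using z[THEN conjunct2, THEN conjunct2, THEN conjunct2, THEN conjunct1] that by blast+
  show "x \<in> layer_region \<longleftrightarrow> y \<in> layer_region"
    if "z < x" "x < z + 2 * \<eta>" "z < y" "y < z + 2 * \<eta>" for x y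
    using z[THEN conjunct2, THEN conjunct2, THEN conjunct2, THEN conjunct2, THEN conjunct1] that unfolding greaterThanLessThan_iff Ball_def by blast
  show "x \<in> layer_region \<longleftrightarrow> y \<in> layer_region"
    if "z - 2 * \<eta> < x" "x < z" "z - 2 * \<eta> < y" "y < z" for x y
    using z[THEN conjunct2, THEN conjunct2, THEN conjunct2, THEN conjunct2, THEN conjunct2] that unfolding greaterThanLessThan_iff Ball_def by blast
qed

lemma p_increasing_near:
  assumes z: "z \<in> regular_zeros" "p1 z > 0" and xy: "z - 2 * \<eta> \<le> x" "x \<le> y" "y \<le> z + 2 * \<eta>"
  shows "\<eta> * (y - x) \<le> p y - p x"
proof (rule deriv_within_diff_ge[OF xy(2)])
  show "(p has_real_derivative p1 t) (at t within {x..y})" if "t \<in> {x..y}" for t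
    using that xy zoneD(1,2)[OF z(1)] by (intro DERIV_subset[OF p_deriv]) auto
  show "\<eta> \<le> p1 t" if "t \<in> {x<..<y}" for t
    using that xy by (intro zoneD(3)[OF z]) (auto simp: abs_le_iff)
qed

lemma p_decreasing_near:
  assumes z: "z \<in> regular_zeros" "p1 z < 0" and xy: "z - 2 * \<eta> \<le> x" "x \<le> y" "y \<le> z + 2 * \<eta>"
  shows "p y - p x \<le> - \<eta> * (y - x)"
proof (rule deriv_within_diff_le[OF xy(2)])
  show "(p has_real_derivative p1 t) (at t within {x..y})" if "t \<in> {x..y}" for t
    using that xy zoneD(1,2)[OF z(1)] by (intro DERIV_subset[OF p_deriv]) auto
  show "p1 t \<le> - \<eta>" if "t \<in> {x<..<y}" for t
    using that xy by (intro zoneD(4)[OF z]) (auto simp: abs_le_iff)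
qed

lemma zero_near_unique:
  assumes z: "z \<in> regular_zeros" and y: "y \<in> zeros" "\<bar>y - z\<bar> \<le> 2 * \<eta>"
  shows "y = z"
proof -
  have py: "p y = 0" "p z = 0" using y regular_zeroD(4)[OF z] by (auto simp: zeros_def)
  have *: "s = t" if "z - 2 * \<eta> \<le> s" "s \<le> t" "t \<le> z + 2 * \<eta>" "p s = 0" "p t = 0" for s t
  proof (cases "p1 z > 0")
    case True
    have "\<eta> * (t - s) \<le> 0" using p_increasing_near[OF z True that(1-3)] that by simp
    then show ?thesis using \<eta>_pos that by (simp add: mult_le_0_iff)
  next
    case False
    then have "p1 z < 0" using regular_zeroD(5)[OF z] by simp
    have "\<eta> * (t - s) \<le> 0" using p_decreasing_near[OF z \<open>p1 z < 0\<close> that(1-3)] that by simp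
    then show ?thesis using \<eta>_pos that by (simp add: mult_le_0_iff)
  qed
  show ?thesis
    using *[of y z] *[of z y] py y(2) \<eta>_pos by (cases "y \<le> z") (auto simp: abs_le_iff)
qed

text \<open>Points with room of width \<open>rad\<close> on the downwind side, away from the zeros of \<open>p\<close>.\<close>

definition safe :: "real \<Rightarrow> bool" where
  "safe x \<longleftrightarrow> x \<in> {xL..xR} \<and> (\<forall>t\<in>{xL..xR}. \<bar>t - x\<bar> \<le> rad \<longrightarrow> c1 \<le> \<bar>p t\<bar>) \<and>
     (p x > 0 \<longrightarrow> x + rad \<le> xR) \<and> (p x < 0 \<longrightarrow> xL \<le> x - rad)"

text \<open>All zeros other than \<open>z\<close> are more than \<open>2 * \<eta>\<close> away from
  \<open>z\<close>, so a shift of \<open>x\<close> by \<open>rad \<le> \<eta> / 4\<close> stays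
  clear of every zero. The bounds at the two ends of a zone start the arguments inside it.\<close>

lemma safe_edge:
  assumes z: "z \<in> regular_zeros" and x: "\<bar>x - z\<bar> = \<eta>"
  shows "safe x"
proof -
  note zD = zoneD[OF z]
  have "c1 \<le> \<bar>p t\<bar>" if t: "t \<in> {xL..xR}" "\<bar>t - x\<bar> \<le> rad" for t
  proof (rule away_rad[OF t(1)])
    fix y assume y: "y \<in> zeros"
    show "rad \<le> \<bar>t - y\<bar>"
    proof (cases "\<bar>y - z\<bar> \<le> 2 * \<eta>")
      case True
      then have "y = z" using zero_near_unique[OF z y] by simp
      then show ?thesis using t(2) x rad_le rad_pos \<eta>_pos by (auto simp: abs_if split: if_splits)
    next
      case False
      then show ?thesis using t(2) x rad_le \<eta>_pos by linarith
    qed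
  qed
  moreover have "x + rad \<le> xR" "xL \<le> x - rad" "x \<in> {xL..xR}"
    using x rad_le zD(1,2) \<eta>_pos rad_pos by (auto simp: abs_if split: if_splits)
  ultimately show ?thesis unfolding safe_def by blast
qed

text \<open>If \<open>p x > 0\<close> and less than \<open>rad\<close> were left before
  \<open>xR\<close>, then \<open>p\<close> would have no zero up to \<open>xR\<close>; so
  \<open>p xR > 0\<close>, and \<open>xR\<close> would be a layer point too close to
  \<open>x\<close>. The same reasoning applies at \<open>xL\<close>.\<close>

lemma safe_regular:
  assumes x: "x \<in> {xL..xR}" and S: "\<And>s. s \<in> layer_points \<Longrightarrow> 3 / 4 * \<delta> \<le> \<bar>x - s\<bar>"
    and Z: "\<And>z. z \<in> regular_zeros \<Longrightarrow> \<eta> / 2 \<le> \<bar>x - z\<bar>"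
  shows "safe x"
proof -
  have pt: "c1 \<le> \<bar>p t\<bar>" if t: "t \<in> {xL..xR}" "\<bar>t - x\<bar> \<le> rad" for t
  proof (rule away_rad[OF t(1)])
    fix y assume y: "y \<in> zeros"
    show "rad \<le> \<bar>t - y\<bar>"
    proof (cases "y \<in> layer_points")
      case True
      then show ?thesis using S[OF True] t(2) rad_le \<delta>_pos by linarith
    next
      case False
      then have "y \<in> regular_zeros" using y by (simp add: regular_zeros_def)
      from Z[OF this] show ?thesis using t(2) rad_le \<eta>_pos by linarith
    qed
  qed
  have "x + rad \<le> xR" if pos: "p x > 0"
  proof (rule ccontr)
    assume neg: "\<not> ?thesis"
    have nz: "p t \<noteq> 0" if "t \<in> {x..xR}" for t
      using pt[of t] that x neg c1_pos by force
    have "p x > 0 \<longleftrightarrow> p xR > 0"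
      by (rule same_sign_if_nonzero[where g = p])
        (use nz x in \<open>auto intro: continuous_on_subset[OF p_cont]\<close>)
    then have "xR \<in> layer_points" using pos layer_points_boundary by simp
    from S[OF this] show False using neg x rad_le \<delta>_pos by auto
  qed
  moreover have "xL \<le> x - rad" if neg: "p x < 0"
  proof (rule ccontr)
    assume nle: "\<not> ?thesis"
    have nz: "p t \<noteq> 0" if "t \<in> {xL..x}" for t
      using pt[of t] that x nle c1_pos by force
    have "p xL > 0 \<longleftrightarrow> p x > 0"
      by (rule same_sign_if_nonzero[where g = p]) (use nz x in \<open>auto intro: continuous_on_subset[OF p_cont]\<close>)
    then have "p xL < 0" using neg nz[of xL] x by auto
    then have "xL \<in> layer_points" using layer_points_boundary by simp
    from S[OF this] show False using nle x rad_le \<delta>_pos by auto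
  qed
  ultimately show ?thesis using x pt unfolding safe_def by blast
qed

text \<open>Coming from the downwind side over the distance \<open>rad\<close>, the excess of
  \<open>v\<close> over \<open>2 * G / c1\<close> shrinks by
  \<open>exp (- c1 * rad / (2 * eps))\<close>. It starts from at most \<open>M / eps\<close>, and
  \<open>exp (- s) \<le> 1 / s\<close> cancels the \<open>eps\<close>. The rate is
  \<open>c1 / 2\<close> because \<open>P\<close> is within \<open>c1 / 2\<close> of
  \<open>p\<close>.\<close>

lemma safe_bound:
  assumes sol: "pw_solution xL xR N X eps P B F w v"
    and cont: "\<And>k. k \<in> {1..N} \<Longrightarrow> continuous_on {X (k - 1)..X k} (P k)"
    and near: "\<And>k t. k \<in> {1..N} \<Longrightarrow> t \<in> {X (k - 1)..X k} \<Longrightarrow> \<bar>P k t - p t\<bar> \<le> c1 / 2"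
    and G: "\<And>k t. k \<in> {1..N} \<Longrightarrow> t \<in> {X (k - 1)..X k} \<Longrightarrow> \<bar>F k t - B k t * w t\<bar> \<le> G"
    and M: "\<And>t. t \<in> {xL..xR} \<Longrightarrow> eps * \<bar>v t\<bar> \<le> M"
    and safe: "safe x"
  shows "v x \<le> 2 * G / c1 + 2 * M / (c1 * rad)"
proof -
  interpret pw_solution xL xR N X eps P B F w v by (rule sol)
  have x: "x \<in> {xL..xR}" and pt: "\<And>t. t \<in> {xL..xR} \<Longrightarrow> \<bar>t - x\<bar> \<le> rad \<Longrightarrow> c1 \<le> \<bar>p t\<bar>"
    using safe unfolding safe_def by auto
  have N: "N \<ge> 1" using mesh less by (cases N) (auto simp: is_mesh_def)
  have G0: "G \<ge> 0" using G[of 1 "X 0"] N mesh_Icc_subset(2)[OF mesh, of 1] by force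
  have c: "c1 / 2 > 0" using c1_pos by simp
  have rp: "rad > 0" by (rule rad_pos)
  have sub: "{X (k - 1)..X k} \<subseteq> {xL..xR}" if "k \<in> {1..N}" for k
    using mesh_Icc_subset(1)[OF mesh that] .
  have fin: "v x \<le> 2 * G / c1 + 2 * M / (c1 * rad)"
    if le: "max 0 (v x - G / (c1 / 2)) \<le> max 0 (v y - G / (c1 / 2)) * exp (- (c1 / 2) * rad / eps)"
      and y: "y \<in> {xL..xR}" for y
  proof -
    have "\<bar>v y\<bar> \<le> M / eps" using M[OF y] eps_pos by (simp add: pos_le_divide_eq mult.commute)
    moreover have "G / (c1 / 2) \<ge> 0" using G0 c1_pos by simp
    ultimately have "max 0 (v y - G / (c1 / 2)) \<le> M / eps" by auto
    moreover have "exp (- (c1 / 2) * rad / eps) \<le> 1 / ((c1 / 2) * rad / eps)"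
      using exp_decay_le_inverse[of "(c1 / 2) * rad / eps"] c1_pos rp eps_pos by simp
    ultimately have "max 0 (v y - G / (c1 / 2)) * exp (- (c1 / 2) * rad / eps) \<le> M / eps * (1 / ((c1 / 2) * rad / eps))"
      by (intro mult_mono) auto
    also have "\<dots> = 2 * M / (c1 * rad)" using eps_pos by simp
    finally show ?thesis using le by (simp add: field_simps)
  qed
  have "p x \<noteq> 0" using pt[OF x] c1_pos rp by auto
  then consider "p x > 0" | "p x < 0" by linarith
  then show ?thesis
  proof cases
    case 1
    then have xr: "x + rad \<le> xR" using safe unfolding safe_def by auto
    have nz: "p t \<noteq> 0" if "t \<in> {x..x + rad}" for t using pt[of t] that c1_pos x xr by auto
    have ge: "c1 \<le> p t" if t: "t \<in> {x..x + rad}" for t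
    proof -
      have "p x > 0 \<longleftrightarrow> p t > 0"
        by (rule same_sign_if_nonzero[where g = p]) (use nz x xr t in \<open>auto intro: continuous_on_subset[OF p_cont]\<close>)
      then show ?thesis using 1 pt[of t] t x xr by auto
    qed
    have "max 0 (v x - G / (c1 / 2)) \<le> max 0 (v (x + rad) - G / (c1 / 2)) * exp (- (c1 / 2) * (x + rad - x) / eps)"
    proof (rule decay_right[OF _ _ xr cont c])
      fix k t assume kt: "k \<in> {1..N}" "t \<in> {X (k - 1)..X k}" "t \<in> {x..x + rad}"
      show "c1 / 2 \<le> P k t" using near[OF kt(1,2)] ge[OF kt(3)] by linarith
      show "\<bar>F k t - B k t * w t\<bar> \<le> G" using G[OF kt(1,2)] .
    qed (use x rp in auto)
    then show ?thesis using x xr rp by (intro fin[of "x + rad"]) auto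
  next
    case 2
    then have xr: "xL \<le> x - rad" using safe unfolding safe_def by auto
    have nz: "p t \<noteq> 0" if "t \<in> {x - rad..x}" for t using pt[of t] that c1_pos x xr by auto
    have ge: "p t \<le> - c1" if t: "t \<in> {x - rad..x}" for t
    proof -
      have "p t > 0 \<longleftrightarrow> p x > 0"
        by (rule same_sign_if_nonzero[where g = p]) (use nz x xr t in \<open>auto intro: continuous_on_subset[OF p_cont]\<close>)
      then show ?thesis using 2 pt[of t] t x xr by auto
    qed
    have "max 0 (v x - G / (c1 / 2)) \<le> max 0 (v (x - rad) - G / (c1 / 2)) * exp (- (c1 / 2) * (x - (x - rad)) / eps)"
    proof (rule decay_left[OF xr _ _ cont c])
      fix k t assume kt: "k \<in> {1..N}" "t \<in> {X (k - 1)..X k}" "t \<in> {x - rad..x}"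
      show "P k t \<le> - (c1 / 2)" using near[OF kt(1,2)] ge[OF kt(3)] by linarith
      show "\<bar>F k t - B k t * w t\<bar> \<le> G" using G[OF kt(1,2)] .
    qed (use x rp in auto)
    then show ?thesis using x xr rp by (intro fin[of "x - rad"]) auto
  qed
qed

text \<open>At an attractive turning point with \<open>\<lambda> > 1\<close> the reaction \<open>b + p'\<close> of the equation for
  \<open>u'\<close> is positive.\<close>

lemma decreasing_zone_upper:
  assumes sol: "pw_solution xL xR 1 X eps (\<lambda>k. p) (\<lambda>k. b) (\<lambda>k. \<phi>) w v"
    and \<phi>_deriv: "\<And>x. x \<in> {xL..xR} \<Longrightarrow> (\<phi> has_real_derivative \<phi>1 x) (at x within {xL..xR})"
    and \<phi>1_le: "\<And>x. x \<in> {xL..xR} \<Longrightarrow> \<bar>\<phi>1 x\<bar> \<le> K"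
    and w: "\<And>x. x \<in> {xL..xR} \<Longrightarrow> \<bar>w x\<bar> \<le> M"
    and z: "z \<in> regular_zeros" "p1 z < 0"
    and edge: "v (z - \<eta>) \<le> A" "v (z + \<eta>) \<le> A" and A: "A > 0" "A * \<eta> > K + K * M"
    and x: "\<bar>x - z\<bar> \<le> \<eta>"
  shows "v x \<le> A"
proof (rule ccontr)
  assume neg: "\<not> v x \<le> A"
  interpret pw_solution xL xR 1 X eps "\<lambda>k. p" "\<lambda>k. b" "\<lambda>k. \<phi>" w v by (rule sol)
  note zD = zoneD[OF z(1)] regular_zeroD[OF z(1)]
  have sub: "{z - \<eta>..z + \<eta>} \<subseteq> {xL..xR}" using zD(1,2) \<eta>_pos by auto
  obtain \<alpha> \<beta> where ab: "z - \<eta> \<le> \<alpha>" "\<alpha> < x" "x < \<beta>" "\<beta> \<le> z + \<eta>" "v \<alpha> = A" "v \<beta> = A"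
    and above: "\<And>t. t \<in> {\<alpha><..<\<beta>} \<Longrightarrow> v t > A"
    using superlevel_component[OF continuous_on_subset[OF v_cont sub] edge, of x] x neg by (auto simp: abs_le_iff)
  have le: "xL \<le> \<alpha>" "\<alpha> < \<beta>" "\<beta> \<le> xR" using ab sub by auto
  \<comment> \<open>This is \<open>eps v'\<close> with \<open>v\<close> replaced by
    \<open>A\<close>, hence one-sided \<open>eps v'\<close> at the ends of the component. Inside,
    \<open>b v \<ge> b A\<close> makes its derivative at least
    \<open>A * (b + p') - K - K * M > 0\<close>, contrary to the signs at the ends.\<close>
  define \<psi> where "\<psi> t = p t * A + b t * w t - \<phi> t" for t
  have "0 \<le> \<psi> \<alpha>" using flux_at_left_end[OF le ab(5) above] unfolding \<psi>_def by blast
  moreover have "\<psi> \<beta> \<le> 0" using flux_at_right_end[OF le ab(6) above] unfolding \<psi>_def by blast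
  moreover have "(A * \<eta> - (K + K * M)) * (\<beta> - \<alpha>) \<le> \<psi> \<beta> - \<psi> \<alpha>"
  proof (rule deriv_within_diff_ge)
    fix t assume t: "t \<in> {\<alpha>..\<beta>}"
    have s: "{\<alpha>..\<beta>} \<subseteq> {xL..xR}" using le by auto
    have tt: "t \<in> {xL..xR}" using s t by auto
    note d = DERIV_subset[OF p_deriv[OF tt] s] DERIV_subset[OF b_deriv[OF tt] s]
      DERIV_subset[OF \<phi>_deriv[OF tt] s] w_deriv_sub[OF s t]
    show "(\<psi> has_real_derivative p1 t * A + (b1 t * w t + b t * v t) - \<phi>1 t) (at t within {\<alpha>..\<beta>})"
      unfolding \<psi>_def by (rule derivative_eq_intros d refl)+ simp
  next
    fix t assume t: "t \<in> {\<alpha><..<\<beta>}"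
    then have tt: "t \<in> {xL..xR}" and near: "\<bar>t - z\<bar> \<le> 2 * \<eta>" using le ab \<eta>_pos by (auto simp: abs_le_iff)
    have "b t \<ge> 0" using b_ge[OF tt] b0_nonneg by simp
    then have 1: "b t * A \<le> b t * v t" using above[OF t] by (intro mult_left_mono) auto
    have 2: "A * \<eta> \<le> A * (b t + p1 t)" using zD(5)[OF z(2) near] A by (intro mult_left_mono) auto
    have "\<bar>b1 t * w t\<bar> \<le> K * M"
      unfolding abs_mult using b1_le[OF tt] w[OF tt] K_pos by (intro mult_mono) auto
    then show "A * \<eta> - (K + K * M) \<le> p1 t * A + (b1 t * w t + b t * v t) - \<phi>1 t"
      using 1 2 \<phi>1_le[OF tt] by (simp add: algebra_simps)
  qed (use le in auto)
  moreover have "(A * \<eta> - (K + K * M)) * (\<beta> - \<alpha>) > 0" using A le by simp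
  ultimately show False by linarith
qed

text \<open>At a repulsive turning point, a component of \<open>{v > A}\<close> whose ends lie in mesh intervals with
  midpoints \<open>m \<le> m'\<close> outside the layer region is impossible, since there the flux balance only
  involves \<open>p m' - p m\<close>. Hence every component meeting the regular region reaches across \<open>z\<close>,
  i.e. there is at most one, and its contribution is of order \<open>h\<close>.\<close>

lemma increasing_zone_upper:
  assumes sol: "pw_solution xL xR N X eps P (\<lambda>k x. b (mesh_mid X k)) (\<lambda>k x. \<phi> (mesh_mid X k)) w v"
    and \<phi>_lip: "\<And>x y. x \<in> {xL..xR} \<Longrightarrow> y \<in> {xL..xR} \<Longrightarrow> \<bar>\<phi> x - \<phi> y\<bar> \<le> K * \<bar>x - y\<bar>"
    and w: "\<And>x. x \<in> {xL..xR} \<Longrightarrow> \<bar>w x\<bar> \<le> M"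
    and P_reg: "\<And>k x. \<lbrakk>k \<in> {1..N}; x \<in> {X (k - 1)..X k}; mesh_mid X k \<notin> layer_region\<rbrakk> \<Longrightarrow> P k x = p (mesh_mid X k)"
    and P_mid: "\<And>k x. \<lbrakk>k \<in> {1..N}; x \<in> {X (k - 1)..X k}\<rbrakk> \<Longrightarrow> \<bar>P k x - p (mesh_mid X k)\<bar> \<le> q"
    and h: "\<And>k. k \<in> {1..N} \<Longrightarrow> X k - X (k - 1) \<le> h" "h \<le> \<eta>"
    and z: "z \<in> regular_zeros" "p1 z > 0" and zX: "z \<in> X ` {0..N}"
    and edge: "v (z - \<eta>) \<le> A" "v (z + \<eta>) \<le> A" and A: "A > 0" "A * \<eta> \<ge> K + K * M"
  shows "\<exists>l l'. xL \<le> l \<and> l' \<le> xR \<and> integral {l..l'} (\<lambda>x. \<bar>v x\<bar>) \<le> 2 * A * q / b0 \<and>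
    (\<forall>k\<in>{1..N}. \<forall>x\<in>{X (k - 1)..X k}. mesh_mid X k \<notin> layer_region \<and> \<bar>x - z\<bar> \<le> \<eta> \<and> v x > A \<longrightarrow> x \<in> {l..l'})"
proof -
  interpret pw_solution xL xR N X eps P "\<lambda>k x. b (mesh_mid X k)" "\<lambda>k x. \<phi> (mesh_mid X k)" w v
    by (rule sol)
  note zD = zoneD[OF z(1)] regular_zeroD[OF z(1)]
  define m where "m k = mesh_mid X k" for k
  have sub: "{z - \<eta>..z + \<eta>} \<subseteq> {xL..xR}" using zD(1,2) \<eta>_pos by auto
  have b0: "b0 > 0" by (rule regular_zeroD(6)[OF z(1)])
  obtain i where i: "i \<le> N" "z = X i" using zX by auto
  have m_in: "X (k - 1) < m k" "m k < X k" "m k \<in> {xL..xR}" if "k \<in> {1..N}" for k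
    using mesh_mid_in[OF mesh that] mesh_Icc_subset[OF mesh that] by (auto simp: m_def)
  have m_near: "z - 2 * \<eta> < m k" "m k < z + 2 * \<eta>"
    if "k \<in> {1..N}" "x \<in> {X (k - 1)..X k}" "\<bar>x - z\<bar> \<le> \<eta>" for k x
    using h(1)[OF that(1)] h(2) m_in[OF that(1)] that by (auto simp: abs_le_iff)
  \<comment> \<open>As \<open>z\<close> is a breakpoint, a mesh interval lies on the side of
    \<open>z\<close> on which its midpoint lies.\<close>
  have left: "X k \<le> z" if "k \<in> {1..N}" "m k < z" for k
  proof -
    have kN: "k - 1 \<le> N" using that(1) by auto
    have "\<not> i \<le> k - 1"
      using mesh_mono[OF mesh _ kN, of i] that(2) m_in(1)[OF that(1)] i(2) by linarith
    then have "k \<le> i" by auto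
    then show ?thesis using mesh_mono[OF mesh _ i(1)] i(2) by blast
  qed
  have right: "z \<le> X (k - 1)" if "k \<in> {1..N}" "m k > z" for k
  proof -
    have "\<not> k \<le> i"
      using mesh_mono[OF mesh _ i(1), of k] that(2) m_in(2)[OF that(1)] i(2) by linarith
    then have "i \<le> k - 1" "k - 1 \<le> N" using that(1) by auto
    then show ?thesis using mesh_mono[OF mesh] i(2) by blast
  qed
  have neq: "m k \<noteq> z" if "k \<in> {1..N}" for k
  proof
    assume "m k = z"
    then have "X (k - 1) < X i" "X i < X k" using m_in[OF that] i by auto
    moreover have "X i \<le> X (k - 1) \<or> X k \<le> X i"
    proof (cases "k \<le> i")
      case True
      then show ?thesis using mesh_mono[OF mesh _ i(1)] by blast
    next
      case False
      then have "i \<le> k - 1" "k - 1 \<le> N" using that by auto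
      then show ?thesis using mesh_mono[OF mesh] by blast
    qed
    ultimately show False by linarith
  qed
  have order: "j \<le> k" if "j \<in> {1..N}" "k \<in> {1..N}" "X (j - 1) < X k" for j k
  proof (rule ccontr)
    assume "\<not> j \<le> k"
    then have "X k \<le> X (j - 1)" using that by (intro mesh_mono[OF mesh]) auto
    then show False using that by simp
  qed
  have m_mono: "m j \<le> m k" if "j \<in> {1..N}" "k \<in> {1..N}" "j \<le> k" for j k
    unfolding m_def using that by (intro mesh_mid_mono[OF mesh]) auto
  have comp: "\<exists>\<alpha> \<beta>. z - \<eta> \<le> \<alpha> \<and> \<alpha> < x \<and> x < \<beta> \<and> \<beta> \<le> z + \<eta> \<and> v \<alpha> = A \<and> v \<beta> = A \<and>
      (\<forall>t\<in>{\<alpha><..<\<beta>}. v t > A) \<and> z \<in> {\<alpha><..<\<beta>} \<and> b0 * (w \<beta> - w \<alpha>) \<le> 2 * A * q"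
    if k: "k \<in> {1..N}" and x: "x \<in> {X (k - 1)..X k}" "\<bar>x - z\<bar> \<le> \<eta>" "v x > A"
      and reg: "m k \<notin> layer_region" for k x
  proof -
    obtain \<alpha> \<beta> where ab: "z - \<eta> \<le> \<alpha>" "\<alpha> < x" "x < \<beta>" "\<beta> \<le> z + \<eta>" "v \<alpha> = A" "v \<beta> = A"
      and above: "\<And>t. t \<in> {\<alpha><..<\<beta>} \<Longrightarrow> v t > A"
      using superlevel_component[OF continuous_on_subset[OF v_cont sub] edge, of x] x by (auto simp: abs_le_iff)
    have le: "xL \<le> \<alpha>" "\<alpha> < \<beta>" "\<beta> \<le> xR" using ab sub by auto
    obtain j where j: "j \<in> {1..N}" "X (j - 1) \<le> \<alpha>" "\<alpha> < X j" "P j \<alpha> * A + b (m j) * w \<alpha> - \<phi> (m j) \<ge> 0"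
      using flux_at_left_end[OF le ab(5) above] unfolding m_def by blast
    obtain l where l: "l \<in> {1..N}" "X (l - 1) < \<beta>" "\<beta> \<le> X l" "P l \<beta> * A + b (m l) * w \<beta> - \<phi> (m l) \<le> 0"
      using flux_at_right_end[OF le ab(6) above] unfolding m_def by blast
    have jl: "j \<le> l" "j \<le> k" "k \<le> l" using j l x k ab le by (auto intro!: order)
    define \<Delta> where "\<Delta> = m l - m j"
    have \<Delta>: "\<Delta> \<ge> 0" using m_mono[OF j(1) l(1) jl(1)] by (simp add: \<Delta>_def)
    have jin: "\<alpha> \<in> {X (j - 1)..X j}" "\<bar>\<alpha> - z\<bar> \<le> \<eta>" and lin: "\<beta> \<in> {X (l - 1)..X l}" "\<bar>\<beta> - z\<bar> \<le> \<eta>"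
      using j l ab x by (auto simp: abs_le_iff)
    note mj = m_near[OF j(1) jin] and ml = m_near[OF l(1) lin] and mk = m_near[OF k x(1,2)]
    have "A * (\<beta> - \<alpha>) \<le> w \<beta> - w \<alpha>"
    proof (rule deriv_within_diff_ge)
      show "(w has_real_derivative v t) (at t within {\<alpha>..\<beta>})" if "t \<in> {\<alpha>..\<beta>}" for t
        using le that by (intro w_deriv_sub) auto
      show "A \<le> v t" if "t \<in> {\<alpha><..<\<beta>}" for t using above[OF that] by simp
    qed (use le in auto)
    moreover have "A * (\<beta> - \<alpha>) > 0" using A le by simp
    ultimately have wpos: "w \<beta> - w \<alpha> > 0" by linarith
    have bm: "b0 * (w \<beta> - w \<alpha>) \<le> b (m j) * (w \<beta> - w \<alpha>)"
      using b_ge[OF m_in(3)[OF j(1)]] wpos by (intro mult_right_mono) auto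
    have "\<bar>\<phi> (m l) - \<phi> (m j)\<bar> \<le> K * \<Delta>"
      using \<phi>_lip[OF m_in(3)[OF l(1)] m_in(3)[OF j(1)]] \<Delta> by (simp add: \<Delta>_def)
    moreover have "\<bar>(b (m l) - b (m j)) * w \<beta>\<bar> \<le> (K * \<Delta>) * M"
      unfolding abs_mult using b_lipschitz[OF m_in(3)[OF l(1)] m_in(3)[OF j(1)]] \<Delta> w[of \<beta>] le K_pos
      by (intro mult_mono) (auto simp: \<Delta>_def)
    moreover have "A * (P l \<beta> - P j \<alpha>) \<le> (\<phi> (m l) - \<phi> (m j)) - (b (m l) - b (m j)) * w \<beta> - b (m j) * (w \<beta> - w \<alpha>)"
      using j(4) l(4) by (simp add: algebra_simps)
    \<comment> \<open>Difference of the two end conditions: changes of the data cost a multiple of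
      \<open>\<Delta>\<close>, while the increase of \<open>w\<close> along the component enters
      with a favourable sign.\<close>
    ultimately have flux: "A * (P l \<beta> - P j \<alpha>) \<le> (K + K * M) * \<Delta> - b0 * (w \<beta> - w \<alpha>)"
      using bm by (simp add: algebra_simps abs_le_iff)
    have pm: "\<eta> * \<Delta> \<le> p (m l) - p (m j)"
      unfolding \<Delta>_def using p_increasing_near[OF z, of "m j" "m l"] mj ml \<Delta> by (simp add: \<Delta>_def)
    have "A * (\<eta> * \<Delta>) \<ge> (K + K * M) * \<Delta>"
      using mult_right_mono[OF A(2) \<Delta>] by (simp add: algebra_simps)
    then have Apm: "A * (p (m l) - p (m j)) \<ge> (K + K * M) * \<Delta>"
      using mult_left_mono[OF pm, of A] A(1) by linarith
    \<comment> \<open>If both end intervals were regular, the slope of \<open>p\<close> would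
      contribute \<open>A * \<eta> * \<Delta>\<close>, which absorbs the change of the data; then
      \<open>w\<close> could not increase along the component.\<close>
    have some: "m j \<in> layer_region \<or> m l \<in> layer_region"
    proof (rule ccontr)
      assume "\<not> ?thesis"
      then have "P j \<alpha> = p (m j)" "P l \<beta> = p (m l)"
        using P_reg[OF j(1) jin(1)] P_reg[OF l(1) lin(1)] by (auto simp: m_def)
      then have "b0 * (w \<beta> - w \<alpha>) \<le> 0" using flux Apm by simp
      then show False using b0 wpos by (simp add: mult_le_0_iff)
    qed
    \<comment> \<open>In general \<open>P\<close> deviates from the midpoint values of
      \<open>p\<close> by at most \<open>q\<close> at either end. The increment of \<open>w\<close>
      bounded in this way is the integral of \<open>v\<close> over the component.\<close>
    have "A * (p (m l) - p (m j)) - A * (2 * q) \<le> A * (P l \<beta> - P j \<alpha>)"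
      unfolding right_diff_distrib[symmetric]
      using P_mid[OF j(1) jin(1)] P_mid[OF l(1) lin(1)] A(1)
      by (intro mult_left_mono) (auto simp: m_def abs_le_iff)
    then have est: "b0 * (w \<beta> - w \<alpha>) \<le> 2 * A * q" using flux Apm by simp
    \<comment> \<open>One end interval has its midpoint in the layer region, the interval of
      \<open>x\<close> does not, so the two lie on different sides of \<open>z\<close>.\<close>
    have "z \<in> {\<alpha><..<\<beta>}"
      using some
    proof
      assume lj: "m j \<in> layer_region"
      have "m j \<le> m k" using m_mono j k jl by auto
      moreover have "\<not> (z < m j \<and> z < m k)" "\<not> (m j < z \<and> m k < z)"
        using zD(6)[of "m j" "m k"] zD(7)[of "m j" "m k"] lj reg mj mk by auto
      ultimately have "m j < z" "z < m k" using neq[OF j(1)] neq[OF k] by auto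
      then show ?thesis using left[OF j(1)] right[OF k] j x ab by auto
    next
      assume ll: "m l \<in> layer_region"
      have "m k \<le> m l" using m_mono l k jl by auto
      moreover have "\<not> (z < m l \<and> z < m k)" "\<not> (m l < z \<and> m k < z)"
        using zD(6)[of "m l" "m k"] zD(7)[of "m l" "m k"] ll reg ml mk by auto
      ultimately have "m k < z" "z < m l" using neq[OF l(1)] neq[OF k] by auto
      then show ?thesis using left[OF k] right[OF l(1)] l x ab by auto
    qed
    then show ?thesis using ab above est by blast
  qed
  show ?thesis
  proof (cases "\<exists>k x. k \<in> {1..N} \<and> x \<in> {X (k - 1)..X k} \<and> \<bar>x - z\<bar> \<le> \<eta> \<and> v x > A \<and> m k \<notin> layer_region")
    case False
    have q: "q \<ge> 0"
    proof -
      have N: "N \<ge> 1" using mesh less by (cases N) (auto simp: is_mesh_def)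
      show ?thesis using P_mid[of 1 "X 0"] N mesh_Icc_subset(2)[OF mesh, of 1] by force
    qed
    \<comment> \<open>Without a peak the witness is the empty interval
      \<open>{xR..xL}\<close>.\<close>
    show ?thesis
      by (rule exI[of _ xR], rule exI[of _ xL]) (use False less q A b0 in \<open>auto simp: m_def\<close>)
  next
    case True
    then obtain k0 x0 where "k0 \<in> {1..N}" "x0 \<in> {X (k0 - 1)..X k0}" "\<bar>x0 - z\<bar> \<le> \<eta>" "v x0 > A"
      "m k0 \<notin> layer_region" by blast
    then obtain \<alpha> \<beta> where ab: "z - \<eta> \<le> \<alpha>" "\<alpha> < x0" "x0 < \<beta>" "\<beta> \<le> z + \<eta>" "v \<alpha> = A" "v \<beta> = A"
      "\<forall>t\<in>{\<alpha><..<\<beta>}. v t > A" "z \<in> {\<alpha><..<\<beta>}" "b0 * (w \<beta> - w \<alpha>) \<le> 2 * A * q"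
      using comp by metis
    have le: "xL \<le> \<alpha>" "\<alpha> < \<beta>" "\<beta> \<le> xR" using ab sub by auto
    have "integral {\<alpha>..\<beta>} (\<lambda>x. \<bar>v x\<bar>) = integral {\<alpha>..\<beta>} v"
    proof (rule integral_cong)
      fix t assume "t \<in> {\<alpha>..\<beta>}"
      then consider "t = \<alpha>" | "t = \<beta>" | "t \<in> {\<alpha><..<\<beta>}" by fastforce
      then have "v t \<ge> A"
      proof cases
        case 3
        then show ?thesis using ab(7) less_imp_le by blast
      qed (use ab(5,6) in simp_all)
      then show "\<bar>v t\<bar> = v t" using A by simp
    qed
    also have "\<dots> = w \<beta> - w \<alpha>" using le by (intro v_integral) auto
    also have "\<dots> \<le> 2 * A * q / b0" using ab(9) b0 by (simp add: pos_le_divide_eq mult.commute)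
    finally have int: "integral {\<alpha>..\<beta>} (\<lambda>x. \<bar>v x\<bar>) \<le> 2 * A * q / b0" .
    \<comment> \<open>Every such component contains \<open>z\<close>, so two of them overlap; but an
      end of one, where \<open>v = A\<close>, cannot be an interior point of the other.\<close>
    have "x \<in> {\<alpha>..\<beta>}" if kx: "k \<in> {1..N}" "x \<in> {X (k - 1)..X k}" "m k \<notin> layer_region" "\<bar>x - z\<bar> \<le> \<eta>" "v x > A" for k x
    proof -
      obtain \<alpha>' \<beta>' where ab': "\<alpha>' < x" "x < \<beta>'" "\<forall>t\<in>{\<alpha>'<..<\<beta>'}. v t > A" "z \<in> {\<alpha>'<..<\<beta>'}"
        using comp[OF kx(1,2,4,5,3)] by metis
      show ?thesis
      proof (rule ccontr)
        assume "x \<notin> {\<alpha>..\<beta>}"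
        then have "\<beta> \<in> {\<alpha>'<..<\<beta>'} \<or> \<alpha> \<in> {\<alpha>'<..<\<beta>'}" using ab' ab(8) by auto
        then have "v \<beta> > A \<or> v \<alpha> > A" using ab'(3) by blast
        then show False using ab(5,6) by simp
      qed
    qed
    then show ?thesis using le int unfolding m_def by (intro exI[of _ \<alpha>] exI[of _ \<beta>]) auto
  qed
qed

end

subsection \<open>The energy estimate\<close>

text \<open>\<open>M\<close> collects the bounds that are uniform in \<open>eps\<close> and the
  mesh. All constants defined in this locale depend only on \<open>M\<close> and the data, never on
  \<open>eps\<close>, \<open>h\<close> or the mesh.\<close>

locale error_setting = zones + approx: pw_solution xL xR N X eps P "\<lambda>k x. b (mesh_mid X k)" "\<lambda>k x. f (mesh_mid X k)" uh v
  + exact: pw_solution xL xR 1 Y eps "\<lambda>k. p" "\<lambda>k. b" "\<lambda>k. f" u V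
  for N X eps P uh v Y u V +
  fixes h M :: real
  assumes P_cont: "\<And>k. k \<in> {1..N} \<Longrightarrow> continuous_on {X (k - 1)..X k} (P k)"
    and P_reg: "\<And>k x. \<lbrakk>k \<in> {1..N}; x \<in> {X (k - 1)..X k}; mesh_mid X k \<notin> layer_region\<rbrakk> \<Longrightarrow> P k x = p (mesh_mid X k)"
    and P_mid: "\<And>k x. \<lbrakk>k \<in> {1..N}; x \<in> {X (k - 1)..X k}\<rbrakk> \<Longrightarrow> \<bar>P k x - p (mesh_mid X k)\<bar> \<le> 2 * K * h"
    and P_layer: "\<And>k x. \<lbrakk>k \<in> {1..N}; x \<in> {X (k - 1)..X k}; mesh_mid X k \<in> layer_region\<rbrakk> \<Longrightarrow> \<bar>P k x - p x\<bar> \<le> K * h\<^sup>2"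
    and width: "\<And>k. k \<in> {1..N} \<Longrightarrow> X k - X (k - 1) \<le> h"
    and h_small: "h \<le> \<eta> / 2" "h \<le> \<delta> / 2" "3 * K * h \<le> c1 / 2"
    and zeros_in_mesh: "regular_zeros \<subseteq> X ` {0..N}"
    and u_le: "\<And>x. x \<in> {xL..xR} \<Longrightarrow> \<bar>u x\<bar> \<le> M" and uh_le: "\<And>x. x \<in> {xL..xR} \<Longrightarrow> \<bar>uh x\<bar> \<le> M"
    and V_le: "\<And>x. x \<in> {xL..xR} \<Longrightarrow> eps * \<bar>V x\<bar> \<le> M" and v_le: "\<And>x. x \<in> {xL..xR} \<Longrightarrow> eps * \<bar>v x\<bar> \<le> M"
    and v_int: "integral {xL..xR} (\<lambda>x. \<bar>v x\<bar>) \<le> M"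
    and boundary: "u xL = uh xL" "u xR = uh xR"
begin

abbreviation m :: "nat \<Rightarrow> real" where "m \<equiv> mesh_mid X"

lemma M_nonneg: "M \<ge> 0"
  using u_le[of xL] less by auto

lemma Icc_sub: "k \<in> {1..N} \<Longrightarrow> {X (k - 1)..X k} \<subseteq> {xL..xR}"
  using mesh_Icc_subset(1)[OF approx.mesh] .

lemma m_in: "k \<in> {1..N} \<Longrightarrow> m k \<in> {X (k - 1)..X k}" and m_Icc: "k \<in> {1..N} \<Longrightarrow> m k \<in> {xL..xR}"
  using mesh_mid_in[OF approx.mesh, of k] Icc_sub[of k] by auto

lemma m_dist:
  assumes "k \<in> {1..N}" "x \<in> {X (k - 1)..X k}"
  shows "\<bar>x - m k\<bar> \<le> h / 2" "\<bar>x - m k\<bar> \<le> h" "x \<in> {xL..xR}"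
proof -
  show 1: "\<bar>x - m k\<bar> \<le> h / 2" using assms(2) width[OF assms(1)] by (auto simp: mesh_mid_def abs_le_iff field_simps)
  then show "\<bar>x - m k\<bar> \<le> h" by linarith
  show "x \<in> {xL..xR}" using Icc_sub[OF assms(1)] assms(2) by auto
qed

lemma h_pos: "h > 0"
proof -
  have "N \<ge> 1" using approx.mesh less by (cases N) (auto simp: is_mesh_def)
  then show ?thesis using width[of 1] mesh_Icc_subset(2)[OF approx.mesh, of 1] by force
qed

definition G :: real where "G = K + K * M"

text \<open>The first two terms come from \<open>safe_bound\<close>; the last one makes
  \<open>A * \<eta>\<close> exceed \<open>K + K * M\<close>, as the arguments in the zones
  require.\<close>

definition A :: real where "A = (2 * G / c1 + 2 * M / (c1 * rad)) + (G + 1) / \<eta>"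

lemma G_pos: "G > 0"
  using K_pos M_nonneg by (simp add: G_def add_pos_nonneg)

lemma A_ge: "A \<ge> 2 * G / c1 + 2 * M / (c1 * rad)" and A_pos: "A > 0" and A_gt: "A * \<eta> > K + K * M"
proof -
  have 1: "2 * G / c1 + 2 * M / (c1 * rad) \<ge> 0" and 2: "(G + 1) / \<eta> > 0"
    using G_pos M_nonneg c1_pos rad_pos \<eta>_pos by auto
  then show "A \<ge> 2 * G / c1 + 2 * M / (c1 * rad)" "A > 0" by (auto simp: A_def)
  have "(G + 1) / \<eta> * \<eta> \<le> A * \<eta>" using 1 \<eta>_pos by (intro mult_right_mono) (auto simp: A_def)
  then show "A * \<eta> > K + K * M" using \<eta>_pos by (simp add: G_def)
qed

lemma flux_bound:
  assumes "x \<in> {xL..xR}" "y \<in> {xL..xR}" "\<bar>t\<bar> \<le> M"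
  shows "\<bar>f x - b y * t\<bar> \<le> G"
proof -
  have "\<bar>b y * t\<bar> \<le> K * M" unfolding abs_mult using assms b_le[of y] K_pos by (intro mult_mono) auto
  then show ?thesis using f_le[OF assms(1)] by (simp add: G_def abs_le_iff)
qed

lemma P_near: "k \<in> {1..N} \<Longrightarrow> x \<in> {X (k - 1)..X k} \<Longrightarrow> \<bar>P k x - p x\<bar> \<le> c1 / 2"
proof -
  assume kx: "k \<in> {1..N}" "x \<in> {X (k - 1)..X k}"
  have "\<bar>p (m k) - p x\<bar> \<le> K * \<bar>m k - x\<bar>" using p_lipschitz[OF m_Icc[OF kx(1)] m_dist(3)[OF kx]] .
  also have "\<dots> \<le> K * h" using m_dist(2)[OF kx] K_pos by (intro mult_left_mono) (auto simp: abs_minus_commute)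
  finally show ?thesis using P_mid[OF kx] h_small(3) by linarith
qed

lemma v_safe:
  assumes "safe x" shows "\<bar>v x\<bar> \<le> A"
proof -
  have "v x \<le> 2 * G / c1 + 2 * M / (c1 * rad)"
    by (rule safe_bound[OF approx.pw_solution_axioms P_cont P_near _ v_le assms])
      (use flux_bound uh_le m_Icc m_dist(3) in auto)
  moreover have "- v x \<le> 2 * G / c1 + 2 * M / (c1 * rad)"
    by (rule safe_bound[OF approx.uminus P_cont P_near _ _ assms])
      (use flux_bound[of "m _" "m _" "uh _"] uh_le m_Icc m_dist(3) v_le in \<open>auto simp: abs_minus_commute\<close>)
  ultimately show ?thesis using A_ge by linarith
qed

lemma V_safe:
  assumes "safe x" shows "\<bar>V x\<bar> \<le> A"
proof -
  have Y: "{Y (k - 1)..Y k} \<subseteq> {xL..xR}" if "k \<in> {1..1}" for k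
    using mesh_Icc_subset(1)[OF exact.mesh that] .
  have "V x \<le> 2 * G / c1 + 2 * M / (c1 * rad)"
    by (rule safe_bound[OF exact.pw_solution_axioms _ _ _ V_le assms])
      (use flux_bound u_le Y c1_pos in \<open>auto intro: continuous_on_subset[OF p_cont]\<close>)
  moreover have "- V x \<le> 2 * G / c1 + 2 * M / (c1 * rad)"
    by (rule safe_bound[OF exact.uminus _ _ _ _ assms])
      (use flux_bound[of "_" "_" "u _"] u_le Y c1_pos V_le in \<open>auto intro: continuous_on_subset[OF p_cont] simp: abs_minus_commute\<close>)
  ultimately show ?thesis using A_ge by linarith
qed

lemma V_decreasing_zone:
  assumes z: "z \<in> regular_zeros" "p1 z < 0" and x: "\<bar>x - z\<bar> \<le> \<eta>"
  shows "\<bar>V x\<bar> \<le> A"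
proof -
  have "\<bar>V (z - \<eta>)\<bar> \<le> A" "\<bar>V (z + \<eta>)\<bar> \<le> A"
    using safe_edge[OF z(1)] \<eta>_pos by (auto intro!: V_safe)
  then have edge: "V (z - \<eta>) \<le> A" "V (z + \<eta>) \<le> A" "- V (z - \<eta>) \<le> A" "- V (z + \<eta>) \<le> A" by auto
  have "V x \<le> A"
    by (rule decreasing_zone_upper[OF exact.pw_solution_axioms f_deriv f1_le u_le z edge(1,2) A_pos A_gt x])
  moreover have "- V x \<le> A"
    by (rule decreasing_zone_upper[OF exact.uminus DERIV_minus[OF f_deriv] _ _ z edge(3,4) A_pos A_gt x])
      (use f1_le u_le in auto)
  ultimately show ?thesis by linarith
qed

text \<open>Twice \<open>2 * A * q / b0\<close> with \<open>q = 2 * K * h\<close>, one share for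
  each sign of \<open>v\<close>, divided by \<open>h\<close>.\<close>

definition peak_bound :: real where "peak_bound = 8 * A * K / b0"

lemma increasing_zone:
  assumes z: "z \<in> regular_zeros" "p1 z > 0"
  shows "\<exists>\<beta>. (\<forall>x. \<beta> x \<ge> 0) \<and> \<beta> integrable_on {xL..xR} \<and> integral {xL..xR} \<beta> \<le> peak_bound * h \<and>
    (\<forall>k\<in>{1..N}. \<forall>x\<in>{X (k - 1)..X k}. m k \<notin> layer_region \<and> \<bar>x - z\<bar> \<le> \<eta> \<longrightarrow> \<bar>v x\<bar> \<le> A + \<beta> x)"
proof -
  have "\<bar>v (z - \<eta>)\<bar> \<le> A" "\<bar>v (z + \<eta>)\<bar> \<le> A"
    using safe_edge[OF z(1)] \<eta>_pos by (auto intro!: v_safe)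
  then have edge: "v (z - \<eta>) \<le> A" "v (z + \<eta>) \<le> A" "- v (z - \<eta>) \<le> A" "- v (z + \<eta>) \<le> A" by auto
  have zX: "z \<in> X ` {0..N}" using zeros_in_mesh z by auto
  have h\<eta>: "h \<le> \<eta>" using h_small \<eta>_pos by simp
  have f_lip': "\<bar>- f x - - f y\<bar> \<le> K * \<bar>x - y\<bar>" if "x \<in> {xL..xR}" "y \<in> {xL..xR}" for x y
    using f_lipschitz[OF that] by (simp add: abs_minus_commute)
  have uh_le': "\<bar>- uh x\<bar> \<le> M" if "x \<in> {xL..xR}" for x using uh_le[OF that] by simp
  obtain l l' where l: "xL \<le> l" "l' \<le> xR" "integral {l..l'} (\<lambda>x. \<bar>v x\<bar>) \<le> 2 * A * (2 * K * h) / b0"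
    and lin: "\<forall>k\<in>{1..N}. \<forall>x\<in>{X (k - 1)..X k}. m k \<notin> layer_region \<and> \<bar>x - z\<bar> \<le> \<eta> \<and> v x > A \<longrightarrow> x \<in> {l..l'}"
    using increasing_zone_upper[OF approx.pw_solution_axioms f_lipschitz uh_le P_reg P_mid width h\<eta> z zX edge(1,2) A_pos less_imp_le[OF A_gt]]
    by blast
  obtain s s' where s: "xL \<le> s" "s' \<le> xR" "integral {s..s'} (\<lambda>x. \<bar>- v x\<bar>) \<le> 2 * A * (2 * K * h) / b0"
    and sin: "\<forall>k\<in>{1..N}. \<forall>x\<in>{X (k - 1)..X k}. m k \<notin> layer_region \<and> \<bar>x - z\<bar> \<le> \<eta> \<and> - v x > A \<longrightarrow> x \<in> {s..s'}"
    using increasing_zone_upper[OF approx.uminus f_lip' uh_le' P_reg P_mid width h\<eta> z zX edge(3,4) A_pos less_imp_le[OF A_gt]]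
    by blast
  \<comment> \<open>On the two exceptional intervals, one for each sign, \<open>\<beta>\<close>
    contains \<open>\<bar>v\<bar>\<close> itself: no pointwise bound is available there, only the
    integral is small.\<close>
  define \<beta> where "\<beta> x = (if x \<in> {l..l'} then \<bar>v x\<bar> else 0) + (if x \<in> {s..s'} then \<bar>v x\<bar> else 0)" for x
  have restr: "(\<lambda>x. if x \<in> {a..c} then \<bar>v x\<bar> else 0) integrable_on {xL..xR}"
    "integral {xL..xR} (\<lambda>x. if x \<in> {a..c} then \<bar>v x\<bar> else 0) = integral {a..c} (\<lambda>x. \<bar>v x\<bar>)"
    if "xL \<le> a" "c \<le> xR" for a c
  proof -
    have sub: "{a..c} \<subseteq> {xL..xR}" using that by auto
    have "(\<lambda>x. \<bar>v x\<bar>) integrable_on {a..c}" using sub by (rule approx.abs_v_integrable)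
    from iffD2[OF has_integral_restrict[OF sub] integrable_integral[OF this]]
    show "(\<lambda>x. if x \<in> {a..c} then \<bar>v x\<bar> else 0) integrable_on {xL..xR}"
      "integral {xL..xR} (\<lambda>x. if x \<in> {a..c} then \<bar>v x\<bar> else 0) = integral {a..c} (\<lambda>x. \<bar>v x\<bar>)"
      by (rule has_integral_integrable, rule integral_unique)
  qed
  note r1 = restr[OF l(1,2)] and r2 = restr[OF s(1,2)]
  have "\<beta> integrable_on {xL..xR}" unfolding \<beta>_def using r1(1) r2(1) by (rule integrable_add)
  moreover have "integral {xL..xR} \<beta> \<le> peak_bound * h"
  proof -
    have "integral {xL..xR} \<beta> = integral {l..l'} (\<lambda>x. \<bar>v x\<bar>) + integral {s..s'} (\<lambda>x. \<bar>v x\<bar>)"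
      unfolding \<beta>_def using Henstock_Kurzweil_Integration.integral_add[OF r1(1) r2(1)] r1(2) r2(2) by simp
    also have "\<dots> \<le> 2 * A * (2 * K * h) / b0 + 2 * A * (2 * K * h) / b0"
      using l(3) s(3) by (intro add_mono) auto
    also have "\<dots> = peak_bound * h" by (simp add: peak_bound_def field_simps)
    finally show ?thesis .
  qed
  moreover have "\<bar>v x\<bar> \<le> A + \<beta> x" if kx: "k \<in> {1..N}" "x \<in> {X (k - 1)..X k}" "m k \<notin> layer_region" "\<bar>x - z\<bar> \<le> \<eta>" for k x
  proof (cases "\<bar>v x\<bar> \<le> A")
    case True
    then show ?thesis by (auto simp: \<beta>_def)
  next
    case False
    then have "v x > A \<or> - v x > A" by auto
    then have "x \<in> {l..l'} \<or> x \<in> {s..s'}" using lin sin kx by blast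
    then show ?thesis using A_pos by (auto simp: \<beta>_def)
  qed
  ultimately show ?thesis by (intro exI[of _ \<beta>]) (auto simp: \<beta>_def)
qed

lemma peaks:
  obtains \<beta> where "\<And>x. \<beta> x \<ge> 0" "\<beta> integrable_on {xL..xR}"
    "integral {xL..xR} \<beta> \<le> real (card regular_zeros) * peak_bound * h"
    "\<And>z k x. \<lbrakk>z \<in> regular_zeros; p1 z > 0; k \<in> {1..N}; x \<in> {X (k - 1)..X k}; m k \<notin> layer_region; \<bar>x - z\<bar> \<le> \<eta>\<rbrakk>
      \<Longrightarrow> \<bar>v x\<bar> \<le> A + \<beta> x"
proof -
  define R where "R = {z \<in> regular_zeros. p1 z > 0}"
  have fin: "finite R" unfolding R_def using finite_regular_zeros by auto
  have "\<forall>z\<in>R. \<exists>\<beta>. (\<forall>x. \<beta> x \<ge> 0) \<and> \<beta> integrable_on {xL..xR} \<and> integral {xL..xR} \<beta> \<le> peak_bound * h \<and>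
    (\<forall>k\<in>{1..N}. \<forall>x\<in>{X (k - 1)..X k}. m k \<notin> layer_region \<and> \<bar>x - z\<bar> \<le> \<eta> \<longrightarrow> \<bar>v x\<bar> \<le> A + \<beta> x)"
    using increasing_zone by (auto simp: R_def)
  then obtain B where B: "\<forall>z\<in>R. (\<forall>x. B z x \<ge> 0) \<and> B z integrable_on {xL..xR} \<and> integral {xL..xR} (B z) \<le> peak_bound * h \<and>
    (\<forall>k\<in>{1..N}. \<forall>x\<in>{X (k - 1)..X k}. m k \<notin> layer_region \<and> \<bar>x - z\<bar> \<le> \<eta> \<longrightarrow> \<bar>v x\<bar> \<le> A + B z x)"
    unfolding bchoice_iff by blast
  define \<beta> where "\<beta> x = (\<Sum>z\<in>R. B z x)" for x
  show ?thesis
  proof (rule that)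
    show "\<beta> x \<ge> 0" for x unfolding \<beta>_def using B by (intro sum_nonneg) auto
    show "\<beta> integrable_on {xL..xR}" unfolding \<beta>_def using B fin by (intro integrable_sum) auto
    have "integral {xL..xR} \<beta> = (\<Sum>z\<in>R. integral {xL..xR} (B z))"
      unfolding \<beta>_def using B fin by (intro integral_sum) auto
    also have "\<dots> \<le> real (card R) * (peak_bound * h)"
      using B by (intro sum_bounded_above) auto
    also have "\<dots> \<le> real (card regular_zeros) * (peak_bound * h)"
    proof (rule mult_right_mono)
      show "real (card R) \<le> real (card regular_zeros)"
        using finite_regular_zeros by (auto simp: R_def intro!: card_mono)
      show "peak_bound * h \<ge> 0" using A_pos K_pos b0_nonneg h_pos by (simp add: peak_bound_def)
    qed
    finally show "integral {xL..xR} \<beta> \<le> real (card regular_zeros) * peak_bound * h" by (simp add: mult.assoc)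
    show "\<bar>v x\<bar> \<le> A + \<beta> x" if "z \<in> regular_zeros" "p1 z > 0" "k \<in> {1..N}" "x \<in> {X (k - 1)..X k}"
      "m k \<notin> layer_region" "\<bar>x - z\<bar> \<le> \<eta>" for z k x
    proof -
      have z: "z \<in> R" using that by (simp add: R_def)
      then have "\<bar>v x\<bar> \<le> A + B z x" using B that by blast
      moreover have "B z x \<le> \<beta> x" unfolding \<beta>_def using B fin z by (intro member_le_sum) auto
      ultimately show ?thesis by linarith
    qed
  qed
qed

section \<open>The error equation and its integration over mesh intervals\<close>

definition e :: "real \<Rightarrow> real" where "e x = u x - uh x"
definition y :: "real \<Rightarrow> real" where "y x = V x - v x"

text \<open>In general the factor of the squared error is
  \<open>b - p' / 2 = (b + (b - p')) / 2 \<ge> \<gamma>0 / 2\<close>. On intervals inside decreasing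
  zones it is \<open>b \<ge> b0\<close>; such zones surround a zero of \<open>p\<close>, which
  forces \<open>b0 > 0\<close>.\<close>

definition coercivity :: real where "coercivity = (if b0 > 0 then min (\<gamma>0 / 2) b0 else \<gamma>0 / 2)"

text \<open>The summands stem from the consistency term with bounded \<open>v\<close> or
  \<open>V\<close>, from the data, and from the terms with \<open>h\<^sup>2 * \<bar>v\<bar>\<close>
  or \<open>\<beta>\<close>, where \<open>\<bar>e\<bar> \<le> 2 * M\<close> is used.\<close>

definition C_int :: real where "C_int = K * A + G + 2 * M * K"

lemma coercivity_pos: "coercivity > 0"
  using \<gamma>0_pos by (simp add: coercivity_def)

lemma e_deriv: "x \<in> {xL..xR} \<Longrightarrow> (e has_real_derivative y x) (at x within {xL..xR})"
  unfolding e_def y_def by (intro DERIV_diff exact.w_deriv approx.w_deriv)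

lemma e_le: "x \<in> {xL..xR} \<Longrightarrow> \<bar>e x\<bar> \<le> 2 * M"
  using u_le[of x] uh_le[of x] by (auto simp: e_def)

lemma cont_e: "continuous_on {xL..xR} e" and cont_y: "continuous_on {xL..xR} y"
  using DERIV_continuous_on[OF e_deriv] by (auto simp: y_def intro!: continuous_intros exact.v_cont approx.v_cont)

text \<open>The midpoint has distance at least \<open>\<delta>\<close> from each layer point and at
  most \<open>h / 2\<close> from \<open>x\<close>, which leaves \<open>3 / 4 * \<delta>\<close>. As
  no decreasing zone contains the whole interval, \<open>x\<close> has distance at least
  \<open>\<eta> - h \<ge> \<eta> / 2\<close> from its centre.\<close>

lemma v_away:
  assumes k: "k \<in> {1..N}" and x: "x \<in> {X (k - 1)..X k}" and reg: "m k \<notin> layer_region"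
    and inc: "\<And>z. z \<in> regular_zeros \<Longrightarrow> p1 z > 0 \<Longrightarrow> \<bar>x - z\<bar> > \<eta>"
    and dec: "\<And>z. z \<in> regular_zeros \<Longrightarrow> p1 z < 0 \<Longrightarrow> \<not> {X (k - 1)..X k} \<subseteq> {z - \<eta>..z + \<eta>}"
  shows "\<bar>v x\<bar> \<le> A"
proof (rule v_safe, rule safe_regular)
  show xI: "x \<in> {xL..xR}" using m_dist(3)[OF k x] .
  show "3 / 4 * \<delta> \<le> \<bar>x - s\<bar>" if s: "s \<in> layer_points" for s
  proof -
    have "m k \<notin> {s - \<delta>..s + \<delta>}" using reg s by (auto simp: layer_region_def)
    then have "\<bar>m k - s\<bar> \<ge> \<delta>" by auto
    then show ?thesis using m_dist(1)[OF k x] h_small(2) by linarith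
  qed
  show "\<eta> / 2 \<le> \<bar>x - z\<bar>" if z: "z \<in> regular_zeros" for z
  proof (cases "p1 z > 0")
    case True
    then show ?thesis using inc[OF z] \<eta>_pos by linarith
  next
    case False
    then have "p1 z < 0" using regular_zeroD(5)[OF z] by simp
    then obtain t where t: "t \<in> {X (k - 1)..X k}" "t \<notin> {z - \<eta>..z + \<eta>}" using dec[OF z] by blast
    then have "\<bar>t - z\<bar> \<ge> \<eta>" by auto
    moreover have "\<bar>x - t\<bar> \<le> h" using t(1) x width[OF k] by auto
    ultimately show ?thesis using h_small(1) by linarith
  qed
qed

text \<open>The error satisfies \<open>eps y' = p y + b e + (p - P) v + (b - b (m k)) uh - (f - f (m
  k))\<close>. After multiplication by \<open>e\<close> the part \<open>c y e\<close> of the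
  convection is absorbed into the derivative of \<open>c e\<^sup>2 / 2\<close>. The free function
  \<open>c\<close> will be \<open>p\<close> or the constant \<open>p (m k)\<close>.\<close>

lemma quadratic_deriv:
  assumes k: "k \<in> {1..N}" and x: "x \<in> {X (k - 1)..X k}"
    and c: "(c has_real_derivative c' x) (at x within {X (k - 1)..X k})"
  shows "((\<lambda>x. eps * y x * e x - c x * (e x)\<^sup>2 / 2) has_real_derivative
    eps * (y x)\<^sup>2 + (b x - c' x / 2) * (e x)\<^sup>2 + (p x - c x) * y x * e x + (p x - P k x) * v x * e x +
      ((b x - b (m k)) * uh x - (f x - f (m k))) * e x) (at x within {X (k - 1)..X k})"
proof -
  note xI = m_dist(3)[OF k x]
  have Y: "{Y (1 - 1)..Y 1} = {xL..xR}" using exact.mesh by (simp add: is_mesh_def)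
  have "(V has_real_derivative (p x * V x + b x * u x - f x) / eps) (at x within {xL..xR})"
    using exact.v_deriv[of 1 x] xI unfolding Y by simp
  then have dV: "(V has_real_derivative (p x * V x + b x * u x - f x) / eps) (at x within {X (k - 1)..X k})"
    by (rule DERIV_subset) (rule Icc_sub[OF k])
  have de: "(e has_real_derivative y x) (at x within {X (k - 1)..X k})"
    by (rule DERIV_subset[OF e_deriv[OF xI] Icc_sub[OF k]])
  have dy: "(y has_real_derivative (p x * V x + b x * u x - f x) / eps -
      (P k x * v x + b (m k) * uh x - f (m k)) / eps) (at x within {X (k - 1)..X k})"
    unfolding y_def[abs_def] by (intro DERIV_diff dV approx.v_deriv k x)
  have d: "((\<lambda>x. eps * y x * e x - c x * (e x)\<^sup>2 / 2) has_real_derivative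
      eps * ((p x * V x + b x * u x - f x) / eps - (P k x * v x + b (m k) * uh x - f (m k)) / eps) * e x +
      eps * y x * y x - (c' x * (e x)\<^sup>2 + c x * (2 * e x * y x)) / 2) (at x within {X (k - 1)..X k})"
    by (rule DERIV_cong[OF DERIV_diff[OF DERIV_mult[OF DERIV_cmult[OF dy, of eps] de]
          DERIV_cdivide[OF DERIV_mult[OF c DERIV_power[OF de, of 2]], of 2]]])
      (simp add: algebra_simps power2_eq_square)
  have eq: "eps * ((p x * V x + b x * u x - f x) / eps - (P k x * v x + b (m k) * uh x - f (m k)) / eps) * e x +
      eps * y x * y x - (c' x * (e x)\<^sup>2 + c x * (2 * e x * y x)) / 2 =
      eps * (y x)\<^sup>2 + (b x - c' x / 2) * (e x)\<^sup>2 + (p x - c x) * y x * e x + (p x - P k x) * v x * e x +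
      ((b x - b (m k)) * uh x - (f x - f (m k))) * e x"
  proof -
    have q: "eps * ((p x * V x + b x * u x - f x) / eps - (P k x * v x + b (m k) * uh x - f (m k)) / eps) =
      (p x * V x + b x * u x - f x) - (P k x * v x + b (m k) * uh x - f (m k))"
      using exact.eps_pos by (simp add: field_simps)
    have V: "V x = y x + v x" "u x = e x + uh x" by (auto simp: y_def e_def)
    show ?thesis unfolding q unfolding V by (simp add: field_simps power2_eq_square)
  qed
  show ?thesis by (rule DERIV_cong[OF d eq])
qed

lemma data_error:
  assumes k: "k \<in> {1..N}" and x: "x \<in> {X (k - 1)..X k}"
  shows "\<bar>((b x - b (m k)) * uh x - (f x - f (m k))) * e x\<bar> \<le> G * h * \<bar>e x\<bar>"
proof -
  note xI = m_dist(3)[OF k x]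
  have Kh: "K * \<bar>x - m k\<bar> \<le> K * h" using m_dist(2)[OF k x] K_pos by (intro mult_left_mono) auto
  have "\<bar>b x - b (m k)\<bar> \<le> K * h" using b_lipschitz[OF xI m_Icc[OF k]] Kh by linarith
  then have "\<bar>(b x - b (m k)) * uh x\<bar> \<le> (K * h) * M"
    unfolding abs_mult using uh_le[OF xI] K_pos h_pos by (intro mult_mono) auto
  moreover have "\<bar>f x - f (m k)\<bar> \<le> K * h" using f_lipschitz[OF xI m_Icc[OF k]] Kh by linarith
  ultimately have "\<bar>(b x - b (m k)) * uh x - (f x - f (m k))\<bar> \<le> G * h"
    unfolding G_def by (simp add: algebra_simps abs_le_iff)
  then show ?thesis unfolding abs_mult by (intro mult_right_mono) auto
qed

text \<open>On intervals where \<open>p\<close> decreases, the convection of the error is attributed to the piecewise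
  constant \<open>P\<close>, whose jumps have the favourable sign; this replaces \<open>v\<close> by the bounded \<open>V\<close> in the
  consistency term.\<close>

lemma interval_estimate:
  assumes k: "k \<in> {1..N}" and \<beta>: "\<And>x. \<beta> x \<ge> 0" "\<beta> integrable_on {xL..xR}"
    and peak: "\<And>z x. \<lbrakk>z \<in> regular_zeros; p1 z > 0; x \<in> {X (k - 1)..X k}; m k \<notin> layer_region; \<bar>x - z\<bar> \<le> \<eta>\<rbrakk>
      \<Longrightarrow> \<bar>v x\<bar> \<le> A + \<beta> x"
  defines "\<Psi> \<equiv> \<lambda>x. eps * y x * e x - p x * (e x)\<^sup>2 / 2"
  shows "integral {X (k - 1)..X k} (\<lambda>x. eps * (y x)\<^sup>2 + coercivity * (e x)\<^sup>2 -
      C_int * (h * \<bar>e x\<bar> + h\<^sup>2 * \<bar>v x\<bar> + h * \<beta> x)) \<le> \<Psi> (X k) - \<Psi> (X (k - 1))"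
proof -
  let ?I = "{X (k - 1)..X k}"
  let ?g = "\<lambda>x. eps * (y x)\<^sup>2 + coercivity * (e x)\<^sup>2 - C_int * (h * \<bar>e x\<bar> + h\<^sup>2 * \<bar>v x\<bar> + h * \<beta> x)"
  note sub = Icc_sub[OF k]
  have le: "X (k - 1) \<le> X k" using mesh_Icc_subset(2)[OF approx.mesh k] by simp
  have g_int: "?g integrable_on ?I"
  proof -
    have "(\<lambda>x. eps * (y x)\<^sup>2 + coercivity * (e x)\<^sup>2 - C_int * (h * \<bar>e x\<bar> + h\<^sup>2 * \<bar>v x\<bar>)) integrable_on ?I"
      by (intro integrable_continuous_real continuous_intros continuous_on_subset[OF cont_e sub]
          continuous_on_subset[OF cont_y sub] continuous_on_subset[OF approx.v_cont sub])
    moreover have "(\<lambda>x. C_int * h * \<beta> x) integrable_on ?I"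
      using integrable_on_subinterval[OF \<beta>(2) sub] by (rule integrable_on_mult_right)
    ultimately have "(\<lambda>x. (eps * (y x)\<^sup>2 + coercivity * (e x)\<^sup>2 - C_int * (h * \<bar>e x\<bar> + h\<^sup>2 * \<bar>v x\<bar>)) -
        C_int * h * \<beta> x) integrable_on ?I" by (rule integrable_diff)
    then show ?thesis by (simp add: algebra_simps)
  qed
  have compare: "integral ?I ?g \<le> H (X k) - H (X (k - 1))"
    if dH: "\<And>x. x \<in> ?I \<Longrightarrow> (H has_real_derivative H' x) (at x within ?I)"
      and ge: "\<And>x. x \<in> ?I \<Longrightarrow> ?g x \<le> H' x" for H H'
    using integral_deriv_within[OF le dH] integral_le[OF g_int _ ge] by metis
  have KA: "K * A \<ge> 0" and MK: "2 * M * K \<ge> 0" using K_pos A_pos M_nonneg by auto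
  have plip: "\<bar>p x - p (m k)\<bar> \<le> K * h" if "x \<in> ?I" for x
  proof -
    have "K * \<bar>x - m k\<bar> \<le> K * h" using m_dist(2)[OF k that] K_pos by (intro mult_left_mono) auto
    then show ?thesis using p_lipschitz[OF m_dist(3)[OF k that] m_Icc[OF k]] by linarith
  qed
  have fromC: "G * h * \<bar>e x\<bar> + T \<le> C_int * (h * \<bar>e x\<bar> + h\<^sup>2 * \<bar>v x\<bar> + h * \<beta> x)"
    if T: "T \<le> (K * A) * (h * \<bar>e x\<bar>) + (2 * M * K) * (h\<^sup>2 * \<bar>v x\<bar> + h * \<beta> x)" for T x
  proof -
    have nn: "h * \<bar>e x\<bar> \<ge> 0" "h\<^sup>2 * \<bar>v x\<bar> + h * \<beta> x \<ge> 0" using h_pos \<beta>(1)[of x] by auto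
    have "G * h * \<bar>e x\<bar> + T \<le> (K * A + G) * (h * \<bar>e x\<bar>) + (2 * M * K) * (h\<^sup>2 * \<bar>v x\<bar> + h * \<beta> x)"
      using T by (simp add: algebra_simps)
    also have "\<dots> \<le> C_int * (h * \<bar>e x\<bar>) + C_int * (h\<^sup>2 * \<bar>v x\<bar> + h * \<beta> x)"
      using KA MK G_pos nn by (intro add_mono mult_right_mono) (auto simp: C_int_def)
    finally show ?thesis by (simp add: algebra_simps)
  qed
  have rest: "(2 * M * K) * (h\<^sup>2 * \<bar>v x\<bar> + h * \<beta> x) \<ge> 0" "(2 * M * K) * (h\<^sup>2 * \<bar>v x\<bar>) \<ge> 0"
    "(2 * M * K) * (h * \<beta> x) \<ge> 0" "(K * A) * (h * \<bar>e x\<bar>) \<ge> 0" for x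
  proof -
    have n: "h\<^sup>2 * \<bar>v x\<bar> \<ge> 0" "h * \<beta> x \<ge> 0" "h * \<bar>e x\<bar> \<ge> 0"
      using h_pos \<beta>(1)[of x] by auto
    show "(2 * M * K) * (h\<^sup>2 * \<bar>v x\<bar> + h * \<beta> x) \<ge> 0" "(2 * M * K) * (h\<^sup>2 * \<bar>v x\<bar>) \<ge> 0"
      "(2 * M * K) * (h * \<beta> x) \<ge> 0" "(K * A) * (h * \<bar>e x\<bar>) \<ge> 0"
      by (rule mult_nonneg_nonneg[OF MK add_nonneg_nonneg[OF n(1,2)]] mult_nonneg_nonneg[OF MK n(1)]
          mult_nonneg_nonneg[OF MK n(2)] mult_nonneg_nonneg[OF KA n(3)])+
  qed
  have combine: "a + a' - C \<le> a + a'' + t1 + t2 + d"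
    if "g + \<bar>t\<bar> \<le> C" "t1 + t2 = t" "a' \<le> a''" "\<bar>d\<bar> \<le> g" for a a' a'' C g t t1 t2 d :: real
    using that by linarith
  consider (dec) z where "m k \<notin> layer_region" "z \<in> regular_zeros" "p1 z < 0" "?I \<subseteq> {z - \<eta>..z + \<eta>}"
    | (other) "\<And>z. \<lbrakk>m k \<notin> layer_region; z \<in> regular_zeros; p1 z < 0\<rbrakk> \<Longrightarrow> \<not> ?I \<subseteq> {z - \<eta>..z + \<eta>}"
    by blast
  then show ?thesis
  proof cases
    case dec
    note z = dec(2,3)
    have b0: "b0 > 0" using regular_zeroD(6)[OF z(1)] .
    let ?H = "\<lambda>x. eps * y x * e x - p (m k) * (e x)\<^sup>2 / 2"
    let ?H' = "\<lambda>x. eps * (y x)\<^sup>2 + (b x - 0 / 2) * (e x)\<^sup>2 + (p x - p (m k)) * y x * e x + (p x - P k x) * v x * e x +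
      ((b x - b (m k)) * uh x - (f x - f (m k))) * e x"
    have "integral ?I ?g \<le> ?H (X k) - ?H (X (k - 1))"
    proof (rule compare)
      show "(?H has_real_derivative ?H' x) (at x within ?I)" if "x \<in> ?I" for x
        by (rule quadratic_deriv[OF k that, of "\<lambda>_. p (m k)" "\<lambda>_. 0"]) simp
      fix x assume x: "x \<in> ?I"
      note xI = m_dist(3)[OF k x]
      have Pk: "P k x = p (m k)" using P_reg[OF k x dec(1)] .
      \<comment> \<open>As \<open>P\<close> equals \<open>p (m k)\<close> here, the leftover
        convection of the error, with \<open>y = V - v\<close>, combines with the consistency term
        and \<open>v\<close> cancels.\<close>
      have comb: "(p x - p (m k)) * y x * e x + (p x - P k x) * v x * e x = (p x - p (m k)) * V x * e x"
        unfolding Pk y_def by (simp add: algebra_simps)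
      have "\<bar>x - z\<bar> \<le> \<eta>" using dec(4) x by (auto simp: abs_le_iff)
      then have "\<bar>V x\<bar> \<le> A" by (rule V_decreasing_zone[OF z])
      then have "\<bar>(p x - p (m k)) * V x * e x\<bar> \<le> (K * h) * A * \<bar>e x\<bar>"
        unfolding abs_mult using plip[OF x] K_pos h_pos by (intro mult_mono) auto
      also have "\<dots> \<le> (K * A) * (h * \<bar>e x\<bar>) + (2 * M * K) * (h\<^sup>2 * \<bar>v x\<bar> + h * \<beta> x)"
        using rest[of x] by (simp add: mult_ac)
      finally have est: "G * h * \<bar>e x\<bar> + \<bar>(p x - p (m k)) * V x * e x\<bar> \<le> C_int * (h * \<bar>e x\<bar> + h\<^sup>2 * \<bar>v x\<bar> + h * \<beta> x)"
        by (rule fromC)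
      have "coercivity * (e x)\<^sup>2 \<le> (b x - 0 / 2) * (e x)\<^sup>2"
        using b_ge[OF xI] b0 by (intro mult_right_mono) (auto simp: coercivity_def)
      then show "?g x \<le> ?H' x"
        by (rule combine[OF est comb _ data_error[OF k x]])
    qed
    \<comment> \<open>Since \<open>p (X k) \<le> p (m k) \<le> p (X (k - 1))\<close>, replacing
      \<open>p (m k)\<close> by \<open>p\<close> in the primitive raises it at the right end and
      lowers it at the left end, both in the desired direction.\<close>
    moreover have "?H (X k) \<le> \<Psi> (X k)"
    proof -
      have "p (X k) - p (m k) \<le> - \<eta> * (X k - m k)"
        using p_decreasing_near[OF z, of "m k" "X k"] dec(4) m_in[OF k] le \<eta>_pos by auto
      also have "\<dots> \<le> 0" using m_in[OF k] \<eta>_pos by (simp add: mult_nonpos_nonneg)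
      finally have "p (X k) * (e (X k))\<^sup>2 \<le> p (m k) * (e (X k))\<^sup>2" by (intro mult_right_mono) auto
      then show ?thesis by (simp add: \<Psi>_def)
    qed
    moreover have "\<Psi> (X (k - 1)) \<le> ?H (X (k - 1))"
    proof -
      have "p (m k) - p (X (k - 1)) \<le> - \<eta> * (m k - X (k - 1))"
        using p_decreasing_near[OF z, of "X (k - 1)" "m k"] dec(4) m_in[OF k] le \<eta>_pos by auto
      also have "\<dots> \<le> 0" using m_in[OF k] \<eta>_pos by (simp add: mult_nonpos_nonneg)
      finally have "p (m k) * (e (X (k - 1)))\<^sup>2 \<le> p (X (k - 1)) * (e (X (k - 1)))\<^sup>2" by (intro mult_right_mono) auto
      then show ?thesis by (simp add: \<Psi>_def)
    qed
    ultimately show ?thesis by linarith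
  next
    case other
    show ?thesis unfolding \<Psi>_def
    proof (rule compare)
      fix x assume x: "x \<in> ?I"
      note xI = m_dist(3)[OF k x]
      show "((\<lambda>x. eps * y x * e x - p x * (e x)\<^sup>2 / 2) has_real_derivative
        eps * (y x)\<^sup>2 + (b x - p1 x / 2) * (e x)\<^sup>2 + (p x - p x) * y x * e x + (p x - P k x) * v x * e x +
        ((b x - b (m k)) * uh x - (f x - f (m k))) * e x) (at x within ?I)"
        by (rule quadratic_deriv[where c = p and c' = p1, OF k x DERIV_subset[OF p_deriv[OF xI] sub]])
      have "\<bar>(p x - P k x) * v x * e x\<bar> \<le> (K * A) * (h * \<bar>e x\<bar>) + (2 * M * K) * (h\<^sup>2 * \<bar>v x\<bar> + h * \<beta> x)"
      proof (cases "m k \<in> layer_region")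
        case True
        have "\<bar>p x - P k x\<bar> \<le> K * h\<^sup>2" using P_layer[OF k x True] by (simp add: abs_minus_commute)
        then have "\<bar>(p x - P k x) * v x * e x\<bar> \<le> (K * h\<^sup>2) * \<bar>v x\<bar> * (2 * M)"
          unfolding abs_mult using K_pos h_pos e_le[OF xI] by (intro mult_mono) auto
        also have "\<dots> \<le> (K * A) * (h * \<bar>e x\<bar>) + (2 * M * K) * (h\<^sup>2 * \<bar>v x\<bar> + h * \<beta> x)"
          using rest(3,4)[of x] by (simp add: distrib_left mult_ac)
        finally show ?thesis .
      next
        case False
        have "\<bar>v x\<bar> \<le> A + \<beta> x"
        proof (cases "\<exists>z\<in>regular_zeros. p1 z > 0 \<and> \<bar>x - z\<bar> \<le> \<eta>")
          case True
          then show ?thesis using peak x False by blast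
        next
          \<comment> \<open>Outside the increasing zones, and on an interval not contained in a
            decreasing one, \<open>v\<close> itself is bounded by \<open>A\<close>.\<close>
          case far: False
          then have "\<bar>v x\<bar> \<le> A" using other[OF False] False by (intro v_away[OF k x]) force+
          then show ?thesis using \<beta>(1)[of x] by linarith
        qed
        moreover have "\<bar>p x - P k x\<bar> \<le> K * h" using plip[OF x] P_reg[OF k x False] by simp
        ultimately have "\<bar>(p x - P k x) * v x * e x\<bar> \<le> (K * h) * (A + \<beta> x) * \<bar>e x\<bar>"
          unfolding abs_mult using K_pos h_pos by (intro mult_mono) auto
        also have "\<dots> = (K * A) * (h * \<bar>e x\<bar>) + K * (h * \<beta> x) * \<bar>e x\<bar>" by (simp add: algebra_simps)
        also have "K * (h * \<beta> x) * \<bar>e x\<bar> \<le> K * (h * \<beta> x) * (2 * M)"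
          using K_pos h_pos \<beta>(1)[of x] e_le[OF xI] by (intro mult_left_mono) auto
        also have "(K * A) * (h * \<bar>e x\<bar>) + K * (h * \<beta> x) * (2 * M) \<le>
            (K * A) * (h * \<bar>e x\<bar>) + (2 * M * K) * (h\<^sup>2 * \<bar>v x\<bar> + h * \<beta> x)"
          using rest(2)[of x] by (simp add: distrib_left mult_ac)
        finally show ?thesis by simp
      qed
      then have est: "G * h * \<bar>e x\<bar> + \<bar>(p x - P k x) * v x * e x\<bar> \<le> C_int * (h * \<bar>e x\<bar> + h\<^sup>2 * \<bar>v x\<bar> + h * \<beta> x)"
        by (rule fromC)
      have co: "coercivity * (e x)\<^sup>2 \<le> (b x - p1 x / 2) * (e x)\<^sup>2"
        using b_ge[OF xI] b0_nonneg coercive[OF xI] by (intro mult_right_mono) (auto simp: coercivity_def)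
      show "?g x \<le> eps * (y x)\<^sup>2 + (b x - p1 x / 2) * (e x)\<^sup>2 + (p x - p x) * y x * e x + (p x - P k x) * v x * e x +
        ((b x - b (m k)) * uh x - (f x - f (m k))) * e x"
        by (rule combine[OF est _ co data_error[OF k x]]) simp
    qed
  qed
qed

definition C_energy :: real where
  "C_energy = C_int\<^sup>2 / (2 * coercivity) * (xR - xL) + C_int * M + C_int * (real (card regular_zeros) * peak_bound)"

text \<open>The interval estimates telescope to boundary terms that vanish with \<open>e\<close>.
  The remainder is of second order: \<open>h * \<bar>e\<bar>\<close> is split by Young's inequality,
  \<open>h\<^sup>2\<close> meets the bounded variation of \<open>uh\<close>, and the peaks
  contribute \<open>h\<close> times an integral of order \<open>h\<close>.\<close>

lemma energy_estimate:
  "eps * integral {xL..xR} (\<lambda>x. (y x)\<^sup>2) + coercivity / 2 * integral {xL..xR} (\<lambda>x. (e x)\<^sup>2) \<le> C_energy * h\<^sup>2"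
proof -
  obtain \<beta> where \<beta>: "\<And>x. \<beta> x \<ge> 0" "\<beta> integrable_on {xL..xR}"
    and \<beta>_int: "integral {xL..xR} \<beta> \<le> real (card regular_zeros) * peak_bound * h"
    and peak: "\<And>z k x. \<lbrakk>z \<in> regular_zeros; p1 z > 0; k \<in> {1..N}; x \<in> {X (k - 1)..X k}; m k \<notin> layer_region; \<bar>x - z\<bar> \<le> \<eta>\<rbrakk>
      \<Longrightarrow> \<bar>v x\<bar> \<le> A + \<beta> x"
    using peaks by blast
  have C_pos: "C_int > 0"
    using K_pos A_pos G_pos M_nonneg by (simp add: C_int_def add_pos_nonneg add_nonneg_pos)
  define \<Psi> where "\<Psi> = (\<lambda>x. eps * y x * e x - p x * (e x)\<^sup>2 / 2)"
  let ?g = "\<lambda>x. eps * (y x)\<^sup>2 + coercivity * (e x)\<^sup>2 - C_int * (h * \<bar>e x\<bar> + h\<^sup>2 * \<bar>v x\<bar> + h * \<beta> x)"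
  let ?low = "\<lambda>x. eps * (y x)\<^sup>2 + coercivity / 2 * (e x)\<^sup>2 - (C_int * h)\<^sup>2 / (2 * coercivity) - C_int * h\<^sup>2 * \<bar>v x\<bar>"
  have i1: "?low integrable_on {xL..xR}"
    by (intro integrable_continuous_real continuous_intros cont_e cont_y approx.v_cont)
       (use coercivity_pos in auto)
  have i2: "(\<lambda>x. C_int * h * \<beta> x) integrable_on {xL..xR}"
    using \<beta>(2) by (rule integrable_on_mult_right)
  have "(\<lambda>x. eps * (y x)\<^sup>2 + coercivity * (e x)\<^sup>2 - C_int * (h * \<bar>e x\<bar> + h\<^sup>2 * \<bar>v x\<bar>)) integrable_on {xL..xR}"
    by (intro integrable_continuous_real continuous_intros cont_e cont_y approx.v_cont)
  from integrable_diff[OF this i2] have i3: "?g integrable_on {xL..xR}" by (simp add: algebra_simps)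
  have "integral {xL..xR} ?g = (\<Sum>k=1..N. integral {X (k - 1)..X k} ?g)"
    using mesh_sum_integral[OF approx.mesh i3] by simp
  also have "\<dots> \<le> (\<Sum>k=1..N. \<Psi> (X k) - \<Psi> (X (k - 1)))"
    unfolding \<Psi>_def using \<beta> peak by (intro sum_mono interval_estimate) auto
  also have "\<dots> = \<Psi> xR - \<Psi> xL" by (rule mesh_sum_diff[OF approx.mesh])
  also have "\<dots> = 0" using boundary by (simp add: \<Psi>_def e_def)
  finally have g0: "integral {xL..xR} ?g \<le> 0" .
  have "integral {xL..xR} (\<lambda>x. ?low x - C_int * h * \<beta> x) \<le> integral {xL..xR} ?g"
  proof (rule integral_le[OF integrable_diff[OF i1 i2] i3])
    fix x
    \<comment> \<open>Young's inequality as a completed square; it spends half of the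
      coercivity.\<close>
    have "0 \<le> (coercivity * \<bar>e x\<bar> - C_int * h)\<^sup>2 / (2 * coercivity)" using coercivity_pos by simp
    also have "\<dots> = coercivity / 2 * (e x)\<^sup>2 + (C_int * h)\<^sup>2 / (2 * coercivity) - C_int * h * \<bar>e x\<bar>"
      using coercivity_pos by (simp add: power2_diff power_mult_distrib field_simps power2_eq_square)
    finally show "?low x - C_int * h * \<beta> x \<le> ?g x" by (simp add: algebra_simps)
  qed
  then have *: "integral {xL..xR} (\<lambda>x. ?low x - C_int * h * \<beta> x) \<le> 0" using g0 by linarith
  have c: "(\<lambda>x. eps * (y x)\<^sup>2) integrable_on {xL..xR}" "(\<lambda>x. coercivity / 2 * (e x)\<^sup>2) integrable_on {xL..xR}"
    "(\<lambda>x. C_int * h\<^sup>2 * \<bar>v x\<bar>) integrable_on {xL..xR}"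
    by (intro integrable_continuous_real continuous_intros cont_e cont_y approx.v_cont)+
  have const: "(\<lambda>x. (C_int * h)\<^sup>2 / (2 * coercivity)) integrable_on {xL..xR}" by (rule integrable_const_ivl)
  have "integral {xL..xR} (\<lambda>x. ?low x - C_int * h * \<beta> x) =
    eps * integral {xL..xR} (\<lambda>x. (y x)\<^sup>2) + coercivity / 2 * integral {xL..xR} (\<lambda>x. (e x)\<^sup>2)
    - (C_int * h)\<^sup>2 / (2 * coercivity) * (xR - xL) - C_int * h\<^sup>2 * integral {xL..xR} (\<lambda>x. \<bar>v x\<bar>)
    - C_int * h * integral {xL..xR} \<beta>"
    using less
    by (simp only: Henstock_Kurzweil_Integration.integral_diff[OF i1 i2]
        Henstock_Kurzweil_Integration.integral_diff[OF integrable_diff[OF integrable_add[OF c(1,2)] const] c(3)]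
        Henstock_Kurzweil_Integration.integral_diff[OF integrable_add[OF c(1,2)] const]
        Henstock_Kurzweil_Integration.integral_add[OF c(1,2)]
        Henstock_Kurzweil_Integration.integral_mult_right) simp
  moreover have "C_int * h\<^sup>2 * integral {xL..xR} (\<lambda>x. \<bar>v x\<bar>) \<le> C_int * h\<^sup>2 * M"
    using v_int C_pos by (intro mult_left_mono) auto
  moreover have "C_int * h * integral {xL..xR} \<beta> \<le> C_int * h * (real (card regular_zeros) * peak_bound * h)"
    using \<beta>_int C_pos h_pos by (intro mult_left_mono) auto
  moreover have "C_energy * h\<^sup>2 = (C_int * h)\<^sup>2 / (2 * coercivity) * (xR - xL) + C_int * h\<^sup>2 * M +
      C_int * h * (real (card regular_zeros) * peak_bound * h)"
    by (simp add: C_energy_def algebra_simps power2_eq_square)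
  ultimately show ?thesis using * by linarith
qed

end

subsection \<open>Uniform bounds and conclusion\<close>

context coefficients
begin

text \<open>Bounds for the supremum norm and the variation of a solution; if \<open>b0 = 0\<close>, they rest on the
  lower bound \<open>c\<close> for the convection.\<close>

definition sup_const :: "real \<Rightarrow> real \<Rightarrow> real" where
  "sup_const U c = (if b0 > 0 then U + K / b0 else U + (K + 1) / c * (xR - xL))"

definition flux_const :: "real \<Rightarrow> real \<Rightarrow> real" where
  "flux_const U c = K + K * sup_const U c"

definition var_const :: "real \<Rightarrow> real \<Rightarrow> real" where
  "var_const U c = (if b0 > 0 then (2 * flux_const U c + 2 * flux_const U c * (xR - xL)) / b0
     else 2 * sup_const U c + flux_const U c / c * (xR - xL))"

definition sol_const :: "real \<Rightarrow> real \<Rightarrow> real" where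
  "sol_const U c = sup_const U c + var_const U c +
     (2 * sup_const U c / (xR - xL) + (K + 2 * K * (xR - xL)) * var_const U c + flux_const U c * (xR - xL))"

text \<open>Serves both solutions. \<open>\<mu>\<close> measures the position at which the
  coefficients are evaluated, so that their jumps sum to at most \<open>K * (xR - xL)\<close>: it is
  constant for the exact solution and the midpoint for the approximate one.\<close>

lemma solution_bounds:
  assumes sol: "pw_solution xL xR N X eps P B F w v" and eps: "eps \<le> 1"
    and P_deriv: "\<And>k x. k \<in> {1..N} \<Longrightarrow> x \<in> {X (k - 1)..X k} \<Longrightarrow>
      (P k has_real_derivative P' k x) (at x within {X (k - 1)..X k})"
    and B_deriv: "\<And>k x. k \<in> {1..N} \<Longrightarrow> x \<in> {X (k - 1)..X k} \<Longrightarrow>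
      (B k has_real_derivative B' k x) (at x within {X (k - 1)..X k})"
    and F_deriv: "\<And>k x. k \<in> {1..N} \<Longrightarrow> x \<in> {X (k - 1)..X k} \<Longrightarrow>
      (F k has_real_derivative F' k x) (at x within {X (k - 1)..X k})"
    and P'_le: "\<And>k x. k \<in> {1..N} \<Longrightarrow> x \<in> {X (k - 1)..X k} \<Longrightarrow> \<bar>P' k x\<bar> \<le> K"
    and B'_le: "\<And>k x. k \<in> {1..N} \<Longrightarrow> x \<in> {X (k - 1)..X k} \<Longrightarrow> \<bar>B' k x\<bar> \<le> K"
    and F'_le: "\<And>k x. k \<in> {1..N} \<Longrightarrow> x \<in> {X (k - 1)..X k} \<Longrightarrow> \<bar>F' k x\<bar> \<le> K"
    and P_le: "\<And>k x. k \<in> {1..N} \<Longrightarrow> x \<in> {X (k - 1)..X k} \<Longrightarrow> \<bar>P k x\<bar> \<le> K + 2 * K * (xR - xL)"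
    and B_le: "\<And>k x. k \<in> {1..N} \<Longrightarrow> x \<in> {X (k - 1)..X k} \<Longrightarrow> \<bar>B k x\<bar> \<le> K"
    and F_le: "\<And>k x. k \<in> {1..N} \<Longrightarrow> x \<in> {X (k - 1)..X k} \<Longrightarrow> \<bar>F k x\<bar> \<le> K"
    and B_ge: "\<And>k x. k \<in> {1..N} \<Longrightarrow> x \<in> {X (k - 1)..X k} \<Longrightarrow> B k x \<ge> b0"
    and jumps: "\<And>k. k \<in> {1..<N} \<Longrightarrow> \<bar>F (Suc k) (X k) - F k (X k)\<bar> \<le> K * (\<mu> (Suc k) - \<mu> k)"
      "\<And>k. k \<in> {1..<N} \<Longrightarrow> \<bar>B (Suc k) (X k) - B k (X k)\<bar> \<le> K * (\<mu> (Suc k) - \<mu> k)"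
    and \<mu>: "\<mu> N - \<mu> 1 \<le> xR - xL"
    and U: "\<bar>w xL\<bar> \<le> U" "\<bar>w xR\<bar> \<le> U"
    and conv: "b0 > 0 \<or> c > 0 \<and> (\<sigma> = 1 \<or> \<sigma> = -1) \<and>
      (\<forall>k\<in>{1..N}. \<forall>x\<in>{X (k - 1)..X k}. \<sigma> * P k x \<ge> c)"
  shows "\<And>x. x \<in> {xL..xR} \<Longrightarrow> \<bar>w x\<bar> \<le> sol_const U c"
    and "\<And>x. x \<in> {xL..xR} \<Longrightarrow> eps * \<bar>v x\<bar> \<le> sol_const U c"
    and "integral {xL..xR} (\<lambda>x. \<bar>v x\<bar>) \<le> sol_const U c"
proof -
  interpret pw_solution xL xR N X eps P B F w v by (rule sol)
  have N: "N \<ge> 1" using mesh less by (cases N) (auto simp: is_mesh_def)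
  note sub = mesh_Icc_subset(1)[OF mesh]
  let ?M = "sup_const U c" and ?G = "flux_const U c" and ?T = "var_const U c"
  have w_le: "\<bar>w x\<bar> \<le> ?M" if x: "x \<in> {xL..xR}" for x
  proof (cases "b0 > 0")
    case True
    have "\<bar>w x\<bar> \<le> U + K / b0"
      using B_ge True F_le U less_imp_le[OF K_pos] x by (rule bound_reaction)
    then show ?thesis using True by (simp add: sup_const_def)
  next
    case False
    then have c: "c > 0" "\<sigma> = 1 \<or> \<sigma> = -1" and P: "\<And>k x. k \<in> {1..N} \<Longrightarrow> x \<in> {X (k - 1)..X k} \<Longrightarrow> \<sigma> * P k x \<ge> c"
      using conv by auto
    have "\<bar>w x\<bar> \<le> U + (K + 1) / c * (xR - xL)"
      by (rule bound_convection[OF c(2) P c(1) _ F_le U less_imp_le[OF K_pos] x])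
        (use B_ge b0_nonneg in \<open>force intro: order_trans\<close>)+
    then show ?thesis using False by (simp add: sup_const_def)
  qed
  then have M0: "?M \<ge> 0" using less by (smt (verit) atLeastAtMost_iff)
  have Bw: "\<bar>a * w x\<bar> \<le> K' * ?M" if "\<bar>a\<bar> \<le> K'" "x \<in> {xL..xR}" for a K' x
    unfolding abs_mult using that w_le M0 by (intro mult_mono) auto
  have G: "\<bar>F k x - B k x * w x\<bar> \<le> ?G" if "k \<in> {1..N}" "x \<in> {X (k - 1)..X k}" for k x
    using F_le[OF that] Bw[OF B_le[OF that], of x] sub[OF that(1)] that(2)
    by (auto simp: flux_const_def abs_le_iff)
  have D: "\<bar>F' k x - B' k x * w x\<bar> \<le> ?G" if "k \<in> {1..N}" "x \<in> {X (k - 1)..X k}" for k x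
    using F'_le[OF that] Bw[OF B'_le[OF that], of x] sub[OF that(1)] that(2)
    by (auto simp: flux_const_def abs_le_iff)
  have G0: "?G \<ge> 0" using K_pos M0 by (simp add: flux_const_def)
  have T: "integral {xL..xR} (\<lambda>x. \<bar>v x\<bar>) \<le> ?T"
  proof (cases "b0 > 0")
    case True
    have "b0 * integral {xL..xR} (\<lambda>x. \<bar>v x\<bar>) \<le> 2 * ?G + ?G * (xR - xL) + (?G * \<mu> N - ?G * \<mu> 1)"
    proof (rule variation_reaction[OF P_deriv B_deriv F_deriv P'_le P_le D G B_ge True])
      fix k assume k: "k \<in> {1..<N}"
      have "X k \<in> {xL..xR}" using k by (intro mesh_in_Icc[OF mesh]) auto
      from Bw[OF jumps(2)[OF k] this] jumps(1)[OF k]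
      show "\<bar>F (Suc k) (X k) - B (Suc k) (X k) * w (X k) - (F k (X k) - B k (X k) * w (X k))\<bar>
          \<le> ?G * \<mu> (Suc k) - ?G * \<mu> k"
        by (simp add: flux_const_def algebra_simps abs_le_iff)
    qed
    also have "?G * \<mu> N - ?G * \<mu> 1 \<le> ?G * (xR - xL)"
      using mult_left_mono[OF \<mu> G0] by (simp add: algebra_simps)
    finally show ?thesis using True by (simp add: var_const_def pos_le_divide_eq mult.commute)
  next
    case False
    then have c: "c > 0" "\<sigma> = 1 \<or> \<sigma> = -1" and P: "\<And>k x. k \<in> {1..N} \<Longrightarrow> x \<in> {X (k - 1)..X k} \<Longrightarrow> \<sigma> * P k x \<ge> c"
      using conv by auto
    have "integral {xL..xR} (\<lambda>x. \<bar>v x\<bar>) \<le> 2 * ?M + ?G / c * (xR - xL)"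
      by (rule variation_convection[OF c(2) DERIV_continuous_on[OF P_deriv] P c(1) G w_le])
    then show ?thesis using False by (simp add: var_const_def)
  qed
  have E: "eps * \<bar>v x\<bar> \<le> 2 * ?M / (xR - xL) + (K + 2 * K * (xR - xL)) * ?T + ?G * (xR - xL)"
    if "x \<in> {xL..xR}" for x
    by (rule eps_v_bound[OF P_le G w_le T that eps])
  have "integral {xL..xR} (\<lambda>x. \<bar>v x\<bar>) \<ge> 0" by (intro integral_nonneg abs_v_integrable) auto
  then have T0: "?T \<ge> 0" using T by linarith
  have E0: "2 * ?M / (xR - xL) + (K + 2 * K * (xR - xL)) * ?T + ?G * (xR - xL) \<ge> 0"
    using M0 T0 G0 K_pos less by (intro add_nonneg_nonneg mult_nonneg_nonneg divide_nonneg_nonneg) auto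
  show "\<bar>w x\<bar> \<le> sol_const U c" if "x \<in> {xL..xR}" for x
    using w_le[OF that] T0 E0 by (simp add: sol_const_def)
  show "eps * \<bar>v x\<bar> \<le> sol_const U c" if "x \<in> {xL..xR}" for x
    using E[OF that] M0 T0 by (simp add: sol_const_def)
  show "integral {xL..xR} (\<lambda>x. \<bar>v x\<bar>) \<le> sol_const U c"
    using T M0 E0 by (simp add: sol_const_def)
qed

section \<open>Accuracy of the approximate convection and bounds for both solutions\<close>

lemma mesh_size_bounds:
  assumes mesh: "is_mesh xL xR N X"
  shows "mesh_size N X > 0" "mesh_size N X \<le> xR - xL"
proof -
  have N: "N \<ge> 1" using mesh less by (cases N) (auto simp: is_mesh_def)
  show "mesh_size N X > 0"
    using mesh_width_le[of 1 N X] mesh_Icc_subset(2)[OF mesh, of 1] N by force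
  show "mesh_size N X \<le> xR - xL"
    unfolding mesh_size_def
  proof (rule Max.boundedI)
    fix d assume "d \<in> (\<lambda>k. X k - X (k - 1)) ` {1..N}"
    then obtain k where k: "k \<in> {1..N}" "d = X k - X (k - 1)" by blast
    then have "k \<le> N" "k - 1 \<le> N" by auto
    from mesh_in_Icc[OF mesh this(1)] mesh_in_Icc[OF mesh this(2)]
    show "d \<le> xR - xL" using k(2) by auto
  qed (use N in auto)
qed

text \<open>The approximation is a midpoint value or the tangent line at a point of the same mesh
  interval; in the second case Taylor's formula gives the error of second order. Either way its
  derivative is a constant bounded by \<open>K\<close>.\<close>

lemma p_bar_properties:
  assumes mesh: "is_mesh xL xR N X" and k: "k \<in> {1..N}"
  shows "\<exists>s. \<bar>s\<bar> \<le> K \<and> (\<forall>x. (p_bar xL xR p b \<delta> X k has_real_derivative s) (at x within {X (k - 1)..X k}))"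
    and "mesh_mid X k \<notin> layer_region \<Longrightarrow> p_bar xL xR p b \<delta> X k x = p (mesh_mid X k)"
    and "x \<in> {X (k - 1)..X k} \<Longrightarrow> \<bar>p_bar xL xR p b \<delta> X k x - p (mesh_mid X k)\<bar> \<le> 2 * K * mesh_size N X"
    and "x \<in> {X (k - 1)..X k} \<Longrightarrow> mesh_mid X k \<in> layer_region \<Longrightarrow>
      \<bar>p_bar xL xR p b \<delta> X k x - p x\<bar> \<le> K * (mesh_size N X)\<^sup>2"
proof -
  let ?P = "p_bar xL xR p b \<delta> X k" and ?m = "mesh_mid X k" and ?h = "mesh_size N X"
  define y where "y = expansion_point layer_points X k"
  note sub = mesh_Icc_subset(1)[OF mesh k]
  have y: "y \<in> {X (k - 1)..X k}"
    using mesh_mid_in[OF mesh k] by (auto simp: y_def expansion_point_def)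
  have m: "?m \<in> {X (k - 1)..X k}" using mesh_mid_in[OF mesh k] by auto
  have dist: "\<bar>s - t\<bar> \<le> ?h" if "s \<in> {X (k - 1)..X k}" "t \<in> {X (k - 1)..X k}" for s t
    using that mesh_width_le[OF k, of X] by (auto simp: abs_le_iff)
  have h0: "?h > 0" by (rule mesh_size_bounds(1)[OF mesh])
  have yI: "y \<in> {xL..xR}" and mI: "?m \<in> {xL..xR}" using y m sub by auto
  have P: "?P = (\<lambda>x. if ?m \<notin> layer_region then p ?m else p1 y * (x - y) + p y)"
    using deriv_Icc_eq[OF less yI p_deriv[OF yI]] mI
    by (auto simp: p_bar_def regular_region_def layer_region_def y_def layer_points_def Let_def fun_eq_iff)
  show "\<exists>s. \<bar>s\<bar> \<le> K \<and> (\<forall>x. (?P has_real_derivative s) (at x within {X (k - 1)..X k}))"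
  proof (cases "?m \<in> layer_region")
    case True
    then show ?thesis unfolding P using p1_le[OF yI]
      by (intro exI[of _ "p1 y"]) (auto intro!: derivative_eq_intros)
  next
    case False
    then show ?thesis unfolding P using K_pos by (intro exI[of _ 0]) auto
  qed
  show "?P x = p ?m" if "?m \<notin> layer_region" using that by (simp add: P)
  show "\<bar>?P x - p ?m\<bar> \<le> 2 * K * ?h" if x: "x \<in> {X (k - 1)..X k}"
  proof (cases "?m \<in> layer_region")
    case True
    have "\<bar>p1 y * (x - y)\<bar> \<le> K * ?h"
      unfolding abs_mult using p1_le[OF yI] dist[OF x y] K_pos by (intro mult_mono) auto
    moreover have "K * \<bar>y - ?m\<bar> \<le> K * ?h" using dist[OF y m] K_pos by (intro mult_left_mono) auto
    ultimately show ?thesis using True p_lipschitz[OF yI mI] by (simp add: P abs_le_iff)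
  next
    case False
    then show ?thesis using K_pos h0 by (simp add: P)
  qed
  show "\<bar>?P x - p x\<bar> \<le> K * ?h\<^sup>2" if x: "x \<in> {X (k - 1)..X k}" and L: "?m \<in> layer_region"
  proof -
    have "\<bar>p x - (p1 y * (x - y) + p y)\<bar> \<le> K * (x - y)\<^sup>2"
      using x sub yI by (intro taylor2_within[OF p_deriv p1_deriv p2_le]) auto
    also have "\<dots> \<le> K * ?h\<^sup>2"
    proof (rule mult_left_mono)
      have "\<bar>x - y\<bar>\<^sup>2 \<le> ?h\<^sup>2" using dist[OF x y] by (intro power_mono) auto
      then show "(x - y)\<^sup>2 \<le> ?h\<^sup>2" by simp
    qed (use K_pos in auto)
    finally show ?thesis using L by (simp add: P abs_minus_commute)
  qed
qed

lemma exact_bounds: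
  assumes sol: "pw_solution xL xR 1 Y eps (\<lambda>k. p) (\<lambda>k. b) (\<lambda>k. f) u V" and eps: "eps \<le> 1"
    and U: "\<bar>u xL\<bar> \<le> U" "\<bar>u xR\<bar> \<le> U"
    and conv: "b0 > 0 \<or> c > 0 \<and> (\<sigma> = 1 \<or> \<sigma> = -1) \<and> (\<forall>x\<in>{xL..xR}. \<sigma> * p x \<ge> c)"
  shows "\<And>x. x \<in> {xL..xR} \<Longrightarrow> \<bar>u x\<bar> \<le> sol_const U c"
    and "\<And>x. x \<in> {xL..xR} \<Longrightarrow> eps * \<bar>V x\<bar> \<le> sol_const U c"
    and "integral {xL..xR} (\<lambda>x. \<bar>V x\<bar>) \<le> sol_const U c"
proof -
  have Y: "Y 0 = xL" "Y (Suc 0) = xR"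
    using pw_solution.mesh[OF sol] by (auto simp: is_mesh_def)
  have le: "\<bar>p x\<bar> \<le> K + 2 * K * (xR - xL)" if "x \<in> {xL..xR}" for x
  proof -
    have "2 * K * (xR - xL) \<ge> 0" using K_pos less by simp
    then show ?thesis using p_le[OF that] by linarith
  qed
  note bounds = solution_bounds[where P' = "\<lambda>k. p1" and B' = "\<lambda>k. b1" and F' = "\<lambda>k. f1"
      and \<mu> = "\<lambda>_. 0" and \<sigma> = \<sigma>, OF sol eps _ _ _ _ _ _ _ _ _ _ _ _ _ U]
  show "\<bar>u x\<bar> \<le> sol_const U c" if "x \<in> {xL..xR}" for x
    by (rule bounds(1)[OF _ _ _ _ _ _ _ _ _ _ _ _ _ _ that])
      (use conv less in \<open>auto simp: Y p_deriv b_deriv f_deriv p1_le b1_le f1_le b_le f_le le b_ge\<close>)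
  show "eps * \<bar>V x\<bar> \<le> sol_const U c" if "x \<in> {xL..xR}" for x
    by (rule bounds(2)[OF _ _ _ _ _ _ _ _ _ _ _ _ _ _ that])
      (use conv less in \<open>auto simp: Y p_deriv b_deriv f_deriv p1_le b1_le f1_le b_le f_le le b_ge\<close>)
  show "integral {xL..xR} (\<lambda>x. \<bar>V x\<bar>) \<le> sol_const U c"
    by (rule bounds(3))
      (use conv less in \<open>auto simp: Y p_deriv b_deriv f_deriv p1_le b1_le f1_le b_le f_le le b_ge\<close>)
qed

text \<open>In the convective alternative the margin is halved:
  \<open>\<sigma> * p \<ge> 2 * c\<close> and a deviation of at most
  \<open>2 * K * h \<le> c\<close> leave \<open>\<sigma> * P \<ge> c\<close>.\<close>

lemma approx_bounds:
  assumes sol: "pw_solution xL xR N X eps (p_bar xL xR p b \<delta> X) (\<lambda>k x. b (mesh_mid X k))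
      (\<lambda>k x. f (mesh_mid X k)) uh v" and eps: "eps \<le> 1"
    and U: "\<bar>uh xL\<bar> \<le> U" "\<bar>uh xR\<bar> \<le> U"
    and conv: "b0 > 0 \<or> c > 0 \<and> (\<sigma> = 1 \<or> \<sigma> = -1) \<and> (\<forall>x\<in>{xL..xR}. \<sigma> * p x \<ge> 2 * c) \<and>
      2 * K * mesh_size N X \<le> c"
  shows "\<And>x. x \<in> {xL..xR} \<Longrightarrow> \<bar>uh x\<bar> \<le> sol_const U c"
    and "\<And>x. x \<in> {xL..xR} \<Longrightarrow> eps * \<bar>v x\<bar> \<le> sol_const U c"
    and "integral {xL..xR} (\<lambda>x. \<bar>v x\<bar>) \<le> sol_const U c"
proof -
  let ?P = "p_bar xL xR p b \<delta> X" and ?m = "mesh_mid X"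
  have mesh: "is_mesh xL xR N X" using sol by (rule pw_solution.mesh)
  have N: "N \<ge> 1" using mesh less by (cases N) (auto simp: is_mesh_def)
  note P_props = p_bar_properties[OF mesh]
  have "\<forall>k\<in>{1..N}. \<exists>s. \<bar>s\<bar> \<le> K \<and> (\<forall>x. (?P k has_real_derivative s) (at x within {X (k - 1)..X k}))"
    using P_props(1) by blast
  then obtain s where s: "\<And>k. k \<in> {1..N} \<Longrightarrow> \<bar>s k\<bar> \<le> K"
    "\<And>k x. k \<in> {1..N} \<Longrightarrow> (?P k has_real_derivative s k) (at x within {X (k - 1)..X k})"
    unfolding bchoice_iff by blast
  have mI: "?m k \<in> {xL..xR}" if "k \<in> {1..N}" for k
    using mesh_mid_in[OF mesh that] mesh_Icc_subset(1)[OF mesh that] by auto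
  have le: "\<bar>?P k x\<bar> \<le> K + 2 * K * (xR - xL)" if "k \<in> {1..N}" "x \<in> {X (k - 1)..X k}" for k x
  proof -
    have "2 * K * mesh_size N X \<le> 2 * K * (xR - xL)" using mesh_size_bounds(2)[OF mesh] K_pos by simp
    then show ?thesis using P_props(3)[OF that] p_le[OF mI[OF that(1)]] by linarith
  qed
  have step: "\<bar>g (?m (Suc k)) - g (?m k)\<bar> \<le> K * (?m (Suc k) - ?m k)"
    if k: "k \<in> {1..<N}" and g: "\<And>x y. x \<in> {xL..xR} \<Longrightarrow> y \<in> {xL..xR} \<Longrightarrow> \<bar>g x - g y\<bar> \<le> K * \<bar>x - y\<bar>" for k and g :: "real \<Rightarrow> real"
  proof -
    have "?m k \<le> ?m (Suc k)" using k by (intro mesh_mid_mono[OF mesh]) auto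
    moreover have "?m k \<in> {xL..xR}" "?m (Suc k) \<in> {xL..xR}" using k by (auto intro!: mI simp del: atLeastAtMost_iff) auto
    ultimately show ?thesis using g[of "?m (Suc k)" "?m k"] by simp
  qed
  have \<mu>: "?m N - ?m 1 \<le> xR - xL" using mI[of N] mI[of 1] N by auto
  have conv': "b0 > 0 \<or> c > 0 \<and> (\<sigma> = 1 \<or> \<sigma> = -1) \<and> (\<forall>k\<in>{1..N}. \<forall>x\<in>{X (k - 1)..X k}. \<sigma> * ?P k x \<ge> c)"
  proof (cases "b0 > 0")
    case False
    then have c: "c > 0" and sg: "\<sigma> = 1 \<or> \<sigma> = -1" and p: "\<And>x. x \<in> {xL..xR} \<Longrightarrow> \<sigma> * p x \<ge> 2 * c"
      and small: "2 * K * mesh_size N X \<le> c"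
      using conv by auto
    have "\<sigma> * ?P k x \<ge> c" if "k \<in> {1..N}" "x \<in> {X (k - 1)..X k}" for k x
    proof -
      have "\<bar>?P k x - p (?m k)\<bar> \<le> c" using P_props(3)[OF that] small by linarith
      then show ?thesis using sg p[OF mI[OF that(1)]] by auto
    qed
    then show ?thesis using sg c by auto
  qed auto
  note bounds = solution_bounds[where P' = "\<lambda>k x. s k" and B' = "\<lambda>k x. 0" and F' = "\<lambda>k x. 0"
      and \<mu> = ?m and \<sigma> = \<sigma>, OF sol eps s(2) DERIV_const DERIV_const s(1) _ _ le
        b_le[OF mI] f_le[OF mI] b_ge[OF mI] step[OF _ f_lipschitz] step[OF _ b_lipschitz] \<mu> U conv']
  show "\<bar>uh x\<bar> \<le> sol_const U c" if "x \<in> {xL..xR}" for x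
    by (rule bounds(1)) (use K_pos that in auto)
  show "eps * \<bar>v x\<bar> \<le> sol_const U c" if "x \<in> {xL..xR}" for x
    by (rule bounds(2)) (use K_pos that in auto)
  show "integral {xL..xR} (\<lambda>x. \<bar>v x\<bar>) \<le> sol_const U c"
    by (rule bounds(3)) (use K_pos in auto)
qed

end

section \<open>From the energy estimate to uniform convergence\<close>

context error_setting
begin

definition C_total :: real where "C_total = C_energy * (1 + 2 / coercivity)"

lemma total_estimate:
  "eps * integral {xL..xR} (\<lambda>x. (V x - v x)\<^sup>2) + integral {xL..xR} (\<lambda>x. (u x - uh x)\<^sup>2) \<le> C_total * h\<^sup>2"
proof -
  let ?Y = "integral {xL..xR} (\<lambda>x. (y x)\<^sup>2)" and ?E = "integral {xL..xR} (\<lambda>x. (e x)\<^sup>2)"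
  have nn: "?Y \<ge> 0" "?E \<ge> 0"
    by (intro integral_nonneg integrable_continuous_real continuous_intros cont_e cont_y; simp)+
  then have nn': "eps * ?Y \<ge> 0" "coercivity / 2 * ?E \<ge> 0"
    using exact.eps_pos coercivity_pos by simp_all
  have "coercivity / 2 * ?E \<le> C_energy * h\<^sup>2" using energy_estimate nn' by linarith
  then have "?E \<le> 2 / coercivity * (C_energy * h\<^sup>2)"
    using coercivity_pos by (simp add: field_simps)
  moreover have "eps * ?Y \<le> C_energy * h\<^sup>2" using energy_estimate nn' by linarith
  ultimately have "eps * ?Y + ?E \<le> C_total * h\<^sup>2" by (simp add: C_total_def algebra_simps)
  then show ?thesis by (simp add: y_def e_def)
qed

end

lemma energy_norm_square:
  assumes less: "a < b" and eps: "eps > 0"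
    and der: "\<And>x. x \<in> {a..b} \<Longrightarrow> (g has_real_derivative g' x) (at x within {a..b})"
    and cont: "continuous_on {a..b} g'"
  shows "energy_norm eps a b g = sqrt (eps * integral {a..b} (\<lambda>x. (g' x)\<^sup>2) + integral {a..b} (\<lambda>x. (g x)\<^sup>2))"
proof -
  have "(L2_norm a b g)\<^sup>2 = integral {a..b} (\<lambda>x. (g x)\<^sup>2)"
    using less DERIV_continuous_on[OF der] by (intro L2_norm_square) auto
  moreover have "(L2_norm a b (deriv g))\<^sup>2 = integral {a..b} (\<lambda>x. (g' x)\<^sup>2)"
  proof (rule L2_norm_square[OF _ cont])
    fix x assume "x \<in> {a<..<b}"
    then have "DERIV g x :> g' x" using der[of x] by (auto simp: at_within_Icc_at)
    then show "deriv g x = g' x" by (rule DERIV_imp_deriv)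
  qed (use less in auto)
  ultimately show ?thesis by (simp add: energy_norm_def add.commute)
qed

lemma (in coefficients) convergence:
  "\<exists>C h0. h0 > 0 \<and> (\<forall>eps N X u uh.
     0 < eps \<and> eps \<le> 1 \<and> is_mesh xL xR N X \<and> {z \<in> {xL<..<xR}. p z = 0} \<subseteq> X ` {0..N} \<and>
     (b0 > 0 \<or> mesh_size N X \<le> h0) \<and>
     exact_solution xL xR p b f uL uR eps u \<and> approx_solution xL xR p b f uL uR \<delta> eps N X uh \<longrightarrow>
       energy_norm eps xL xR (\<lambda>x. u x - uh x) \<le> C * mesh_size N X)"
proof -
  obtain \<eta> where \<eta>: "zone_radius \<eta>" using zone_radius_exists by blast
  then have "min \<eta> \<delta> / 4 > 0" using \<delta>_pos by (auto simp: zone_radius_def)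
  then obtain c1 where c1: "c1 > 0"
    and away: "\<forall>x\<in>{xL..xR}. (\<forall>z\<in>zeros. min \<eta> \<delta> / 4 \<le> \<bar>x - z\<bar>) \<longrightarrow> c1 \<le> \<bar>p x\<bar>"
    using away_from_zeros by blast
  interpret zones xL xR \<gamma>0 b0 \<delta> K p p1 p2 b b1 f f1 \<eta> c1
    using \<eta> c1 away by unfold_locales auto
  define L where "L = xR - xL"
  define U where "U = max \<bar>uL\<bar> \<bar>uR\<bar>"
  define M where "M = sol_const U (c1 / 2)"
  \<comment> \<open>The last entry gives \<open>6 * K * h \<le> c1\<close>, which covers both
    \<open>3 * K * h \<le> c1 / 2\<close> for the error analysis and
    \<open>2 * K * h \<le> c1 / 2\<close> for the sign of the approximate convection.\<close>
  define h0 where "h0 = min (min (\<eta> / 2) (\<delta> / 2)) (c1 / (6 * K))"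
  have h0: "h0 > 0" using \<eta>_pos \<delta>_pos c1 K_pos by (simp add: h0_def)
  \<comment> \<open>The arguments of the exported constant show its uniformity: neither
    \<open>eps\<close> nor the mesh nor a solution is among them.\<close>
  define C1 where "C1 = error_setting.C_total xL xR \<gamma>0 b0 \<delta> K p b \<eta> c1 M"
  define C2 where "C2 = 4 * M\<^sup>2 + 4 * M\<^sup>2 * L"
  \<comment> \<open>If \<open>b0\<close> is not positive, \<open>p\<close> has no zero; then the
    lower bound \<open>c1\<close> for \<open>\<bar>p\<bar>\<close> holds everywhere and
    \<open>p\<close> keeps its sign.\<close>
  have sign: "\<exists>\<sigma>. (\<sigma> = 1 \<or> \<sigma> = -1) \<and> (\<forall>x\<in>{xL..xR}. \<sigma> * p x \<ge> c1)" if "\<not> b0 > 0"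
  proof -
    have "zeros = {}" using at_zero that by (auto simp: zeros_def)
    then have c: "c1 \<le> \<bar>p x\<bar>" if "x \<in> {xL..xR}" for x using away that by auto
    have same: "p xL > 0 \<longleftrightarrow> p x > 0" if x: "x \<in> {xL..xR}" for x
    proof (rule same_sign_if_nonzero[where g = p])
      show "p t \<noteq> 0" if "t \<in> {xL..x}" for t using c[of t] c1 x that by auto
    qed (use x in \<open>auto intro: continuous_on_subset[OF p_cont]\<close>)
    show ?thesis
    proof (cases "p xL > 0")
      case True
      then have "\<forall>x\<in>{xL..xR}. 1 * p x \<ge> c1" using c same by fastforce
      then show ?thesis by blast
    next
      case False
      then have "\<forall>x\<in>{xL..xR}. (-1) * p x \<ge> c1" using c same by fastforce
      then show ?thesis by blast
    qed
  qed
  have main: "energy_norm eps xL xR (\<lambda>x. u x - uh x) \<le> max (sqrt C1) (sqrt C2 / h0) * mesh_size N X"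
    if eps: "0 < eps" "eps \<le> 1" and mesh: "is_mesh xL xR N X"
      and zeros_mesh: "{z \<in> {xL<..<xR}. p z = 0} \<subseteq> X ` {0..N}"
      and small: "b0 > 0 \<or> mesh_size N X \<le> h0"
      and ex: "exact_solution xL xR p b f uL uR eps u"
      and ap: "approx_solution xL xR p b f uL uR \<delta> eps N X uh" for eps N X u uh
  proof -
    let ?P = "p_bar xL xR p b \<delta> X" and ?m = "mesh_mid X"
    define h where "h = mesh_size N X"
    have h: "h > 0" "h \<le> L" using mesh_size_bounds[OF mesh] by (auto simp: h_def L_def)
    note P_props = p_bar_properties[OF mesh, folded h_def]
    have P_cont: "continuous_on {X (k - 1)..X k} (?P k)" if k: "k \<in> {1..N}" for k
    proof -
      obtain s where "\<And>x. (?P k has_real_derivative s) (at x within {X (k - 1)..X k})"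
        using P_props(1)[OF k] by blast
      then show ?thesis by (rule DERIV_continuous_on)
    qed
    obtain V where V: "pw_solution xL xR 1 (\<lambda>k. if k = 0 then xL else xR) eps (\<lambda>k. p) (\<lambda>k. b) (\<lambda>k. f) u V"
      using exact_solution_pw[OF less eps(1) p_cont DERIV_continuous_on[OF b_deriv] DERIV_continuous_on[OF f_deriv] ex]
      by blast
    obtain v where v: "pw_solution xL xR N X eps ?P (\<lambda>k x. b (?m k)) (\<lambda>k x. f (?m k)) uh v"
      using approx_solution_pw[OF less eps(1) mesh P_cont ap] by blast
    interpret exact: pw_solution xL xR 1 "\<lambda>k. if k = 0 then xL else xR" eps "\<lambda>k. p" "\<lambda>k. b" "\<lambda>k. f" u V by (rule V)
    interpret approx: pw_solution xL xR N X eps ?P "\<lambda>k x. b (?m k)" "\<lambda>k x. f (?m k)" uh v by (rule v)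
    have ends: "u xL = uL" "u xR = uR" "uh xL = uL" "uh xR = uR"
      using ex ap by (auto simp: exact_solution_def approx_solution_def)
    obtain \<sigma> where \<sigma>: "b0 > 0 \<or> (\<sigma> = 1 \<or> \<sigma> = -1) \<and> (\<forall>x\<in>{xL..xR}. \<sigma> * p x \<ge> c1)"
      using sign by blast
    have U: "\<bar>u xL\<bar> \<le> U" "\<bar>u xR\<bar> \<le> U" "\<bar>uh xL\<bar> \<le> U" "\<bar>uh xR\<bar> \<le> U"
      using ends by (auto simp: U_def)
    have conv_u: "b0 > 0 \<or> c1 / 2 > 0 \<and> (\<sigma> = 1 \<or> \<sigma> = -1) \<and> (\<forall>x\<in>{xL..xR}. \<sigma> * p x \<ge> c1 / 2)"
      using \<sigma> c1 by (smt (verit) field_sum_of_halves)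
    have small_h: "6 * (K * h) \<le> c1" if "h \<le> h0"
    proof -
      have "h \<le> c1 / (6 * K)" using that by (simp add: h0_def)
      then show ?thesis using K_pos by (simp add: pos_le_divide_eq mult_ac)
    qed
    have conv_uh: "b0 > 0 \<or> c1 / 2 > 0 \<and> (\<sigma> = 1 \<or> \<sigma> = -1) \<and> (\<forall>x\<in>{xL..xR}. \<sigma> * p x \<ge> 2 * (c1 / 2)) \<and>
        2 * K * mesh_size N X \<le> c1 / 2"
    proof (cases "b0 > 0")
      case False
      then have "6 * (K * h) \<le> c1" using small small_h by (auto simp: h_def)
      moreover have "K * h > 0" using K_pos h by simp
      ultimately have "2 * K * mesh_size N X \<le> c1 / 2" by (simp add: h_def)
      then show ?thesis using False \<sigma> c1 by auto
    qed auto
    note bu = exact_bounds[OF V eps(2) U(1,2) conv_u, folded M_def]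
    note buh = approx_bounds[OF v eps(2) U(3,4) conv_uh, folded M_def]
    define E where "E = eps * integral {xL..xR} (\<lambda>x. (V x - v x)\<^sup>2) + integral {xL..xR} (\<lambda>x. (u x - uh x)\<^sup>2)"
    have norm: "energy_norm eps xL xR (\<lambda>x. u x - uh x) = sqrt E"
      unfolding E_def
      by (intro energy_norm_square less eps DERIV_diff exact.w_deriv approx.w_deriv continuous_intros
          exact.v_cont approx.v_cont)
    show ?thesis
    proof (cases "h \<le> h0")
      case True
      have "error_setting xL xR \<gamma>0 b0 \<delta> K p p1 p2 b b1 f f1 \<eta> c1 N X eps ?P uh v (\<lambda>k. if k = 0 then xL else xR) u V h M"
      proof unfold_locales
        show "regular_zeros \<subseteq> X ` {0..N}"
        proof
          fix z assume "z \<in> regular_zeros"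
          from regular_zeroD(2-4)[OF this] show "z \<in> X ` {0..N}" using zeros_mesh by auto
        qed
        show "X k - X (k - 1) \<le> h" if "k \<in> {1..N}" for k
          using mesh_width_le[OF that] by (simp add: h_def)
        show "h \<le> \<eta> / 2" "h \<le> \<delta> / 2" using True by (auto simp: h0_def)
        show "3 * K * h \<le> c1 / 2" using small_h[OF True] by simp
        show "?P k x = p (?m k)" if "k \<in> {1..N}" "x \<in> {X (k - 1)..X k}" "?m k \<notin> layer_region" for k x
          using P_props(2)[OF that(1,3)] .
        show "\<bar>?P k x - p x\<bar> \<le> K * h\<^sup>2" if "k \<in> {1..N}" "x \<in> {X (k - 1)..X k}" "?m k \<in> layer_region" for k x
          using P_props(4)[OF that] .
        show "u xL = uh xL" "u xR = uh xR" using ends by auto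
      qed (fact P_cont P_props(3) bu buh)+
      then have "E \<le> C1 * h\<^sup>2" unfolding E_def C1_def by (rule error_setting.total_estimate)
      then have "sqrt E \<le> sqrt C1 * h" using real_sqrt_le_mono h by (fastforce simp: real_sqrt_mult)
      also have "\<dots> \<le> max (sqrt C1) (sqrt C2 / h0) * h" using h by (intro mult_right_mono) auto
      finally show ?thesis by (simp add: norm h_def)
    next
      case False
      have M0: "M \<ge> 0" using bu(1)[of xL] less by auto
      have ie: "(\<lambda>x. (u x - uh x)\<^sup>2) integrable_on {xL..xR}" and iy: "(\<lambda>x. eps * (V x - v x)\<^sup>2) integrable_on {xL..xR}"
        and iv: "(\<lambda>x. 2 * M * (\<bar>V x\<bar> + \<bar>v x\<bar>)) integrable_on {xL..xR}"
        by (intro integrable_continuous_real continuous_intros exact.w_cont approx.w_cont exact.v_cont approx.v_cont)+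
      have "integral {xL..xR} (\<lambda>x. (u x - uh x)\<^sup>2) \<le> integral {xL..xR} (\<lambda>x. (2 * M)\<^sup>2)"
      proof (rule integral_le[OF ie])
        fix x assume x: "x \<in> {xL..xR}"
        have "\<bar>u x - uh x\<bar> \<le> 2 * M" using bu(1)[OF x] buh(1)[OF x] by auto
        then have "\<bar>u x - uh x\<bar>\<^sup>2 \<le> (2 * M)\<^sup>2" by (intro power_mono) auto
        then show "(u x - uh x)\<^sup>2 \<le> (2 * M)\<^sup>2" by simp
      qed auto
      then have 1: "integral {xL..xR} (\<lambda>x. (u x - uh x)\<^sup>2) \<le> 4 * M\<^sup>2 * L"
        using less by (simp add: L_def power_mult_distrib algebra_simps)
      \<comment> \<open>For coarse meshes one factor is bounded pointwise,
        \<open>eps * \<bar>V - v\<bar> \<le> 2 * M\<close>, and the other one by the variations of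
        \<open>u\<close> and \<open>uh\<close>.\<close>
      have "integral {xL..xR} (\<lambda>x. eps * (V x - v x)\<^sup>2) \<le> integral {xL..xR} (\<lambda>x. 2 * M * (\<bar>V x\<bar> + \<bar>v x\<bar>))"
      proof (rule integral_le[OF iy iv])
        fix x assume x: "x \<in> {xL..xR}"
        have "\<bar>V x - v x\<bar> \<le> \<bar>V x\<bar> + \<bar>v x\<bar>" by simp
        then have "eps * \<bar>V x - v x\<bar> \<le> eps * (\<bar>V x\<bar> + \<bar>v x\<bar>)" using eps by simp
        also have "\<dots> \<le> 2 * M" using bu(2)[OF x] buh(2)[OF x] by (simp add: distrib_left)
        finally have "(eps * \<bar>V x - v x\<bar>) * \<bar>V x - v x\<bar> \<le> 2 * M * (\<bar>V x\<bar> + \<bar>v x\<bar>)"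
          by (rule mult_mono) (use M0 in auto)
        then show "eps * (V x - v x)\<^sup>2 \<le> 2 * M * (\<bar>V x\<bar> + \<bar>v x\<bar>)"
          by (simp add: power2_eq_square mult.assoc abs_mult_self_eq)
      qed
      also have "\<dots> = 2 * M * (integral {xL..xR} (\<lambda>x. \<bar>V x\<bar>) + integral {xL..xR} (\<lambda>x. \<bar>v x\<bar>))"
        by (simp add: Henstock_Kurzweil_Integration.integral_add[OF exact.abs_v_integrable approx.abs_v_integrable])
      also have "\<dots> \<le> 2 * M * (M + M)" using bu(3) buh(3) M0 by (intro mult_left_mono) auto
      finally have 2: "eps * integral {xL..xR} (\<lambda>x. (V x - v x)\<^sup>2) \<le> 4 * M\<^sup>2"
        by (simp add: power2_eq_square)
      have "E \<le> C2" using 1 2 by (simp add: E_def C2_def)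
      then have "sqrt E \<le> sqrt C2 / h0 * h0" using h0 by simp
      also have "\<dots> \<le> sqrt C2 / h0 * h" using False h0 by (intro mult_left_mono) (auto simp: C2_def L_def less_imp_le[OF less])
      also have "\<dots> \<le> max (sqrt C1) (sqrt C2 / h0) * h" using h by (intro mult_right_mono) auto
      finally show ?thesis by (simp add: norm h_def)
    qed
  qed
  show ?thesis
    by (rule exI[of _ "max (sqrt C1) (sqrt C2 / h0)"], rule exI[of _ h0]) (use h0 main in blast)
qed

lemma continuous_on_Icc_abs_bounded:
  fixes g :: "real \<Rightarrow> real"
  assumes "continuous_on {a..b} g"
  shows "\<exists>B\<ge>0. \<forall>x\<in>{a..b}. \<bar>g x\<bar> \<le> B"
proof -
  have "bounded (g ` {a..b})"
    using compact_continuous_image[OF assms] by (intro compact_imp_bounded) auto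
  then obtain B where "B > 0" "\<forall>y\<in>g ` {a..b}. norm y \<le> B" by (auto simp: bounded_pos)
  then show ?thesis by (intro exI[of _ B]) auto
qed

theorem theorem3p2:
  fixes xL xR uL uR \<gamma>0 b0 \<delta> :: real and p b f :: "real \<Rightarrow> real"
  assumes "xL < xR"
    and "C_infinity_on {xL..xR} p" and "C_infinity_on {xL..xR} b" and "C_infinity_on {xL..xR} f"
    and "finite {z \<in> {xL..xR}. p z = 0}"
    and "\<forall>z\<in>{xL..xR}. p z = 0 \<longrightarrow> deriv_Icc xL xR p z \<noteq> 0"
    and "\<gamma>0 > 0" and "\<forall>x\<in>{xL..xR}. b x - deriv_Icc xL xR p x \<ge> \<gamma>0"
    and "\<forall>x\<in>{xL..xR}. b x \<ge> b0"
    and "if \<exists>z\<in>{xL..xR}. p z = 0 then b0 > 0 else b0 \<ge> 0"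
    and "\<delta> > 0"
    and "\<forall>s\<in>singular_points xL xR p b. \<forall>t\<in>singular_points xL xR p b.
           s \<noteq> t \<longrightarrow> \<delta> < \<bar>s - t\<bar> / 3"
  shows "\<exists>C h0 :: real. h0 > 0 \<and>
    (\<forall>eps N X u uh.
       0 < eps \<and> eps \<le> 1 \<and>
       is_mesh xL xR N X \<and>
       singular_points xL xR p b \<union> {z \<in> {xL<..<xR}. p z = 0} \<subseteq> X ` {0..N} \<and>
       (b0 > 0 \<or> mesh_size N X \<le> h0) \<and>
       exact_solution xL xR p b f uL uR eps u \<and>
       approx_solution xL xR p b f uL uR \<delta> eps N X uh \<longrightarrow>
         L2_norm xL xR (\<lambda>x. u x - uh x) \<le> energy_norm eps xL xR (\<lambda>x. u x - uh x) \<and>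
         energy_norm eps xL xR (\<lambda>x. u x - uh x) \<le> C * mesh_size N X)"
proof -
  note asm = assms
  have C2: "C_k_on 2 {xL..xR} p" "C_k_on 2 {xL..xR} b" "C_k_on 2 {xL..xR} f"
    using asm(2-4) by (auto simp: C_infinity_on_def)
  obtain p1 p2 where p: "\<And>x. x \<in> {xL..xR} \<Longrightarrow> (p has_real_derivative p1 x) (at x within {xL..xR})"
    "\<And>x. x \<in> {xL..xR} \<Longrightarrow> (p1 has_real_derivative p2 x) (at x within {xL..xR})" "continuous_on {xL..xR} p2"
    using C_k_on_2E[OF C2(1)] by metis
  obtain b1 b2 where b: "\<And>x. x \<in> {xL..xR} \<Longrightarrow> (b has_real_derivative b1 x) (at x within {xL..xR})"
    "\<And>x. x \<in> {xL..xR} \<Longrightarrow> (b1 has_real_derivative b2 x) (at x within {xL..xR})" "continuous_on {xL..xR} b2"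
    using C_k_on_2E[OF C2(2)] by metis
  obtain f1 f2 where f: "\<And>x. x \<in> {xL..xR} \<Longrightarrow> (f has_real_derivative f1 x) (at x within {xL..xR})"
    "\<And>x. x \<in> {xL..xR} \<Longrightarrow> (f1 has_real_derivative f2 x) (at x within {xL..xR})" "continuous_on {xL..xR} f2"
    using C_k_on_2E[OF C2(3)] by metis
  have d: "deriv_Icc xL xR p x = p1 x" if "x \<in> {xL..xR}" for x
    using asm(1) that p(1)[OF that] by (rule deriv_Icc_eq)
  let ?gs = "{p, p1, p2, b, b1, f, f1}"
  have "\<forall>g\<in>?gs. \<exists>B\<ge>0. \<forall>x\<in>{xL..xR}. \<bar>g x\<bar> \<le> B"
    using DERIV_continuous_on[OF p(1)] DERIV_continuous_on[OF p(2)] p(3) DERIV_continuous_on[OF b(1)]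
      DERIV_continuous_on[OF b(2)] DERIV_continuous_on[OF f(1)] DERIV_continuous_on[OF f(2)]
    by (auto intro!: continuous_on_Icc_abs_bounded)
  then obtain B where B: "\<forall>g\<in>?gs. 0 \<le> B g \<and> (\<forall>x\<in>{xL..xR}. \<bar>g x\<bar> \<le> B g)"
    unfolding bchoice_iff by blast
  \<comment> \<open>One constant bounds all data and the derivatives that occur; the summand
    \<open>1\<close> keeps it positive even for vanishing data.\<close>
  define K where "K = 1 + (\<Sum>g\<in>?gs. B g)"
  have B_le: "B g \<le> K" if "g \<in> ?gs" for g
  proof -
    have "B g \<le> (\<Sum>g\<in>?gs. B g)" by (rule member_le_sum[OF that]) (use B in auto)
    then show ?thesis by (simp add: K_def)
  qed
  have K: "\<bar>g x\<bar> \<le> K" if "g \<in> ?gs" "x \<in> {xL..xR}" for g x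
    using order_trans[OF _ B_le[OF that(1)]] B that by blast
  have "(\<Sum>g\<in>?gs. B g) \<ge> 0" by (rule sum_nonneg) (use B in blast)
  then have K_pos: "K > 0" by (simp add: K_def)
  have z: "b0 > 0 \<and> p1 x \<noteq> 0" if "x \<in> {xL..xR}" "p x = 0" for x
    using asm(6,10) that d[OF that(1)] by (auto split: if_splits)
  have b0: "b0 \<ge> 0" using asm(10) by (auto split: if_splits)
  interpret coefficients xL xR \<gamma>0 b0 \<delta> K p p1 p2 b b1 f f1
  proof
    show "\<gamma>0 \<le> b x - p1 x" if "x \<in> {xL..xR}" for x
      using bspec[OF asm(8) that] d[OF that] by simp
    show "\<bar>p x\<bar> \<le> K" "\<bar>p1 x\<bar> \<le> K" "\<bar>p2 x\<bar> \<le> K" "\<bar>b x\<bar> \<le> K" "\<bar>b1 x\<bar> \<le> K" "\<bar>f x\<bar> \<le> K" "\<bar>f1 x\<bar> \<le> K"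
      if "x \<in> {xL..xR}" for x
      using K[OF _ that] by simp_all
    show "b0 \<le> b x" if "x \<in> {xL..xR}" for x using bspec[OF asm(9) that] .
    show "0 < b0 \<and> p1 x \<noteq> 0" if "x \<in> {xL..xR}" "p x = 0" for x using z[OF that] .
  qed (fact asm(1,5,7,11) p(1,2) b(1) f(1) K_pos b0)+
  obtain C h0 where h0: "h0 > 0" and C: "\<And>eps N X u uh.
     0 < eps \<and> eps \<le> 1 \<and> is_mesh xL xR N X \<and> {z \<in> {xL<..<xR}. p z = 0} \<subseteq> X ` {0..N} \<and>
     (b0 > 0 \<or> mesh_size N X \<le> h0) \<and>
     exact_solution xL xR p b f uL uR eps u \<and> approx_solution xL xR p b f uL uR \<delta> eps N X uh \<Longrightarrow>
       energy_norm eps xL xR (\<lambda>x. u x - uh x) \<le> C * mesh_size N X"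
    using convergence[of uL uR] by blast
  have le: "L2_norm xL xR g \<le> energy_norm eps xL xR g" if "0 < eps" for eps g
    using L2_norm_nonneg[of xL xR g] that unfolding energy_norm_def by (intro real_le_rsqrt) simp
  show ?thesis
    by (rule exI[of _ C], rule exI[of _ h0]) (use h0 C le in blast)
qed

end
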